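(* Let $q\in\mathbb{C}\setminus\{0\}$, $\delta=q+q^{-1}$, and let $w$ be an infinite link state. Then the $TL_\infty(\delta)$ representation $\mathcal{R}(w)$ is either zero or irreducible.
   Context: $TL_\infty(\delta)$ is the unital $\mathbb{C}$-algebra generated by $\mathbf{1}$ and $e_i$, $i\in\mathbb{N}=\{1,2,\dots\}$, with relations $e_i^2=\delta e_i$, $e_ie_{i\pm1}e_i=e_i$, $e_ie_j=e_je_i$ for $|i-j|>1$; $TL_n(\delta)$ is generated by $1,e_1,\dots,e_{n-1}$ with the same relations. An $(n,p)$-link state is a configuration on the points $1,\dots,n$ with $p$ cups (each joining two points) and $n-2p$ strings (each attached to a single point), non-intersecting: no two cups cross and no string point lies strictly between the endpoints of a cup. $\mathcal{V}_{n,p}$ is the $TL_n(\delta)$ representation with basis the $(n,p)$-link states, acting by diagram concatenation (closed loops replaced by $\delta$; zero if the number of cups increases). $\langle x,y\rangle$ is the bilinear form on $\mathcal{V}_{n,p}$ given on link states by reflecting $x$ and gluing it to $y$: $0$ unless every string of $x$ is connected to a string of $y$, and otherwise $\delta^k$ with $k$ the number of closed loops. $\mathcal{R}_{n,p}$ is the kernel of this form. An infinite link state is the analogous non-intersecting configuration of cups and strings on the points $1,2,3,\dots$. $TL_\infty(\delta)$ acts on the span of all infinite link states by concatenation: $e_iw=0$ if $i,i+1$ are both strings; $e_iw=\delta w$ if $i,i+1$ are joined; if exactly one of $i,i+1$ is a string and the other is joined to $b$, then $e_iw$ has cup $\{i,i+1\}$ and $b$ a string; if $i$ is joined to $a\ne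 i+1$ and $i+1$ to $b$, these cups are replaced by $\{i,i+1\},\{a,b\}$. $\mathcal{X}(w)$ is the subrepresentation generated by $w$. The restriction of an infinite link state to length $n$ deletes all points greater than $n$; if this would cut a cup, one instead restricts to the smallest $n'>n$ for which no cup is cut. An element of $\mathcal{X}(w)$ is a finite linear combination of link states that agree beyond some point, and is restricted, for $n$ large enough, term by term. $\mathcal{R}(w)=\{x\in\mathcal{X}(w):$ there is $n$ such that $x$ restricts to an element of $\mathcal{R}_{n',p}$ for all $n'\ge n\}$ ($p$ depending on $n'$), a subrepresentation of $\mathcal{X}(w)$. *)

theory Defs
  imports Complex_Main "HOL-Library.Poly_Mapping"
begin

text \<open>
  Points and generators are numbered from 0 instead of 1: the point \<open>i\<close> below is the point
  \<open>i + 1\<close> of the mathematical text, and likewise for the generator \<open>e\<^sub>i\<close>.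
\<close>

subsection \<open>The free vector space on a type\<close>

definition scale :: "complex \<Rightarrow> ('a \<Rightarrow>\<^sub>0 complex) \<Rightarrow> ('a \<Rightarrow>\<^sub>0 complex)"
  where "scale c x = Poly_Mapping.map ((*) c) x"

lemma lookup_scale [simp]: "Poly_Mapping.lookup (scale c x) v = c * Poly_Mapping.lookup x v"
  by (simp add: scale_def Poly_Mapping.map.rep_eq when_def)

global_interpretation lc: vector_space scale
  by unfold_locales
    (auto intro!: poly_mapping_eqI simp: lookup_add algebra_simps)

definition lin_ext :: "('a \<Rightarrow> ('b \<Rightarrow>\<^sub>0 complex)) \<Rightarrow> ('a \<Rightarrow>\<^sub>0 complex) \<Rightarrow> ('b \<Rightarrow>\<^sub>0 complex)"
  where "lin_ext f x = (\<Sum>v\<in>Poly_Mapping.keys x. scale (Poly_Mapping.lookup x v) (f v))"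


subsection \<open>The algebra\<close>

text \<open>
  The free unital algebra on the \<open>e\<^sub>i\<close> is the monoid algebra of the free monoid of words.
  Its product is the multiplication of \<^type>\<open>poly_mapping\<close>, which convolves along \<open>+\<close> of the
  monoid; hence concatenation of words is written additively and the empty word is \<open>0\<close>.
\<close>

datatype word = Word (letters: "nat list")

instantiation word :: monoid_add
begin
definition "0 = Word []"
definition "u + v = Word (letters u @ letters v)"
instance by standard (simp_all add: zero_word_def plus_word_def)
end

type_synonym free_alg = "word \<Rightarrow>\<^sub>0 complex"

definition gen :: "nat \<Rightarrow> free_alg"
  where "gen i = Poly_Mapping.single (Word [i]) 1"

text \<open>
  The two-sided ideal generated by the Temperley--Lieb relations. The algebra
  \<open>TL\<^sub>\<infinity>(\<delta>)\<close> is the quotient of \<^typ>\<open>free_alg\<close> by this ideal.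
\<close>

inductive_set tl_ideal :: "complex \<Rightarrow> free_alg set" for \<delta> :: complex where
  square: "gen i * gen i - scale \<delta> (gen i) \<in> tl_ideal \<delta>"
| braid_up: "gen i * gen (Suc i) * gen i - gen i \<in> tl_ideal \<delta>"
| braid_down: "gen (Suc i) * gen i * gen (Suc i) - gen (Suc i) \<in> tl_ideal \<delta>"
| commute: "Suc i < j \<Longrightarrow> gen i * gen j - gen j * gen i \<in> tl_ideal \<delta>"
| zero: "0 \<in> tl_ideal \<delta>"
| add: "a \<in> tl_ideal \<delta> \<Longrightarrow> b \<in> tl_ideal \<delta> \<Longrightarrow> a + b \<in> tl_ideal \<delta>"
| mult_left: "a \<in> tl_ideal \<delta> \<Longrightarrow> r * a \<in> tl_ideal \<delta>"
| mult_right: "a \<in> tl_ideal \<delta> \<Longrightarrow> a * r \<in> tl_ideal \<delta>"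


subsection \<open>Link states\<close>

text \<open>
  A link state on the set of points \<open>S\<close> is encoded as an involution \<open>\<pi>\<close> whose two-element
  orbits are the cups. The fixed points in \<open>S\<close> are the strings; points outside \<open>S\<close> are
  fixed as a mere convention and carry nothing.
\<close>

definition link_state :: "nat set \<Rightarrow> (nat \<Rightarrow> nat) \<Rightarrow> bool"
  where "link_state S \<pi> \<longleftrightarrow>
    (\<forall>i. i \<notin> S \<longrightarrow> \<pi> i = i) \<and> (\<forall>i\<in>S. \<pi> i \<in> S) \<and> (\<forall>i. \<pi> (\<pi> i) = i) \<and>
    (\<forall>a c. \<not> (a < c \<and> c < \<pi> a \<and> \<pi> a < \<pi> c)) \<and>
    (\<forall>a c. a < c \<and> c < \<pi> a \<longrightarrow> \<pi> c \<noteq> c)"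

definition link_states :: "nat \<Rightarrow> nat \<Rightarrow> (nat \<Rightarrow> nat) set"
  where "link_states n p = {\<pi>. link_state {..<n} \<pi> \<and> card {i. i < \<pi> i} = p}"

abbreviation inf_link_state :: "(nat \<Rightarrow> nat) \<Rightarrow> bool"
  where "inf_link_state \<equiv> link_state UNIV"

type_synonym vec = "(nat \<Rightarrow> nat) \<Rightarrow>\<^sub>0 complex"

abbreviation basis :: "(nat \<Rightarrow> nat) \<Rightarrow> vec"
  where "basis v \<equiv> Poly_Mapping.single v 1"


subsection \<open>The bilinear form on \<open>V\<^sub>n\<^sub>,\<^sub>p\<close> and its kernel\<close>

definition glue :: "(nat \<Rightarrow> nat) \<Rightarrow> (nat \<Rightarrow> nat) \<Rightarrow> (nat \<times> nat) set"
  where "glue x y = {(i, j). j = x i \<or> j = y i}\<^sup>*"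

definition loops :: "nat \<Rightarrow> (nat \<Rightarrow> nat) \<Rightarrow> (nat \<Rightarrow> nat) \<Rightarrow> nat set set"
  where "loops n x y =
    {C \<in> (\<lambda>i. glue x y `` {i}) ` {..<n}. \<forall>i\<in>C. x i \<noteq> i \<and> y i \<noteq> i}"

definition state_form :: "complex \<Rightarrow> nat \<Rightarrow> (nat \<Rightarrow> nat) \<Rightarrow> (nat \<Rightarrow> nat) \<Rightarrow> complex"
  where "state_form \<delta> n x y =
    (if \<forall>i<n. x i = i \<longrightarrow> (\<exists>j<n. y j = j \<and> (i, j) \<in> glue x y)
     then \<delta> ^ card (loops n x y) else 0)"

definition form :: "complex \<Rightarrow> nat \<Rightarrow> vec \<Rightarrow> vec \<Rightarrow> complex"
  where "form \<delta> n x y =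
    (\<Sum>u\<in>Poly_Mapping.keys x. \<Sum>v\<in>Poly_Mapping.keys y.
       Poly_Mapping.lookup x u * Poly_Mapping.lookup y v * state_form \<delta> n u v)"

definition standard :: "nat \<Rightarrow> nat \<Rightarrow> vec set"
  where "standard n p = {x. Poly_Mapping.keys x \<subseteq> link_states n p}"

definition radical :: "complex \<Rightarrow> nat \<Rightarrow> nat \<Rightarrow> vec set"
  where "radical \<delta> n p = {x \<in> standard n p. \<forall>y\<in>standard n p. form \<delta> n x y = 0}"


subsection \<open>The action on infinite link states\<close>

definition e_state :: "complex \<Rightarrow> nat \<Rightarrow> (nat \<Rightarrow> nat) \<Rightarrow> vec"
  where "e_state \<delta> i w =
    (let j = Suc i; a = w i; b = w j in
     if a = i \<and> b = j then 0
     else if a = j then scale \<delta> (basis w)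
     else if a = i then basis (w(i := j, j := i, b := b))
     else if b = j then basis (w(i := j, j := i, a := a))
     else basis (w(i := j, j := i, a := b, b := a)))"

definition e_op :: "complex \<Rightarrow> nat \<Rightarrow> vec \<Rightarrow> vec"
  where "e_op \<delta> i = lin_ext (e_state \<delta> i)"

definition act :: "complex \<Rightarrow> free_alg \<Rightarrow> vec \<Rightarrow> vec"
  where "act \<delta> a x =
    (\<Sum>u\<in>Poly_Mapping.keys a. scale (Poly_Mapping.lookup a u) (foldr (e_op \<delta>) (letters u) x))"

definition invariant_subspace :: "complex \<Rightarrow> vec set \<Rightarrow> bool"
  where "invariant_subspace \<delta> V \<longleftrightarrow> lc.subspace V \<and> (\<forall>a. \<forall>x\<in>V. act \<delta> a x \<in> V)"

text \<open>
  The ideal has to act by zero for the action of \<^typ>\<open>free_alg\<close> to be one of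
  \<open>TL\<^sub>\<infinity>(\<delta>)\<close>; this is not automatic, as the type \<^typ>\<open>vec\<close> also contains
  combinations of functions that are not link states.
\<close>

definition TL_rep :: "complex \<Rightarrow> vec set \<Rightarrow> bool"
  where "TL_rep \<delta> V \<longleftrightarrow>
    invariant_subspace \<delta> V \<and> (\<forall>a\<in>tl_ideal \<delta>. \<forall>x\<in>V. act \<delta> a x = 0)"

definition TL_irreducible :: "complex \<Rightarrow> vec set \<Rightarrow> bool"
  where "TL_irreducible \<delta> V \<longleftrightarrow>
    TL_rep \<delta> V \<and> V \<noteq> {0} \<and> (\<forall>U. TL_rep \<delta> U \<and> U \<subseteq> V \<longrightarrow> U = {0} \<or> U = V)"

definition X_rep :: "complex \<Rightarrow> (nat \<Rightarrow> nat) \<Rightarrow> vec set"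
  where "X_rep \<delta> w = {act \<delta> a (basis w) | a. True}"


subsection \<open>Restriction and the radical of \<open>X(w)\<close>\<close>

definition cut :: "(nat \<Rightarrow> nat) \<Rightarrow> nat \<Rightarrow> nat"
  where "cut v n = (LEAST m. n \<le> m \<and> (\<forall>i<m. v i < m))"

definition restr_state :: "nat \<Rightarrow> (nat \<Rightarrow> nat) \<Rightarrow> (nat \<Rightarrow> nat)"
  where "restr_state n v = (\<lambda>i. if i < cut v n then v i else i)"

definition restr :: "nat \<Rightarrow> vec \<Rightarrow> vec"
  where "restr n = lin_ext (\<lambda>v. basis (restr_state n v))"

text \<open>
  The encoding of a finite link state does not record its length, so the common length \<open>m\<close>
  of the restrictions of the terms of \<open>x\<close> is stated separately. The terms of an element
  of \<open>X(w)\<close> agree beyond some point, so such an \<open>m\<close> exists for all large \<open>k\<close>.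
\<close>

definition R_rep :: "complex \<Rightarrow> (nat \<Rightarrow> nat) \<Rightarrow> vec set"
  where "R_rep \<delta> w =
    {x \<in> X_rep \<delta> w. \<exists>n. \<forall>k\<ge>n. \<exists>m p.
       (\<forall>v\<in>Poly_Mapping.keys x. cut v k = m) \<and> restr k x \<in> radical \<delta> m p}"

end

theory Submission
  imports Defs "HOL-Computational_Algebra.Polynomial"
begin

text \<open>
  Let \<open>V k p\<close> be the span of the link states with \<open>k\<close> strings and \<open>p\<close> cups on \<open>k + 2p\<close> points and
  let \<open>Rd k p\<close> be the kernel of its form. An element of \<open>R(w)\<close> is recovered from its restriction to a long
  initial segment of the points by attaching the tail of \<open>w\<close>, and the restriction lies in some \<open>Rd k p\<close>.
  Two elements of \<open>R(w)\<close> can be restricted to the same segment, so everything follows once each nonzero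
  element of \<open>Rd k p\<close> is known to generate all of \<open>Rd k p\<close> (\<open>Rd_irreducible\<close>).

  The generator \<open>e\<^sub>i\<close> factors as \<open>u\<^sub>i c\<^sub>i\<close>, where the cap \<open>c\<^sub>i\<close> joins the points \<open>i\<close> and \<open>i + 1\<close> and removes
  them and the cup \<open>u\<^sub>i\<close> inserts two joined points. Cups and caps satisfy a few relations from which all the algebra
  below is derived, and they are adjoint for the form (\<open>form_cup\<close>). Hence a vector is in the radical if and
  only if all its caps are (\<open>radical_Suc\<close>); in particular every \<^emph>\<open>singular\<close> vector of \<open>V k p\<close> with \<open>p > 0\<close>,
  that is every vector with all caps zero, is in the radical.

  Turning the partner of the last point into a string, and removing the last point, is a map
  \<open>rho : V k (p + 1) \<rightarrow> V (k + 1) p\<close> with kernel \<open>V (k - 1) (p + 1)\<close>. It commutes with the other caps and is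
  injective on singular vectors, so these form a space of dimension at most one for each \<open>k\<close> and \<open>p\<close>.
  With the signed quantum integers \<open>A j = (-1)\<^bsup>j - 1\<^esup> [j]\<close>, every \<open>u\<close> in \<open>V (k + 1) p\<close> has a lift \<open>y\<close> such that
  \<open>rho y = A (k + 1) u\<close> and \<open>\<langle>y, v\<rangle> = - A (k + 2) \<langle>u, rho v\<rangle>\<close> for all \<open>v\<close> (\<open>lift_family\<close>). If \<open>A (k + 1) \<noteq> 0\<close>,
  the form on \<open>V k (p + 1)\<close> is thus the orthogonal sum of the form on \<open>V (k - 1) (p + 1)\<close> and of a multiple of
  the form on \<open>V (k + 1) p\<close>, the multiple being zero precisely if \<open>A (k + 2) = 0\<close>.

  From this one finds the degree of singular vectors: a nonzero one in \<open>V k p\<close> with \<open>p > 0\<close> forces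
  \<open>A (k + 1 + p)\<close> to be the first zero among \<open>A (k + 1), A (k + 2), \<dots>\<close> (\<open>singular_A\<close>), so given \<open>k\<close> there is only one
  such \<open>p\<close>, say \<open>r\<close>. That there is none if \<open>A (k + 1) = 0\<close> is the one point where a deformation of \<open>\<delta>\<close> and
  the simplicity of the zeros of the Chebyshev polynomials \<open>A j\<close> enter. Above degree \<open>r\<close> the radical is
  spanned by the cups of the radical one degree lower (\<open>Rd_generated\<close>).

  Irreducibility is then an induction on \<open>p\<close>. Below degree \<open>r\<close> the radical is zero, in degree \<open>r\<close> it is
  spanned by the singular vector, and above it a nonzero element \<open>x\<close> has a nonzero cap \<open>c\<^sub>i x\<close>; this generates
  the radical one degree lower, whose cups span the radical and are reached from \<open>e\<^sub>i x = u\<^sub>i (c\<^sub>i x)\<close>.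
\<close>

section \<open>Linear extension\<close>

lemma scale_basis: "scale c (Poly_Mapping.single v 1) = Poly_Mapping.single v c"
  by (rule poly_mapping_eqI) (simp add: lookup_single when_def)

lemma lin_ext_superset:
  assumes "finite S" "Poly_Mapping.keys x \<subseteq> S"
  shows "lin_ext f x = (\<Sum>v\<in>S. scale (Poly_Mapping.lookup x v) (f v))"
  unfolding lin_ext_def using assms
  by (intro sum.mono_neutral_left) (auto simp: in_keys_iff)

lemma lin_ext_0 [simp]: "lin_ext f 0 = 0"
  by (simp add: lin_ext_def)

lemma lin_ext_basis [simp]: "lin_ext f (Poly_Mapping.single v c) = scale c (f v)"
  by (subst lin_ext_superset[where S="{v}"]) auto

lemma lin_ext_add: "lin_ext f (x + y) = lin_ext f x + lin_ext f y"
proof -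
  let ?S = "Poly_Mapping.keys x \<union> Poly_Mapping.keys y"
  have "Poly_Mapping.keys (x + y) \<subseteq> ?S" by (rule keys_add)
  then show ?thesis
    by (simp add: lin_ext_superset[where S="?S"] lookup_add lc.scale_left_distrib sum.distrib)
qed

lemma lin_ext_scale: "lin_ext f (scale c x) = scale c (lin_ext f x)"
proof -
  have "Poly_Mapping.keys (scale c x) \<subseteq> Poly_Mapping.keys x"
    by (auto simp: in_keys_iff)
  then show ?thesis
    by (simp add: lin_ext_superset[where S="Poly_Mapping.keys x"] lc.scale_sum_right)
qed

lemma lin_ext_sum: "lin_ext f (\<Sum>i\<in>I. g i) = (\<Sum>i\<in>I. lin_ext f (g i))"
  by (induction I rule: infinite_finite_induct) (simp_all add: lin_ext_add)

lemma lin_ext_diff: "lin_ext f (x - y) = lin_ext f x - lin_ext f y"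
proof -
  have "lin_ext f (x - y) + lin_ext f y = lin_ext f x"
    by (simp flip: lin_ext_add)
  then show ?thesis by (simp add: algebra_simps)
qed

lemma vec_expand: "x = (\<Sum>v\<in>Poly_Mapping.keys x. scale (Poly_Mapping.lookup x v) (Poly_Mapping.single v 1))"
  by (rule poly_mapping_eqI) (simp add: lookup_sum lookup_single when_def if_distrib[of "\<lambda>a. _ * a"] sum.delta in_keys_iff cong: if_cong)

lemma vec_induct [consumes 1, case_names zero add scale basis]:
  assumes "Poly_Mapping.keys x \<subseteq> S" "P 0" "\<And>x y. P x \<Longrightarrow> P y \<Longrightarrow> P (x + y)"
    "\<And>c x. P x \<Longrightarrow> P (scale c x)" "\<And>v. v \<in> S \<Longrightarrow> P (Poly_Mapping.single v 1)"
  shows "P x"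
proof -
  have "P (\<Sum>v\<in>F. scale (Poly_Mapping.lookup x v) (Poly_Mapping.single v 1))" if "finite F" "F \<subseteq> S" for F
    using that by (induction F rule: finite_induct) (auto intro: assms)
  from this[OF finite_keys assms(1)] show ?thesis using vec_expand[of x] by simp
qed

lemma lin_ext_cong:
  assumes "\<And>v. v \<in> Poly_Mapping.keys x \<Longrightarrow> f v = g v"
  shows "lin_ext f x = lin_ext g x"
  using assms by (simp add: lin_ext_def)

lemma lin_ext_lin_ext:
  "lin_ext f (lin_ext g x) = lin_ext (\<lambda>v. lin_ext f (g v)) x"
  by (simp add: lin_ext_def[of _ x] lin_ext_sum lin_ext_scale)

lemma lin_ext_id [simp]: "lin_ext (\<lambda>v. Poly_Mapping.single v 1) x = x"
  using vec_expand[of x] by (simp add: lin_ext_def)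

lemma keys_lin_ext:
  assumes "\<And>v. v \<in> Poly_Mapping.keys x \<Longrightarrow> Poly_Mapping.keys (f v) \<subseteq> S"
  shows "Poly_Mapping.keys (lin_ext f x) \<subseteq> S"
proof
  fix u assume "u \<in> Poly_Mapping.keys (lin_ext f x)"
  then have "(\<Sum>v\<in>Poly_Mapping.keys x. Poly_Mapping.lookup x v * Poly_Mapping.lookup (f v) u) \<noteq> 0"
    by (simp add: in_keys_iff lin_ext_def lookup_sum)
  then obtain v where "v \<in> Poly_Mapping.keys x" "Poly_Mapping.lookup x v * Poly_Mapping.lookup (f v) u \<noteq> 0"
    by (meson sum.not_neutral_contains_not_neutral)
  then show "u \<in> S" using assms[of v] by (auto simp: in_keys_iff)
qed

section \<open>Cups and caps\<close>

text \<open>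
  \<open>shift i\<close> enumerates the points other than \<open>i\<close> and \<open>i + 1\<close>, so that cups and caps can renumber the
  points of what remains.
\<close>

definition shift :: "nat \<Rightarrow> nat \<Rightarrow> nat" where
  "shift i a = (if a < i then a else a + 2)"

definition unshift :: "nat \<Rightarrow> nat \<Rightarrow> nat" where
  "unshift i a = (if a < i then a else a - 2)"

definition cup :: "nat \<Rightarrow> (nat \<Rightarrow> nat) \<Rightarrow> nat \<Rightarrow> nat" where
  "cup i v = (\<lambda>a. if a = i then Suc i else if a = Suc i then i else shift i (v (unshift i a)))"

text \<open>
  The partner of \<open>a\<close> once \<open>i\<close> and \<open>i + 1\<close> have been joined to each other: a line that runs into one
  of them leaves through the partner of the other, and ends, so that \<open>a\<close> becomes a string, if the other was
  a string.
\<close>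

definition rejoin :: "nat \<Rightarrow> (nat \<Rightarrow> nat) \<Rightarrow> nat \<Rightarrow> nat" where
  "rejoin i v a =
    (if v a = i then (if v (Suc i) = Suc i then a else v (Suc i))
     else if v a = Suc i then (if v i = i then a else v i) else v a)"

definition capf :: "nat \<Rightarrow> (nat \<Rightarrow> nat) \<Rightarrow> nat \<Rightarrow> nat" where
  "capf i v = (\<lambda>a. unshift i (rejoin i v (shift i a)))"

text \<open>
  Two strings are never joined, and a cup that is closed to a loop counts \<open>\<delta>\<close>.
\<close>

definition cap_state :: "complex \<Rightarrow> nat \<Rightarrow> (nat \<Rightarrow> nat) \<Rightarrow> vec" where
  "cap_state \<delta> i v =
    (if v i = i \<and> v (Suc i) = Suc i then 0
     else if v i = Suc i then scale \<delta> (basis (capf i v)) else basis (capf i v))"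

definition cupop :: "nat \<Rightarrow> vec \<Rightarrow> vec" where
  "cupop i = lin_ext (\<lambda>v. basis (cup i v))"

definition capop :: "complex \<Rightarrow> nat \<Rightarrow> vec \<Rightarrow> vec" where
  "capop \<delta> i = lin_ext (cap_state \<delta> i)"

definition invol :: "(nat \<Rightarrow> nat) \<Rightarrow> bool" where
  "invol v \<longleftrightarrow> (\<forall>a. v (v a) = a)"

lemma unshift_shift [simp]: "unshift i (shift i a) = a"
  by (auto simp: shift_def unshift_def)

lemma shift_unshift: "a \<noteq> i \<Longrightarrow> a \<noteq> Suc i \<Longrightarrow> shift i (unshift i a) = a"
  by (auto simp: shift_def unshift_def)

lemma shift_neq [simp]: "shift i a \<noteq> i" "shift i a \<noteq> Suc i" "i \<noteq> shift i a" "Suc i \<noteq> shift i a"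
  by (auto simp: shift_def)

lemma shift_eq_iff [simp]: "shift i a = shift i b \<longleftrightarrow> a = b"
  by (auto simp: shift_def)

lemma shift_less_iff [simp]: "shift i a < shift i b \<longleftrightarrow> a < b"
  by (auto simp: shift_def)

lemma shift_compare [simp]:
  "shift i a < i \<longleftrightarrow> a < i" "shift i a < Suc i \<longleftrightarrow> a < i"
  "i < shift i a \<longleftrightarrow> i \<le> a" "Suc i < shift i a \<longleftrightarrow> i \<le> a"
  by (auto simp: shift_def)

lemma cup_simps [simp]:
  "cup i v i = Suc i" "cup i v (Suc i) = i" "cup i v (shift i a) = shift i (v a)"
  by (auto simp: cup_def)

lemma shift_cases [case_names left right shift]:
  obtains "a = i" | "a = Suc i" | b where "a = shift i b"
  by (metis shift_unshift)

lemma invol_cup: "invol v \<Longrightarrow> invol (cup i v)"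
  unfolding invol_def by (metis shift_unshift cup_simps)

lemma invol_id: "invol (\<lambda>a. a)" by (simp add: invol_def)

lemma capf_cup_same: "capf i (cup i v) = v"
  by (auto simp: capf_def rejoin_def)

lemma cap_state_cup_loop: "cap_state \<delta> i (cup i v) = scale \<delta> (basis v)"
  by (simp add: cap_state_def capf_cup_same)

lemma shift_shift: "i \<le> j \<Longrightarrow> shift i (shift j a) = shift (Suc (Suc j)) (shift i a)"
  by (auto simp: shift_def)

lemma cup_cup: "i \<le> j \<Longrightarrow> cup i (cup j v) = cup (Suc (Suc j)) (cup i v)"
proof
  fix a assume ij: "i \<le> j"
  have e: "shift (Suc (Suc j)) i = i" "shift (Suc (Suc j)) (Suc i) = Suc i"
     "shift i j = Suc (Suc j)" "shift i (Suc j) = Suc (Suc (Suc j))"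
    using ij by (auto simp: shift_def)
  show "cup i (cup j v) a = cup (Suc (Suc j)) (cup i v) a"
  proof (cases a i rule: shift_cases)
    case left
    then show ?thesis using cup_simps(3)[of "Suc (Suc j)" "cup i v" i] e by simp
  next
    case right
    then show ?thesis using cup_simps(3)[of "Suc (Suc j)" "cup i v" "Suc i"] e by simp
  next
    case (shift b)
    show ?thesis
    proof (cases b j rule: shift_cases)
      case left
      then show ?thesis using shift cup_simps(3)[of i "cup j v" j] e by simp
    next
      case right
      then show ?thesis using shift cup_simps(3)[of i "cup j v" "Suc j"] e by simp
    next
      case (shift c)
      then have "cup i (cup j v) a = shift i (shift j (v c))" using \<open>a = _\<close> by simp
      moreover have "a = shift (Suc (Suc j)) (shift i c)"
        using shift \<open>a = _\<close> ij by (simp add: shift_shift)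
      ultimately show ?thesis using ij by (simp add: shift_shift)
    qed
  qed
qed

lemma cap_state_cup_Suc: "cap_state \<delta> i (cup (Suc i) v) = basis v" if "invol v"
proof -
  have "capf i (cup (Suc i) v) = v"
  proof
    fix a
    have inv: "v (v a) = a" for a using that by (simp add: invol_def)
    show "capf i (cup (Suc i) v) a = v a"
      using inv[of a] inv[of i]
      by (auto simp: capf_def rejoin_def cup_def shift_def unshift_def split: if_splits)
  qed
  moreover have "cup (Suc i) v (Suc i) \<noteq> Suc i" by simp
  moreover have "cup (Suc i) v i \<noteq> Suc i" by (auto simp: cup_def)
  ultimately show ?thesis by (simp add: cap_state_def)
qed

lemma cap_state_Suc_cup: "cap_state \<delta> (Suc i) (cup i v) = basis v" if "invol v"
proof -
  have "capf (Suc i) (cup i v) = v"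
  proof
    fix a
    have inv: "v (v a) = a" for a using that by (simp add: invol_def)
    show "capf (Suc i) (cup i v) a = v a"
      using inv[of a] inv[of i]
      by (auto simp: capf_def rejoin_def cup_def shift_def unshift_def split: if_splits)
  qed
  moreover have "cup i v (Suc i) \<noteq> Suc i" "cup i v (Suc i) \<noteq> Suc (Suc i)" by simp_all
  ultimately show ?thesis by (simp add: cap_state_def)
qed

text \<open>
  In this lemma and the next one the cap and the cup concern different points, and they commute up to the
  renumbering of the points behind them.
\<close>

lemma cap_state_cup_far:
  assumes ij: "i \<le> j" and "invol v"
  shows "cap_state \<delta> i (cup (Suc (Suc j)) v) = lin_ext (\<lambda>v. basis (cup j v)) (cap_state \<delta> i v)"
proof -
  let ?j = "Suc (Suc j)"
  have inv: "v (v a) = a" for a using assms by (simp add: invol_def)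
  have s: "shift ?j i = i" "shift ?j (Suc i) = Suc i" using ij by (auto simp: shift_def)
  have vi: "cup ?j v i = shift ?j (v i)" "cup ?j v (Suc i) = shift ?j (v (Suc i))"
    using cup_simps(3)[of ?j v i] cup_simps(3)[of ?j v "Suc i"] s by auto
  have e: "shift ?j a = i \<longleftrightarrow> a = i" "shift ?j a = Suc i \<longleftrightarrow> a = Suc i" for a
    using s shift_eq_iff by metis+
  have sj: "shift i j = ?j" "shift i (Suc j) = Suc ?j" using ij by (auto simp: shift_def)
  have usc: "unshift i (shift ?j b) = shift j (unshift i b)" if "b \<noteq> i" "b \<noteq> Suc i" for b
    using that ij by (auto simp: shift_def unshift_def)
  have usj: "unshift i (Suc ?j) = Suc j" "unshift i ?j = j" using ij by (auto simp: unshift_def)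
  have "capf i (cup ?j v) = cup j (capf i v)" if "\<not> (v i = i \<and> v (Suc i) = Suc i)"
  proof
    fix a
    show "capf i (cup ?j v) a = cup j (capf i v) a"
    proof (cases a j rule: shift_cases)
      case left
      then show ?thesis using sj ij by (simp add: capf_def rejoin_def usj)
    next
      case right
      then show ?thesis using sj ij by (simp add: capf_def rejoin_def usj)
    next
      case (shift b)
      have "rejoin i (cup ?j v) (shift ?j (shift i b)) = shift ?j (rejoin i v (shift i b))"
        by (simp add: rejoin_def e vi)
      moreover have "rejoin i v (shift i b) \<noteq> i" "rejoin i v (shift i b) \<noteq> Suc i"
        using that inv[of "shift i b"] inv[of i] inv[of "Suc i"] by (auto simp: rejoin_def split: if_splits)
      ultimately show ?thesis using shift ij by (simp add: capf_def shift_shift usc)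
    qed
  qed
  then show ?thesis by (auto simp: cap_state_def vi e lin_ext_scale)
qed

lemma cap_state_far_cup:
  assumes ij: "i \<le> j" and "invol v"
  shows "cap_state \<delta> (Suc (Suc j)) (cup i v) = lin_ext (\<lambda>v. basis (cup i v)) (cap_state \<delta> j v)"
proof -
  let ?j = "Suc (Suc j)"
  have inv: "v (v a) = a" for a using assms by (simp add: invol_def)
  have s: "shift i j = ?j" "shift i (Suc j) = Suc ?j" using ij by (auto simp: shift_def)
  have vi: "cup i v ?j = shift i (v j)" "cup i v (Suc ?j) = shift i (v (Suc j))"
    using cup_simps(3)[of i v j] cup_simps(3)[of i v "Suc j"] s by auto
  have e: "shift i a = ?j \<longleftrightarrow> a = j" "shift i a = Suc ?j \<longleftrightarrow> a = Suc j" for a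
    using s shift_eq_iff by metis+
  have sj: "shift ?j i = i" "shift ?j (Suc i) = Suc i" using ij by (auto simp: shift_def)
  have usc: "unshift ?j (shift i b) = shift i (unshift j b)" if "b \<noteq> j" "b \<noteq> Suc j" for b
    using that ij by (auto simp: shift_def unshift_def)
  have usj: "unshift ?j (Suc i) = Suc i" "unshift ?j i = i" using ij by (auto simp: unshift_def)
  have "capf ?j (cup i v) = cup i (capf j v)" if "\<not> (v j = j \<and> v (Suc j) = Suc j)"
  proof
    fix a
    show "capf ?j (cup i v) a = cup i (capf j v) a"
    proof (cases a i rule: shift_cases)
      case left
      then show ?thesis using sj ij by (simp add: capf_def rejoin_def usj)
    next
      case right
      then show ?thesis using sj ij by (simp add: capf_def rejoin_def usj)
    next
      case (shift b)
      have "rejoin ?j (cup i v) (shift i (shift j b)) = shift i (rejoin j v (shift j b))"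
        by (simp add: rejoin_def e vi)
      moreover have "rejoin j v (shift j b) \<noteq> j" "rejoin j v (shift j b) \<noteq> Suc j"
        using that inv[of "shift j b"] inv[of j] inv[of "Suc j"] by (auto simp: rejoin_def split: if_splits)
      ultimately show ?thesis using shift ij by (simp add: capf_def usc flip: shift_shift)
    qed
  qed
  then show ?thesis by (auto simp: cap_state_def vi e lin_ext_scale)
qed

text \<open>
  The generator of the Temperley--Lieb algebra factors through the link states with two points less. Thus
  the Temperley--Lieb relations reduce to the relations between cups and caps.
\<close>

lemma e_state_eq:
  assumes "invol v"
  shows "e_state \<delta> i v = lin_ext (\<lambda>v. basis (cup i v)) (cap_state \<delta> i v)"
proof -
  have inv: "v (v a) = a" for a using assms by (simp add: invol_def)
  have inj: "v a = v b \<longleftrightarrow> a = b" for a b by (metis inv)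
  let ?r = "\<lambda>a. if a = i then Suc i else if a = Suc i then i else rejoin i v a"
  have r: "cup i (capf i v) = ?r" if "\<not> (v i = i \<and> v (Suc i) = Suc i)"
  proof
    fix a
    show "cup i (capf i v) a = ?r a"
    proof (cases a i rule: shift_cases)
      case (shift b)
      have "rejoin i v (shift i b) \<noteq> i" "rejoin i v (shift i b) \<noteq> Suc i"
        using that inv[of "shift i b"] inv[of i] inv[of "Suc i"] by (auto simp: rejoin_def split: if_splits)
      then show ?thesis using shift by (simp add: capf_def shift_unshift)
    qed simp_all
  qed
  consider "v i = i" "v (Suc i) = Suc i" | "v i = Suc i"
    | "v i = i" "v (Suc i) \<noteq> Suc i" | "v i \<noteq> i" "v i \<noteq> Suc i" "v (Suc i) = Suc i"
    | "v i \<noteq> i" "v i \<noteq> Suc i" "v (Suc i) \<noteq> Suc i" by blast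
  then show ?thesis
  proof cases
    case 1 then show ?thesis by (simp add: e_state_def cap_state_def)
  next
    case 2
    then have "v (Suc i) = i" using inv by metis
    then have "?r = v" using 2 inv by (auto simp: rejoin_def fun_eq_iff)
    then show ?thesis using 2 r by (simp add: e_state_def cap_state_def lin_ext_scale)
  next
    case 3
    have "?r = v(i := Suc i, Suc i := i, v (Suc i) := v (Suc i))"
    proof
      fix a show "?r a = (v(i := Suc i, Suc i := i, v (Suc i) := v (Suc i))) a"
        using 3 inv[of a] inv[of "Suc i"] inv[of i] by (auto simp: rejoin_def)
    qed
    then show ?thesis using 3 r by (simp add: e_state_def cap_state_def Let_def)
  next
    case 4
    have "?r = v(i := Suc i, Suc i := i, v i := v i)"
    proof
      fix a show "?r a = (v(i := Suc i, Suc i := i, v i := v i)) a"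
        using 4 inv[of a] inv[of "Suc i"] inv[of i] by (auto simp: rejoin_def)
    qed
    then show ?thesis using 4 r by (simp add: e_state_def cap_state_def Let_def)
  next
    case 5
    have "?r = v(i := Suc i, Suc i := i, v i := v (Suc i), v (Suc i) := v i)"
    proof
      fix a show "?r a = (v(i := Suc i, Suc i := i, v i := v (Suc i), v (Suc i) := v i)) a"
        using 5 inv[of a] inv[of "Suc i"] inv[of i] inj by (auto simp: rejoin_def)
    qed
    then show ?thesis using 5 r by (simp add: e_state_def cap_state_def Let_def)
  qed
qed

section \<open>Finite link states are words of cups\<close>

lemma link_states_invol: "v \<in> link_states n p \<Longrightarrow> invol v"
  by (simp add: link_states_def link_state_def invol_def)

lemma link_states_fixed: "v \<in> link_states n p \<Longrightarrow> n \<le> a \<Longrightarrow> v a = a"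
  by (simp add: link_states_def link_state_def)

lemma link_states_le: "v \<in> link_states n p \<Longrightarrow> a < n \<Longrightarrow> v a < n"
  by (simp add: link_states_def link_state_def)

lemma link_states_noncross:
  "v \<in> link_states n p \<Longrightarrow> a < c \<Longrightarrow> c < v a \<Longrightarrow> v a < v c \<Longrightarrow> False"
  by (auto simp add: link_states_def link_state_def)

lemma link_states_nostring:
  "v \<in> link_states n p \<Longrightarrow> a < c \<Longrightarrow> c < v a \<Longrightarrow> v c \<noteq> c"
  by (auto simp add: link_states_def link_state_def)

lemma link_statesI:
  assumes "\<And>i. n \<le> i \<Longrightarrow> v i = i" "\<And>i. i < n \<Longrightarrow> v i < n" "\<And>i. v (v i) = i"
    "\<And>a c. a < c \<Longrightarrow> c < v a \<Longrightarrow> v a < v c \<Longrightarrow> False"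
    "\<And>a c. a < c \<Longrightarrow> c < v a \<Longrightarrow> v c \<noteq> c" "card {i. i < v i} = p"
  shows "v \<in> link_states n p"
  unfolding link_states_def link_state_def mem_Collect_eq lessThan_iff not_less
  using assms by blast

lemma link_states_card: "v \<in> link_states n p \<Longrightarrow> card {i. i < v i} = p"
  by (simp add: link_states_def)

lemma finite_openers:
  assumes "\<And>i. n \<le> i \<Longrightarrow> v i = i" shows "finite {i::nat. i < v i}"
proof (rule finite_subset)
  show "{i. i < v i} \<subseteq> {..<n}" using assms by (metis lessThan_iff less_irrefl_nat mem_Collect_eq not_le subsetI)
qed simp

lemma openers_finite: "v \<in> link_states n p \<Longrightarrow> finite {i. i < v i}"
  using finite_openers link_states_fixed by blast

lemma link_states_mono:
  assumes "v \<in> link_states n p" "n \<le> m" shows "v \<in> link_states m p"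
proof -
  have "v i < m" if "i < m" for i
    using link_states_le[OF assms(1), of i] link_states_fixed[OF assms(1), of i] assms(2) that
    by (cases "i < n") auto
  then show ?thesis
    using link_states_fixed[OF assms(1)] assms(2) link_states_invol[OF assms(1)]
      link_states_noncross[OF assms(1)] link_states_nostring[OF assms(1)] link_states_card[OF assms(1)]
    by (intro link_statesI) (auto simp: invol_def)
qed

lemma link_states_restrict:
  assumes "v \<in> link_states (Suc n) p" "v n = n" shows "v \<in> link_states n p"
proof -
  have inv: "v (v c) = c" for c using link_states_invol[OF assms(1)] by (simp add: invol_def)
  have "v i < n" if "i < n" for i
  proof -
    have "v i < Suc n" using link_states_le[OF assms(1), of i] that by simp
    moreover have "v i \<noteq> n" using inv[of i] assms(2) that by auto
    ultimately show ?thesis by simp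
  qed
  moreover have "v i = i" if "n \<le> i" for i
    using link_states_fixed[OF assms(1), of i] assms(2) that by (cases "i = n") auto
  ultimately show ?thesis
    using inv link_states_noncross[OF assms(1)] link_states_nostring[OF assms(1)] link_states_card[OF assms(1)]
    by (intro link_statesI) auto
qed

lemma link_states_0: "link_states n 0 = {\<lambda>a. a}"
proof -
  have "v = (\<lambda>a. a)" if "v \<in> link_states n 0" for v
  proof
    fix a
    have "{i. i < v i} = {}" using that openers_finite[OF that] by (simp add: link_states_def)
    then have "\<not> a < v a" "\<not> v a < v (v a)" by auto
    then show "v a = a" using link_states_invol[OF that] by (simp add: invol_def)
  qed
  moreover have "(\<lambda>a. a) \<in> link_states n 0"
    by (auto simp: link_states_def link_state_def)
  ultimately show ?thesis by blast
qed

lemma opener_cup: "{a. a < cup i v a} = insert i (shift i ` {a. a < v a})"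
proof -
  have "a < cup i v a \<longleftrightarrow> a \<in> insert i (shift i ` {a. a < v a})" for a
    by (cases a i rule: shift_cases) (simp_all add: image_iff)
  then show ?thesis by blast
qed

lemma cup_link_states:
  assumes v: "v \<in> link_states n p" and i: "i \<le> n"
  shows "cup i v \<in> link_states (Suc (Suc n)) (Suc p)"
proof -
  have sh: "shift i a < Suc (Suc n) \<longleftrightarrow> a < n" for a using i by (auto simp: shift_def)
  show ?thesis
  proof (rule link_statesI)
    show "cup i v a = a" if "Suc (Suc n) \<le> a" for a
      using that i link_states_fixed[OF v] sh by (cases a i rule: shift_cases) (auto simp flip: not_less)
    show "cup i v a < Suc (Suc n)" if "a < Suc (Suc n)" for a
      using that i link_states_le[OF v] by (cases a i rule: shift_cases) (auto simp: sh)
    show "cup i v (cup i v a) = a" for a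
      using invol_cup[OF link_states_invol[OF v]] by (simp add: invol_def)
    show False if "a < c" "c < cup i v a" "cup i v a < cup i v c" for a c
      using that link_states_noncross[OF v]
      by (cases a i rule: shift_cases; cases c i rule: shift_cases) auto
    show "cup i v c \<noteq> c" if "a < c" "c < cup i v a" for a c
      using that link_states_nostring[OF v]
      by (cases a i rule: shift_cases; cases c i rule: shift_cases) auto
    have "card (shift i ` {a. a < v a}) = p"
      using v by (subst card_image) (auto simp: inj_on_def link_states_def)
    moreover have "i \<notin> shift i ` {a. a < v a}" by auto
    ultimately show "card {a. a < cup i v a} = Suc p"
      unfolding opener_cup using openers_finite[OF v] by simp
  qed
qed

text \<open>
  A cup whose ends have the least distance encloses no point: an enclosed point would belong to a shorter cup,
  since no string and no crossing line lies below a cup.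
\<close>

lemma link_states_innermost:
  assumes v: "v \<in> link_states n (Suc p)"
  obtains i where "v i = Suc i"
proof -
  have "{i. i < v i} \<noteq> {}" using link_states_card[OF v] by (metis card.empty nat.distinct(1))
  then obtain a where a: "a < v a" by blast
  \<comment> \<open>The number \<open>d\<close> counts the points below a cup.\<close>
  define P where "P d \<longleftrightarrow> (\<exists>a. v a = a + Suc d)" for d
  have "P (v a - Suc a)" unfolding P_def using a by (intro exI[of _ a]) simp
  then have L: "P (LEAST d. P d)" by (rule LeastI)
  then obtain b where b: "v b = b + Suc (LEAST d. P d)" unfolding P_def by blast
  have inv: "v (v c) = c" for c using link_states_invol[OF v] by (simp add: invol_def)
  have "v b = Suc b"
  proof (rule ccontr)
    assume ne: "v b \<noteq> Suc b"
    let ?c = "Suc b"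
    have c: "b < ?c" "?c < v b" using b ne by auto
    then have "v ?c \<noteq> ?c" using link_states_nostring[OF v] by blast
    moreover have "\<not> v b < v ?c" using link_states_noncross[OF v c] by blast
    moreover have "v ?c \<noteq> v b" "v ?c \<noteq> b" using inv c by (metis n_not_Suc_n, metis nat_neq_iff)
    moreover have "\<not> v ?c < b"
      using link_states_noncross[OF v, of "v ?c" b] inv[of ?c] c by auto
    ultimately have "?c < v ?c" "v ?c < v b" by linarith+
    then have "v ?c - Suc ?c < (LEAST d. P d)" using b by linarith
    moreover have "P (v ?c - Suc ?c)"
      unfolding P_def using \<open>?c < v ?c\<close> by (intro exI[of _ ?c]) simp
    ultimately show False using not_less_Least by blast
  qed
  then show thesis by (rule that)
qed

text \<open>
  Removing an innermost cup leaves a link state. Hence link states are the words of cups applied to the state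
  without cups, and statements about spans of link states can be proved by induction on the number of cups
  with \<open>standard_Suc_induct\<close>, without returning to the combinatorics of noncrossing involutions.
\<close>

lemma link_states_Suc:
  assumes v: "v \<in> link_states m (Suc p)"
  obtains n i u where "m = Suc (Suc n)" "i \<le> n" "u \<in> link_states n p" "v = cup i u"
proof -
  obtain i where i: "v i = Suc i" using link_states_innermost[OF v] .
  have inv: "v (v c) = c" for c using link_states_invol[OF v] by (simp add: invol_def)
  have i': "v (Suc i) = i" using i inv by metis
  have "i < m" using link_states_fixed[OF v, of i] i by (metis n_not_Suc_n not_le)
  then have im: "Suc i < m" using link_states_le[OF v, of i] i by simp
  then obtain n where n: "m = Suc (Suc n)" "i \<le> n"
    by (metis Suc_leD Suc_le_D Suc_less_eq2 less_Suc_eq_le less_Suc_eq_0_disj)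
  define u where "u = (\<lambda>a. unshift i (v (shift i a)))"
  have ne: "v (shift i a) \<noteq> i" "v (shift i a) \<noteq> Suc i" for a
    using inv i i' by (metis shift_neq)+
  have su: "shift i (u a) = v (shift i a)" for a
    unfolding u_def using ne by (simp add: shift_unshift)
  have vu: "v = cup i u"
  proof
    fix a show "v a = cup i u a" by (cases a i rule: shift_cases) (auto simp: i i' su)
  qed
  have sh: "shift i a < m \<longleftrightarrow> a < n" for a using n by (auto simp: shift_def)
  have ufix: "u a = a" if "n \<le> a" for a
    using link_states_fixed[OF v, of "shift i a"] that su[of a] sh[of a] by simp
  have "u \<in> link_states n p"
  proof (rule link_statesI)
    show "u a < n" if "a < n" for a
      using link_states_le[OF v, of "shift i a"] that su[of a] sh[of a] sh[of "u a"] by simp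
    show "u (u a) = a" for a
      using inv[of "shift i a"] su[of "u a"] su[of a] by simp
    show False if "a < c" "c < u a" "u a < u c" for a c
      using link_states_noncross[OF v, of "shift i a" "shift i c"] that by (simp flip: su)
    show "u c \<noteq> c" if "a < c" "c < u a" for a c
      using link_states_nostring[OF v, of "shift i a" "shift i c"] that by (simp flip: su)
    have "finite {a. a < u a}" using ufix by (rule finite_openers)
    moreover have "i \<notin> shift i ` {a. a < u a}" by auto
    moreover have "card {a. a < v a} = Suc p" using v by (simp add: link_states_def)
    ultimately show "card {a. a < u a} = p" unfolding vu opener_cup by (simp add: card_image inj_on_def)
  qed (rule ufix)
  then show thesis using that n vu by blast
qed

section \<open>Cups and caps on spans of link states\<close>

lemma cupop_lin [simp]:
  "cupop i 0 = 0" "cupop i (x + y) = cupop i x + cupop i y" "cupop i (x - y) = cupop i x - cupop i y"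
  "cupop i (scale c x) = scale c (cupop i x)" "cupop i (Poly_Mapping.single v c) = scale c (basis (cup i v))"
  by (simp_all add: cupop_def lin_ext_add lin_ext_diff lin_ext_scale)

lemma capop_lin [simp]:
  "capop \<delta> i 0 = 0" "capop \<delta> i (x + y) = capop \<delta> i x + capop \<delta> i y"
  "capop \<delta> i (x - y) = capop \<delta> i x - capop \<delta> i y"
  "capop \<delta> i (scale c x) = scale c (capop \<delta> i x)"
  "capop \<delta> i (Poly_Mapping.single v c) = scale c (cap_state \<delta> i v)"
  by (simp_all add: capop_def lin_ext_add lin_ext_diff lin_ext_scale)

lemma capop_sum: "capop \<delta> i (\<Sum>a\<in>I. g a) = (\<Sum>a\<in>I. capop \<delta> i (g a))"
  by (simp add: capop_def lin_ext_sum)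

text \<open>
  Combinations of matchings of the points. The relations between a cap and a cup are statements about
  matchings, of which the noncrossing ones are a special case.
\<close>

definition invvec :: "vec \<Rightarrow> bool" where
  "invvec x \<longleftrightarrow> Poly_Mapping.keys x \<subseteq> Collect invol"

lemma invvec_basis: "invol v \<Longrightarrow> invvec (basis v)"
  by (simp add: invvec_def)

lemma cap_cup_loop [simp]: "capop \<delta> i (cupop i x) = scale \<delta> x"
  by (rule vec_induct[of x UNIV]) (simp_all add: cap_state_cup_loop lc.scale_right_distrib mult.commute)

lemma cap_cup_Suc:
  assumes "invvec x" shows "capop \<delta> i (cupop (Suc i) x) = x"
  using assms[unfolded invvec_def]
  by (induction x rule: vec_induct) (simp_all add: cap_state_cup_Suc)

lemma cap_Suc_cup:
  assumes "invvec x" shows "capop \<delta> (Suc i) (cupop i x) = x"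
  using assms[unfolded invvec_def]
  by (induction x rule: vec_induct) (simp_all add: cap_state_Suc_cup)

lemma cap_cup_far:
  assumes "invvec x" "i \<le> j"
  shows "capop \<delta> i (cupop (Suc (Suc j)) x) = cupop j (capop \<delta> i x)"
  using assms(1)[unfolded invvec_def]
  by (induction x rule: vec_induct) (simp_all add: cap_state_cup_far assms(2) flip: cupop_def)

lemma cap_far_cup:
  assumes "invvec x" "i \<le> j"
  shows "capop \<delta> (Suc (Suc j)) (cupop i x) = cupop i (capop \<delta> j x)"
  using assms(1)[unfolded invvec_def]
  by (induction x rule: vec_induct) (simp_all add: cap_state_far_cup assms(2) flip: cupop_def)

lemma cupop_cupop:
  assumes "i \<le> j"
  shows "cupop i (cupop j x) = cupop (Suc (Suc j)) (cupop i x)"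
  by (rule vec_induct[of x UNIV]) (simp_all add: cup_cup assms)

lemma standard_0 [simp]: "0 \<in> standard n p" by (simp add: standard_def)

lemma standard_add: "x \<in> standard n p \<Longrightarrow> y \<in> standard n p \<Longrightarrow> x + y \<in> standard n p"
  using keys_add[of x y] by (auto simp: standard_def)

lemma keys_scale: "Poly_Mapping.keys (scale c x) \<subseteq> Poly_Mapping.keys x"
  by (auto simp: in_keys_iff)

lemma standard_scale: "x \<in> standard n p \<Longrightarrow> scale c x \<in> standard n p"
  using keys_scale[of c x] by (auto simp: standard_def)

lemma standard_diff: "x \<in> standard n p \<Longrightarrow> y \<in> standard n p \<Longrightarrow> x - y \<in> standard n p"
  using keys_diff[of x y] by (auto simp: standard_def)

lemma standard_sum: "(\<And>i. i \<in> I \<Longrightarrow> f i \<in> standard n p) \<Longrightarrow> sum f I \<in> standard n p"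
  by (induction I rule: infinite_finite_induct) (auto intro: standard_add)

lemma standard_basis [simp]: "basis v \<in> standard n p \<longleftrightarrow> v \<in> link_states n p"
  by (simp add: standard_def)

lemma standard_induct [consumes 1, case_names zero add scale basis]:
  assumes "x \<in> standard n p" "P 0"
    "\<And>x y. x \<in> standard n p \<Longrightarrow> y \<in> standard n p \<Longrightarrow> P x \<Longrightarrow> P y \<Longrightarrow> P (x + y)"
    "\<And>c x. x \<in> standard n p \<Longrightarrow> P x \<Longrightarrow> P (scale c x)" "\<And>v. v \<in> link_states n p \<Longrightarrow> P (basis v)"
  shows "P x"
proof -
  have "Poly_Mapping.keys x \<subseteq> link_states n p" using assms(1) by (simp add: standard_def)
  then have "P x \<and> x \<in> standard n p"
    by (induction x rule: vec_induct) (auto intro: assms standard_add standard_scale)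
  then show ?thesis by simp
qed

lemma standard_invvec: "x \<in> standard n p \<Longrightarrow> invvec x"
  using link_states_invol by (auto simp: standard_def invvec_def)

lemma standard_mono: "x \<in> standard n p \<Longrightarrow> n \<le> m \<Longrightarrow> x \<in> standard m p"
  using link_states_mono by (fastforce simp: standard_def)

lemma standard_cup:
  assumes "x \<in> standard n p" "i \<le> n" shows "cupop i x \<in> standard (Suc (Suc n)) (Suc p)"
  using assms(1)
  by (induction x rule: standard_induct) (auto intro: standard_add standard_scale cup_link_states assms(2))

lemma standard_0_iff: "x \<in> standard n 0 \<longleftrightarrow> (\<exists>c. x = scale c (basis (\<lambda>a. a)))"
proof
  assume "x \<in> standard n 0"
  then have "Poly_Mapping.keys x \<subseteq> {\<lambda>a. a}" by (simp add: standard_def link_states_0)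
  then show "\<exists>c. x = scale c (basis (\<lambda>a. a))"
    using lin_ext_superset[of "{\<lambda>a. a}" x "\<lambda>v. basis v"] by auto
qed (auto simp: standard_def link_states_0 in_keys_iff lookup_single when_def split: if_splits)

lemma cap_id [simp]: "cap_state \<delta> i (\<lambda>a. a) = 0"
  by (simp add: cap_state_def)

lemma cap_standard_0: "x \<in> standard n 0 \<Longrightarrow> capop \<delta> i x = 0"
  by (auto simp: standard_0_iff)

lemma cap_outside: "x \<in> standard n p \<Longrightarrow> n \<le> i \<Longrightarrow> capop \<delta> i x = 0"
proof (induction x rule: standard_induct)
  case (basis v)
  then show ?case using link_states_fixed[OF basis(1)] by (simp add: cap_state_def)
qed simp_all

text \<open>
  A cap at \<open>i\<close> and a cup at \<open>m\<close> fall under exactly one of the five relations.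
\<close>

lemma near_far_cases [case_names same up down far_up far_down]:
  fixes i m :: nat
  obtains "m = i" | "m = Suc i" | "i = Suc m"
    | j where "m = Suc (Suc j)" "i \<le> j" | j where "i = Suc (Suc j)" "m \<le> j"
proof -
  consider "m = i" | "m = Suc i" | "i = Suc m" | "i + 2 \<le> m" | "m + 2 \<le> i" by linarith
  then show ?thesis
  proof cases
    case 4 then show ?thesis using that(4)[of "m - 2"] by simp
  next
    case 5 then show ?thesis using that(5)[of "i - 2"] by simp
  qed (use that in blast)+
qed

lemma standard_Suc_induct [consumes 1, case_names zero add scale cup]:
  assumes "x \<in> standard m (Suc p)" "P 0"
    "\<And>x y. x \<in> standard m (Suc p) \<Longrightarrow> y \<in> standard m (Suc p) \<Longrightarrow> P x \<Longrightarrow> P y \<Longrightarrow> P (x + y)"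
    "\<And>c x. x \<in> standard m (Suc p) \<Longrightarrow> P x \<Longrightarrow> P (scale c x)"
    "\<And>n i y. m = Suc (Suc n) \<Longrightarrow> i \<le> n \<Longrightarrow> y \<in> standard n p \<Longrightarrow> P (cupop i y)"
  shows "P x"
  using assms(1)
proof (induction x rule: standard_induct)
  case (basis v)
  then obtain n i u where "m = Suc (Suc n)" "i \<le> n" "u \<in> link_states n p" "v = cup i u"
    by (rule link_states_Suc)
  then show ?case using assms(5)[of n i "basis u"] by simp
qed (use assms in auto)

text \<open>
  Noncrossing is preserved by caps because the relations push a cap through a word of cups until it
  cancels one of them, creates a loop or meets the state without cups, which it annihilates.
\<close>

lemma standard_cap:
  "x \<in> standard (Suc (Suc n)) (Suc p) \<Longrightarrow> i \<le> n \<Longrightarrow> capop \<delta> i x \<in> standard n p"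
proof (induction p arbitrary: x n i)
  case (0 x n i)
  from 0 show ?case
  proof (induction x rule: standard_Suc_induct)
    case (cup n' m y)
    have y: "y \<in> standard n 0" "invvec y" using cup standard_invvec by auto
    show ?case
      by (cases m i rule: near_far_cases)
        (use y in \<open>simp_all add: cap_cup_Suc cap_Suc_cup cap_cup_far cap_far_cup cap_standard_0 standard_scale\<close>)
  qed (simp_all add: standard_add standard_scale)
next
  case (Suc p x n i)
  from Suc.prems(1) show ?case
  proof (induction x rule: standard_Suc_induct)
    case (cup n' m y)
    then have y: "y \<in> standard n (Suc p)" "invvec y" "m \<le> n" using standard_invvec by auto
    have *: "capop \<delta> l y \<in> standard n'' p" if "l \<le> n''" "n = Suc (Suc n'')" for l n''
      using Suc.IH[of y n'' l] y that by simp
    show ?case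
    proof (cases "y = 0")
      case False
      then have "Poly_Mapping.keys y \<noteq> {}" by simp
      then obtain v where "v \<in> link_states n (Suc p)" using y(1) unfolding standard_def by blast
      then obtain n'' where n: "n = Suc (Suc n'')" by (rule link_states_Suc)
      show ?thesis
        by (cases m i rule: near_far_cases)
          (use y n * Suc.prems(2) in \<open>auto simp: cap_cup_Suc cap_Suc_cup cap_cup_far cap_far_cup standard_scale intro!: standard_cup\<close>)
    qed simp
  qed (simp_all add: standard_add standard_scale)
qed

lemma standard_cap_last:
  assumes "x \<in> standard (Suc n) (Suc p)" shows "capop \<delta> n x \<in> standard n p"
  by (rule standard_cap) (auto intro: standard_mono[OF assms])

lemma standard_small: "x \<in> standard n p \<Longrightarrow> n < 2 * p \<Longrightarrow> x = 0"
proof (induction p arbitrary: x n)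
  case (Suc p)
  from Suc.prems(1) show ?case
  proof (induction x rule: standard_Suc_induct)
    case (cup n' i y)
    then show ?case using Suc.IH[of y n'] Suc.prems(2) by simp
  qed simp_all
qed simp

text \<open>
  As for \<open>standard_cap\<close>, both caps are pushed through the outermost cup of a word; on matchings
  directly one would have to distinguish how the lines at the four points are connected.
\<close>

lemma cap_cap:
  "x \<in> standard n p \<Longrightarrow> i \<le> j \<Longrightarrow> capop \<delta> i (capop \<delta> (Suc (Suc j)) x) = capop \<delta> j (capop \<delta> i x)"
proof (induction p arbitrary: x n i j)
  case 0
  then show ?case by (simp add: cap_standard_0)
next
  case (Suc p)
  from Suc.prems(1) show ?case
  proof (induction x rule: standard_Suc_induct)
    case (cup n' m y)
    have inv: "invvec y" using cup standard_invvec by auto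
    have inv2: "invvec (capop \<delta> l y)" for l
    proof (cases p)
      case 0 then show ?thesis using cup cap_standard_0 by (simp add: invvec_def)
    next
      case (Suc p')
      have "y \<in> standard (Suc (Suc (max n' l))) (Suc p')" using standard_mono cup Suc by simp
      then have "capop \<delta> l y \<in> standard (max n' l) p'" by (rule standard_cap) simp
      then show ?thesis by (rule standard_invvec)
    qed
    note IH = Suc.IH[OF cup(3)]
    note R = inv inv2 cap_cup_Suc cap_Suc_cup cap_cup_far cap_far_cup
    show ?case
    proof (cases m i rule: near_far_cases)
      case same
      then show ?thesis using \<open>i \<le> j\<close> by (simp add: R)
    next
      case up
      then show ?thesis using \<open>i \<le> j\<close> by (cases "i = j") (simp_all add: R)
    next
      case down
      then show ?thesis using \<open>i \<le> j\<close> by (simp add: R)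
    next
      case (far_up l)
      show ?thesis
      proof (cases m "Suc (Suc j)" rule: near_far_cases)
        case same then show ?thesis using far_up \<open>i \<le> j\<close> by (simp add: R)
      next
        case up then show ?thesis using far_up \<open>i \<le> j\<close> by (simp add: R)
      next
        case down then show ?thesis using far_up \<open>i \<le> j\<close> by (cases j) (simp_all add: R)
      next
        case (far_up k)
        then obtain h where "k = Suc (Suc h)" "j \<le> h" by (intro that[of "k - 2"]) auto
        then show ?thesis using far_up \<open>m = Suc (Suc l)\<close> \<open>i \<le> l\<close> \<open>i \<le> j\<close> IH[of i j] by (simp add: R)
      next
        case (far_down k)
        then have k: "k = j" "Suc (Suc l) \<le> j" using \<open>m = Suc (Suc l)\<close> by auto
        then obtain h where "j = Suc (Suc h)" "l \<le> h" by (intro that[of "j - 2"]) auto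
        then show ?thesis using k \<open>m = Suc (Suc l)\<close> \<open>i \<le> l\<close> IH[of i h] by (simp add: R)
      qed
    next
      case (far_down l)
      then obtain h where "j = Suc (Suc h)" "l \<le> h" using \<open>i \<le> j\<close> by (intro that[of "j - 2"]) auto
      then show ?thesis using far_down IH[of l h] by (simp add: R)
    qed
  qed simp_all
qed

text \<open>
  If the last point \<open>n\<close> is joined to \<open>b\<close>, no string lies between them. So \<open>b\<close> is the last string among the
  points before \<open>n\<close> after the cap, and the state can be recovered.
\<close>

lemma capf_last_inj:
  assumes v: "v \<in> link_states (Suc n) p" and u: "u \<in> link_states (Suc n) p"
    and "v n \<noteq> n" "u n \<noteq> n" and eq: "capf n v = capf n u"
  shows "v = u"
proof -
  have char: "capf n w a = (if a < n then if w a = n then a else w a else a)"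
    if "w \<in> link_states (Suc n) p" "w n \<noteq> n" for w a
    using link_states_le[OF that(1), of a] link_states_fixed[OF that(1), of "Suc n"]
      link_states_fixed[OF that(1), of "Suc (Suc a)"] that(2)
    by (auto simp: capf_def rejoin_def shift_def unshift_def)
  have last: "w n < n" "w (w n) = n" "capf n w (w n) = w n"
    "\<And>c. w n < c \<Longrightarrow> c < n \<Longrightarrow> capf n w c \<noteq> c"
    if w: "w \<in> link_states (Suc n) p" "w n \<noteq> n" for w
  proof -
    have inv: "w (w c) = c" for c using link_states_invol[OF w(1)] by (simp add: invol_def)
    show lt: "w n < n" using link_states_le[OF w(1), of n] w(2) by simp
    show "w (w n) = n" by (rule inv)
    then show "capf n w (w n) = w n" using lt char[OF w] by simp
    show "capf n w c \<noteq> c" if c: "w n < c" "c < n" for c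
      using link_states_nostring[OF w(1), of "w n" c] inv[of c] inv[of n] c char[OF w, of c] by auto
  qed
  note lv = last[OF v assms(3)] and lu = last[OF u assms(4)]
  have b: "v n = u n"
    using lv lu eq by (metis linorder_neqE_nat)
  show ?thesis
  proof
    fix a
    have "capf n v a = capf n u a" using eq by simp
    then show "v a = u a"
      using b char[OF v assms(3), of a] char[OF u assms(4), of a] lv(1,2) lu(1,2)
        link_states_fixed[OF v, of a] link_states_fixed[OF u, of a]
        link_states_invol[OF v] link_states_invol[OF u]
      unfolding invol_def by (metis Suc_leI linorder_neqE_nat)
  qed
qed

text \<open>
  Here the point \<open>n\<close> is the last one and \<open>n + 1\<close>, being outside the state, counts as a string. Thus the cap at
  \<open>n\<close> turns the partner of \<open>n\<close> into a string, and kills the states in which \<open>n\<close> is a string.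
\<close>

lemma kernel_cap_last:
  assumes x: "x \<in> standard (Suc n) p" and z: "capop \<delta> n x = 0"
  shows "x \<in> standard n p"
proof -
  have "v \<in> link_states n p" if k: "v \<in> Poly_Mapping.keys x" for v
  proof (rule ccontr)
    assume c: "v \<notin> link_states n p"
    have K: "Poly_Mapping.keys x \<subseteq> link_states (Suc n) p" using x by (simp add: standard_def)
    then have v: "v \<in> link_states (Suc n) p" using k by blast
    then have vn: "v n \<noteq> n" using c link_states_restrict by blast
    have cs: "cap_state \<delta> n u = (if u n = n then 0 else basis (capf n u))"
      if "u \<in> link_states (Suc n) p" for u
      using link_states_fixed[OF that, of "Suc n"] link_states_le[OF that, of n] by (simp add: cap_state_def)
    \<comment> \<open>By injectivity on the states that survive, \<open>v\<close> alone contributes to this coefficient.\<close>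
    have "0 = Poly_Mapping.lookup (capop \<delta> n x) (capf n v)" using z by simp
    also have "\<dots> = (\<Sum>u\<in>Poly_Mapping.keys x. Poly_Mapping.lookup x u * Poly_Mapping.lookup (cap_state \<delta> n u) (capf n v))"
      by (simp add: capop_def lin_ext_def lookup_sum)
    also have "\<dots> = (\<Sum>u\<in>Poly_Mapping.keys x. if u = v then Poly_Mapping.lookup x v else 0)"
    proof (rule sum.cong)
      fix u assume "u \<in> Poly_Mapping.keys x"
      then have u: "u \<in> link_states (Suc n) p" using K by blast
      show "Poly_Mapping.lookup x u * Poly_Mapping.lookup (cap_state \<delta> n u) (capf n v) =
        (if u = v then Poly_Mapping.lookup x v else 0)"
        using capf_last_inj[OF u v _ vn] vn by (auto simp: cs[OF u] lookup_single when_def)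
    qed simp
    also have "\<dots> = Poly_Mapping.lookup x v" using k by simp
    finally show False using k by (simp add: in_keys_iff)
  qed
  then show ?thesis by (auto simp: standard_def)
qed

text \<open>
  No loop can be closed with a point that is a string.
\<close>

lemma cap_last_indep:
  assumes "x \<in> standard (Suc n) p" shows "capop \<delta> n x = capop \<delta>' n x"
  using assms
proof (induction x rule: standard_induct)
  case (basis v)
  then show ?case using link_states_le[OF basis, of n] by (simp add: cap_state_def)
qed simp_all

section \<open>Gluing a cup\<close>

lemma glue_refl: "(a, a) \<in> glue x y" by (simp add: glue_def)

lemma glue_left: "(a, x a) \<in> glue x y" by (auto simp: glue_def)

lemma glue_right: "(a, y a) \<in> glue x y" by (auto simp: glue_def)

lemma glue_trans: "(a, b) \<in> glue x y \<Longrightarrow> (b, c) \<in> glue x y \<Longrightarrow> (a, c) \<in> glue x y"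
  by (auto simp: glue_def)

lemma glue_sym:
  assumes "invol x" "invol y" "(a, b) \<in> glue x y" shows "(b, a) \<in> glue x y"
proof -
  have "sym {(i, j). j = x i \<or> j = y i}"
    using assms(1,2) by (auto simp: sym_def invol_def)
  then show ?thesis using assms(3) unfolding glue_def by (meson sym_rtrancl symE)
qed

lemma glue_induct [consumes 1, case_names refl left right]:
  assumes "(a, b) \<in> glue x y" "P a" "\<And>c. P c \<Longrightarrow> P (x c)" "\<And>c. P c \<Longrightarrow> P (y c)"
  shows "P b"
  using assms(1) unfolding glue_def by (induction rule: rtrancl_induct) (auto intro: assms)

lemma glue_class_eq:
  assumes "invol x" "invol y" "(a, b) \<in> glue x y" shows "glue x y `` {a} = glue x y `` {b}"
  using glue_trans glue_sym[OF assms(1,2)] assms(3) by blast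

text \<open>
  Gluing \<open>x\<close> to a state \<open>y\<close> with a cup at \<open>i\<close> gives the same connections between the other points as gluing the
  capped state \<open>x'\<close> to the state \<open>v\<close> from which \<open>y\<close> arises. Only the component of \<open>i\<close> and \<open>i + 1\<close> can
  be lost: it is a loop if \<open>x\<close> joins these points as well, and it has no string of \<open>y\<close> if both are strings of \<open>x\<close>.
\<close>

context
  fixes i n :: nat and x v x' y :: "nat \<Rightarrow> nat"
  assumes x: "invol x" and v: "invol v" and i: "i \<le> n"
    and bounded: "\<And>a. a < Suc (Suc n) \<Longrightarrow> x a < Suc (Suc n)"
  defines "x' \<equiv> capf i x" and "y \<equiv> cup i v"
begin

lemma inv_x: "x (x a) = a" using x by (simp add: invol_def)

lemma inv_y: "invol y" unfolding y_def using v by (rule invol_cup)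

lemma y_simps: "y i = Suc i" "y (Suc i) = i" "y (shift i a) = shift i (v a)"
  by (simp_all add: y_def)

lemma y_fixed: "y b = b \<longleftrightarrow> (\<exists>d. b = shift i d \<and> v d = d)"
  by (cases b i rule: shift_cases) (auto simp: y_def)

lemma shift_bound: "shift i a < Suc (Suc n) \<longleftrightarrow> a < n"
  using i by (auto simp: shift_def)

lemma shift_x':
  assumes "\<not> (x i = i \<and> x (Suc i) = Suc i)"
  shows "shift i (x' a) = rejoin i x (shift i a)"
proof -
  have "rejoin i x (shift i a) \<noteq> i" "rejoin i x (shift i a) \<noteq> Suc i"
    using assms inv_x[of "shift i a"] inv_x[of i] inv_x[of "Suc i"] by (auto simp: rejoin_def split: if_splits)
  then show ?thesis by (simp add: x'_def capf_def shift_unshift)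
qed

lemma glue_unshift:
  assumes "\<not> (x i = i \<and> x (Suc i) = Suc i)" "(shift i a, shift i b) \<in> glue x y"
  shows "(a, b) \<in> glue x' v"
proof -
  \<comment> \<open>A path in the larger graph may rest at \<open>i\<close> or \<open>i + 1\<close>, which are not points of the smaller one. There the
    invariant speaks of the points by which the path can leave again.\<close>
  define P where "P c \<longleftrightarrow> (\<forall>d. c = shift i d \<longrightarrow> (a, d) \<in> glue x' v) \<and>
    (c = i \<or> c = Suc i \<longrightarrow> (\<forall>d. x i = shift i d \<or> x (Suc i) = shift i d \<longrightarrow> (a, d) \<in> glue x' v))" for c
  have "P (shift i b)"
    using assms(2)
  proof (induction rule: glue_induct)
    case refl
    then show ?case by (simp add: P_def glue_refl)
  next
    case (left c)
    show ?case
    proof (cases c i rule: shift_cases)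
      case (shift d)
      then have ad: "(a, d) \<in> glue x' v" using left by (simp add: P_def)
      then have ad': "(a, x' d) \<in> glue x' v" using glue_left glue_trans by fast
      show ?thesis
      proof (cases "x c" i rule: shift_cases)
        case left
        then have "x i = shift i d" using shift inv_x by metis
        moreover have "x' d = e" if "x (Suc i) = shift i e" for e
          using shift_x'[OF assms(1), of d] left shift that by (simp add: rejoin_def)
        ultimately show ?thesis using left ad ad' by (auto simp: P_def)
      next
        case right
        then have "x (Suc i) = shift i d" using shift inv_x by metis
        moreover have "x' d = e" if "x i = shift i e" for e
          using shift_x'[OF assms(1), of d] right shift that by (simp add: rejoin_def)
        ultimately show ?thesis using right ad ad' by (auto simp: P_def)
      next
        case (shift e)
        then have "x' d = e" using shift_x'[OF assms(1), of d] \<open>c = _\<close> by (simp add: rejoin_def)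
        then show ?thesis using shift ad' by (simp add: P_def)
      qed
    qed (use left in \<open>auto simp: P_def\<close>)
  next
    case (right c)
    show ?case
    proof (cases c i rule: shift_cases)
      case (shift d)
      then have "(a, d) \<in> glue x' v" using right by (simp add: P_def)
      then have "(a, v d) \<in> glue x' v" using glue_right glue_trans by fast
      then show ?thesis using shift by (simp add: P_def y_simps)
    qed (use right in \<open>auto simp: P_def y_simps\<close>)
  qed
  then show ?thesis by (simp add: P_def)
qed

lemma glue_shift:
  assumes "\<not> (x i = i \<and> x (Suc i) = Suc i)" "(a, b) \<in> glue x' v"
  shows "(shift i a, shift i b) \<in> glue x y"
  using assms(2)
proof (induction rule: glue_induct)
  case (left c)
  have 1: "(i, Suc i) \<in> glue x y" "(Suc i, i) \<in> glue x y"
    using glue_right[of _ y x] y_simps by metis+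
  have "(shift i c, shift i (x' c)) \<in> glue x y"
    unfolding shift_x'[OF assms(1)]
  proof (cases "x (shift i c) = i \<or> x (shift i c) = Suc i")
    case True
    have s: "(shift i c, x (shift i c)) \<in> glue x y" by (rule glue_left)
    have "(shift i c, x (Suc i)) \<in> glue x y" if "x (shift i c) = i"
      using glue_trans[OF glue_trans[OF s] glue_left[of "Suc i"]] that 1 by simp
    moreover have "(shift i c, x i) \<in> glue x y" if "x (shift i c) = Suc i"
      using glue_trans[OF glue_trans[OF s] glue_left[of "i"]] that 1 by simp
    ultimately show "(shift i c, rejoin i x (shift i c)) \<in> glue x y"
      using True by (auto simp: rejoin_def glue_refl)
  next
    case False
    then show "(shift i c, rejoin i x (shift i c)) \<in> glue x y"
      using glue_left by (simp add: rejoin_def)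
  qed
  with left show ?case by (rule glue_trans)
next
  case (right c)
  then show ?case using glue_right[of "shift i c" y x] glue_trans by (fastforce simp: y_simps)
qed (rule glue_refl)

lemma fixed_x':
  assumes "\<not> (x i = i \<and> x (Suc i) = Suc i)"
  shows "x' a = a \<longleftrightarrow> x (shift i a) = shift i a \<or> x i = shift i a \<and> x (Suc i) = Suc i
     \<or> x (Suc i) = shift i a \<and> x i = i"
proof -
  have "x' a = a \<longleftrightarrow> rejoin i x (shift i a) = shift i a"
    using shift_x'[OF assms, of a] by (metis shift_eq_iff)
  then show ?thesis
    using inv_x[of "shift i a"] inv_x[of i] inv_x[of "Suc i"] by (auto simp: rejoin_def split: if_splits)
qed

text \<open>
  A string of \<open>x'\<close> is a string of \<open>x\<close> or was connected to one through the cup.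
\<close>

lemma fixed_x'_glue:
  assumes "\<not> (x i = i \<and> x (Suc i) = Suc i)" "x' a = a" "a < n"
  obtains f where "x f = f" "f < Suc (Suc n)" "(shift i a, f) \<in> glue x y"
proof -
  have 1: "(i, Suc i) \<in> glue x y" "(Suc i, i) \<in> glue x y"
    using glue_right[of _ y x] y_simps by metis+
  consider "x (shift i a) = shift i a" | "x (shift i a) = i" "x (Suc i) = Suc i"
    | "x (shift i a) = Suc i" "x i = i"
    using assms fixed_x'[OF assms(1), of a] inv_x by metis
  then show ?thesis
  proof cases
    case 1 then show ?thesis using that[of "shift i a"] shift_bound assms(3) by (simp add: glue_refl)
  next
    case 2
    then have "(shift i a, Suc i) \<in> glue x y" using 1 glue_left[of "shift i a" x y] glue_trans by metis
    then show ?thesis using that[of "Suc i"] 2 i by simp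
  next
    case 3
    then have "(shift i a, i) \<in> glue x y" using 1 glue_left[of "shift i a" x y] glue_trans by metis
    then show ?thesis using that[of i] 3 i by simp
  qed
qed

lemma fixed_x_glue:
  assumes "\<not> (x i = i \<and> x (Suc i) = Suc i)" "x f = f" "f < Suc (Suc n)"
  obtains a where "x' a = a" "a < n" "(f, shift i a) \<in> glue x y"
proof (cases f i rule: shift_cases)
  case left
  then obtain a where a: "x (Suc i) = shift i a"
    using assms inv_x by (metis shift_cases)
  have "(i, shift i a) \<in> glue x y"
    using glue_right[of i y x] glue_left[of "Suc i" x y] a glue_trans by (metis y_simps(1))
  then show ?thesis
    using that[of a] fixed_x'[OF assms(1), of a] a left assms(2) bounded[of "Suc i"] i shift_bound by simp
next
  case right
  then obtain a where a: "x i = shift i a"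
    using assms inv_x by (metis shift_cases)
  have "(Suc i, shift i a) \<in> glue x y"
    using glue_right[of "Suc i" y x] glue_left[of i x y] a glue_trans by (metis y_simps(2))
  then show ?thesis
    using that[of a] fixed_x'[OF assms(1), of a] a right assms(2) bounded[of i] i shift_bound by simp
next
  case (shift a)
  then show ?thesis using that[of a] assms fixed_x'[OF assms(1), of a] shift_bound by (simp add: glue_refl)
qed

lemma strings_matched:
  assumes "\<not> (x i = i \<and> x (Suc i) = Suc i)"
  shows "(\<forall>f<Suc (Suc n). x f = f \<longrightarrow> (\<exists>j<Suc (Suc n). y j = j \<and> (f, j) \<in> glue x y)) \<longleftrightarrow>
    (\<forall>a<n. x' a = a \<longrightarrow> (\<exists>j<n. v j = j \<and> (a, j) \<in> glue x' v))" (is "?L \<longleftrightarrow> ?R")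
proof
  assume L: ?L
  show ?R
  proof (intro allI impI)
    fix a assume a: "a < n" "x' a = a"
    then obtain f where f: "x f = f" "f < Suc (Suc n)" "(shift i a, f) \<in> glue x y"
      using fixed_x'_glue[OF assms] by blast
    then obtain j where "j < Suc (Suc n)" "y j = j" "(f, j) \<in> glue x y" using L by blast
    moreover then obtain d where "j = shift i d" "v d = d" using y_fixed by blast
    ultimately show "\<exists>j<n. v j = j \<and> (a, j) \<in> glue x' v"
      using glue_unshift[OF assms, of a d] glue_trans[OF f(3), of j] shift_bound[of d] by auto
  qed
next
  assume R: ?R
  show ?L
  proof (intro allI impI)
    fix f assume f: "f < Suc (Suc n)" "x f = f"
    then obtain a where a: "x' a = a" "a < n" "(f, shift i a) \<in> glue x y"
      using fixed_x_glue[OF assms] by blast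
    then obtain j where j: "j < n" "v j = j" "(a, j) \<in> glue x' v" using R by blast
    then have "(f, shift i j) \<in> glue x y" using glue_shift[OF assms] a(3) glue_trans by blast
    then show "\<exists>j<Suc (Suc n). y j = j \<and> (f, j) \<in> glue x y"
      using j y_simps(3)[of j] shift_bound[of j] by (intro exI[of _ "shift i j"]) simp
  qed
qed

lemma mem_loops:
  "C \<in> loops m a b \<longleftrightarrow> (\<exists>f<m. C = glue a b `` {f}) \<and> (\<forall>c\<in>C. a c \<noteq> c \<and> b c \<noteq> c)"
  unfolding loops_def by (simp only: mem_Collect_eq image_iff Bex_def lessThan_iff)

lemma card_loops:
  assumes "\<not> (x i = i \<and> x (Suc i) = Suc i)"
  shows "card (loops (Suc (Suc n)) x y) = (if x i = Suc i then Suc (card (loops n x' v)) else card (loops n x' v))"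
proof -
  let ?E = "glue x y" and ?E' = "glue x' v"
  define loop where "loop C \<longleftrightarrow> (\<forall>c\<in>C. x c \<noteq> c \<and> y c \<noteq> c)" for C
  define loop' where "loop' C \<longleftrightarrow> (\<forall>c\<in>C. x' c \<noteq> c \<and> v c \<noteq> c)" for C
  note mem = mem_loops[of _ "Suc (Suc n)" x y, folded loop_def]
  let ?C = "\<lambda>a. ?E `` {shift i a}"
  have pre: "shift i -` ?C a = ?E' `` {a}" for a
  proof (rule set_eqI)
    show "c \<in> shift i -` ?C a \<longleftrightarrow> c \<in> ?E' `` {a}" for c
      using glue_unshift[OF assms, of a c] glue_shift[OF assms, of a c] by auto
  qed
  have loop_iff: "loop (?C a) \<longleftrightarrow> loop' (?E' `` {a})" for a
  proof
    assume L: "loop (?C a)"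
    show "loop' (?E' `` {a})"
      unfolding loop'_def
    proof
      fix d assume "d \<in> ?E' `` {a}"
      then have d: "(shift i a, shift i d) \<in> ?E" using glue_shift[OF assms] by blast
      have "v d \<noteq> d" using L d y_fixed unfolding loop_def by blast
      moreover have "x' d \<noteq> d"
      proof
        assume "x' d = d"
        then have "x (shift i d) = shift i d \<or> x (shift i d) = i \<and> x (Suc i) = Suc i
            \<or> x (shift i d) = Suc i \<and> x i = i"
          using fixed_x'[OF assms, of d] inv_x by metis
        moreover have "(shift i a, x (shift i d)) \<in> ?E" "(shift i a, y (x (shift i d))) \<in> ?E"
          using d glue_left glue_right glue_trans by metis+
        ultimately show False using L d y_simps unfolding loop_def by (metis Image_singleton_iff)
      qed
      ultimately show "x' d \<noteq> d \<and> v d \<noteq> d" by simp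
    qed
  next
    assume L: "loop' (?E' `` {a})"
    then have L': "x' d \<noteq> d \<and> v d \<noteq> d" if "(shift i a, shift i d) \<in> ?E" for d
      using glue_unshift[OF assms, of a d] L that unfolding loop'_def by blast
    show "loop (?C a)"
      unfolding loop_def
    proof
      fix c assume "c \<in> ?C a"
      then have c: "(shift i a, c) \<in> ?E" by simp
      then have cx: "(shift i a, x c) \<in> ?E" "(shift i a, y c) \<in> ?E" "(shift i a, x (y c)) \<in> ?E"
        using glue_left glue_right glue_trans by metis+
      have "y c \<noteq> c"
      proof
        assume "y c = c"
        then obtain d where "c = shift i d" "v d = d" using y_fixed by auto
        then show False using L' c by simp
      qed
      moreover have "x c \<noteq> c"
      proof
        assume xc: "x c = c"
        show False
        proof (cases c i rule: shift_cases)
          case left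
          then obtain d where "x (Suc i) = shift i d"
            using assms xc inv_x by (metis shift_cases)
          then show False using L'[of d] cx(3) left y_simps fixed_x'[OF assms, of d] xc by simp
        next
          case right
          then obtain d where "x i = shift i d"
            using assms xc inv_x by (metis shift_cases)
          then show False using L'[of d] cx(3) right y_simps fixed_x'[OF assms, of d] xc by simp
        next
          case (shift d)
          then show False using L'[of d] c fixed_x'[OF assms, of d] xc by simp
        qed
      qed
      ultimately show "x c \<noteq> c \<and> y c \<noteq> c" by simp
    qed
  qed
  \<comment> \<open>The loops that visit some point other than \<open>i\<close> and \<open>i + 1\<close>; they correspond to the loops of the smaller graph.\<close>
  define M where "M = {?C a | a. a < n \<and> loop (?C a)}"
  have "loops n x' v = {?E' `` {a} | a. a < n \<and> loop' (?E' `` {a})}"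
    by (rule set_eqI, subst mem_loops, fold loop'_def) blast
  also have "\<dots> = {shift i -` ?C a | a. a < n \<and> loop (?C a)}"
    by (simp only: pre loop_iff)
  also have "\<dots> = (\<lambda>C. shift i -` C) ` M"
    unfolding M_def by blast
  finally have "loops n x' v = (\<lambda>C. shift i -` C) ` M" .
  moreover have "inj_on (\<lambda>C. shift i -` C) M"
  proof (rule inj_onI)
    fix C D assume "C \<in> M" "D \<in> M" and eq: "shift i -` C = shift i -` D"
    then obtain a b where ab: "C = ?C a" "D = ?C b" unfolding M_def by auto
    then have "shift i a \<in> C" by (simp add: glue_refl)
    then have "shift i a \<in> D" using eq by blast
    then have "(shift i b, shift i a) \<in> ?E" using ab by simp
    then show "C = D" using glue_class_eq[OF x inv_y] ab by simp
  qed
  ultimately have cM: "card (loops n x' v) = card M" by (simp add: card_image)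
  have finM: "finite M" by (simp add: M_def)
  have M_loops: "M \<subseteq> loops (Suc (Suc n)) x y"
  proof
    fix C assume "C \<in> M"
    then obtain a where "a < n" "C = ?C a" "loop C" unfolding M_def by blast
    then show "C \<in> loops (Suc (Suc n)) x y"
      unfolding mem using shift_bound[of a] by blast
  qed
  show ?thesis
  proof (cases "x i = Suc i")
    case True
    have xs: "x (Suc i) = i" using inv_x[of i] True by simp
    have cl: "?E `` {f} = {i, Suc i}" if "f = i \<or> f = Suc i" for f
    proof -
      have "c \<in> {i, Suc i}" if "(f, c) \<in> ?E" for c
        using that by (induction rule: glue_induct) (use \<open>f = i \<or> f = Suc i\<close> True xs y_simps in auto)
      moreover have "(f, i) \<in> ?E" "(f, Suc i) \<in> ?E"
        using that glue_right[of i y x] glue_right[of "Suc i" y x] glue_refl[of f x y] y_simps by auto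
      ultimately show ?thesis by blast
    qed
    have loopI: "loop {i, Suc i}" using True xs y_simps by (simp add: loop_def)
    have "loops (Suc (Suc n)) x y = insert {i, Suc i} M"
    proof (intro equalityI subsetI)
      fix C assume "C \<in> loops (Suc (Suc n)) x y"
      then obtain f where f: "f < Suc (Suc n)" "C = ?E `` {f}" "loop C" unfolding mem by blast
      show "C \<in> insert {i, Suc i} M"
      proof (cases f i rule: shift_cases)
        case (shift a)
        then have "C \<in> M" unfolding M_def using f shift_bound by blast
        then show ?thesis by blast
      qed (use f cl in simp_all)
    next
      fix C assume "C \<in> insert {i, Suc i} M"
      moreover have "{i, Suc i} \<in> loops (Suc (Suc n)) x y"
        unfolding mem using cl[of i] loopI i by (intro conjI exI[of _ i]) auto
      ultimately show "C \<in> loops (Suc (Suc n)) x y" using M_loops by blast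
    qed
    moreover have "{i, Suc i} \<notin> M"
    proof
      assume "{i, Suc i} \<in> M"
      then obtain a where "{i, Suc i} = ?C a" unfolding M_def by blast
      then have "shift i a \<in> {i, Suc i}" by (simp add: glue_refl)
      then show False by simp
    qed
    ultimately show ?thesis using True cM finM by simp
  next
    case False
    have "loops (Suc (Suc n)) x y = M"
    proof (intro equalityI subsetI)
      fix C assume "C \<in> loops (Suc (Suc n)) x y"
      then obtain f where f: "f < Suc (Suc n)" "C = ?E `` {f}" "loop C" unfolding mem by blast
      then have xf: "x f \<noteq> f" using glue_refl unfolding loop_def by blast
      obtain a where a: "a < n" "(f, shift i a) \<in> ?E"
      proof (cases f i rule: shift_cases)
        case (shift a)
        then show ?thesis using f(1) shift_bound[of a] glue_refl that[of a] by simp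
      next
        case left
        then obtain a where a: "x i = shift i a" using False xf by (metis shift_cases)
        then have "a < n" using bounded[of i] i shift_bound[of a] by simp
        then show ?thesis using left glue_left[of i x y] a that[of a] by simp
      next
        case right
        have "x (Suc i) \<noteq> i" using False inv_x by metis
        then obtain a where a: "x (Suc i) = shift i a" using xf right by (metis shift_cases)
        then have "a < n" using bounded[of "Suc i"] i shift_bound[of a] by simp
        then show ?thesis using right glue_left[of "Suc i" x y] a that[of a] by simp
      qed
      then have "C = ?C a" using glue_class_eq[OF x inv_y] f(2) by simp
      then show "C \<in> M" using a f(3) unfolding M_def by blast
    next
      fix C assume "C \<in> M"
      then show "C \<in> loops (Suc (Suc n)) x y" using M_loops by blast
    qed
    then show ?thesis using False cM by simp
  qed
qed

lemma state_form_right_cup: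
  "state_form \<delta> (Suc (Suc n)) x y =
    (if x i = i \<and> x (Suc i) = Suc i then 0
     else if x i = Suc i then \<delta> * state_form \<delta> n x' v else state_form \<delta> n x' v)"
proof (cases "x i = i \<and> x (Suc i) = Suc i")
  case True
  have "c \<in> {i, Suc i}" if "(i, c) \<in> glue x y" for c
    using that by (induction rule: glue_induct) (use True y_simps in auto)
  then have "\<not> (y j = j \<and> (i, j) \<in> glue x y)" for j
    using y_simps(1,2) by fastforce
  then have "\<not> (\<forall>f<Suc (Suc n). x f = f \<longrightarrow> (\<exists>j<Suc (Suc n). y j = j \<and> (f, j) \<in> glue x y))"
    using True i by (metis le_imp_less_Suc less_SucI)
  then have "state_form \<delta> (Suc (Suc n)) x y = 0"
    unfolding state_form_def by (rule if_not_P)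
  then show ?thesis using True by simp
next
  case False
  define R where "R \<longleftrightarrow> (\<forall>a<n. x' a = a \<longrightarrow> (\<exists>j<n. v j = j \<and> (a, j) \<in> glue x' v))"
  have "state_form \<delta> (Suc (Suc n)) x y = (if R then \<delta> ^ card (loops (Suc (Suc n)) x y) else 0)"
    unfolding state_form_def strings_matched[OF False] R_def ..
  moreover have "state_form \<delta> n x' v = (if R then \<delta> ^ card (loops n x' v) else 0)"
    unfolding state_form_def R_def ..
  ultimately show ?thesis using False by (auto simp: card_loops[OF False])
qed

end

lemma state_form_cup:
  assumes "u \<in> link_states (Suc (Suc n)) p" "v \<in> link_states n r" "i \<le> n"
  shows "state_form \<delta> (Suc (Suc n)) u (cup i v) =
    (if u i = i \<and> u (Suc i) = Suc i then 0
     else if u i = Suc i then \<delta> * state_form \<delta> n (capf i u) v else state_form \<delta> n (capf i u) v)"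
  using link_states_invol[OF assms(1)] link_states_invol[OF assms(2)] assms(3) link_states_le[OF assms(1)]
  by (rule state_form_right_cup)

section \<open>The bilinear form\<close>

lemma form_superset:
  assumes "finite S" "Poly_Mapping.keys x \<subseteq> S" "finite T" "Poly_Mapping.keys y \<subseteq> T"
  shows "form \<delta> n x y = (\<Sum>u\<in>S. \<Sum>v\<in>T. Poly_Mapping.lookup x u * Poly_Mapping.lookup y v * state_form \<delta> n u v)"
proof -
  have "form \<delta> n x y = (\<Sum>u\<in>Poly_Mapping.keys x. \<Sum>v\<in>T. Poly_Mapping.lookup x u * Poly_Mapping.lookup y v * state_form \<delta> n u v)"
    unfolding form_def using assms(3,4)
    by (intro sum.cong sum.mono_neutral_left) (auto simp: in_keys_iff)
  also have "\<dots> = (\<Sum>u\<in>S. \<Sum>v\<in>T. Poly_Mapping.lookup x u * Poly_Mapping.lookup y v * state_form \<delta> n u v)"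
    using assms(1,2) by (intro sum.mono_neutral_left) (auto simp: in_keys_iff)
  finally show ?thesis .
qed

lemma form_0 [simp]: "form \<delta> n 0 y = 0" "form \<delta> n x 0 = 0"
  by (simp_all add: form_def)

lemma form_basis [simp]: "form \<delta> n (basis u) (basis v) = state_form \<delta> n u v"
  by (simp add: form_def)

lemma form_add_left: "form \<delta> n (x + x') y = form \<delta> n x y + form \<delta> n x' y"
proof -
  let ?S = "Poly_Mapping.keys x \<union> Poly_Mapping.keys x'"
  note f = form_superset[where S="?S" and T="Poly_Mapping.keys y"]
  have "Poly_Mapping.keys (x + x') \<subseteq> ?S" by (rule keys_add)
  then show ?thesis
    by (simp add: f lookup_add algebra_simps sum.distrib)
qed

lemma form_add_right: "form \<delta> n x (y + y') = form \<delta> n x y + form \<delta> n x y'"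
proof -
  let ?S = "Poly_Mapping.keys y \<union> Poly_Mapping.keys y'"
  note f = form_superset[where T="?S" and S="Poly_Mapping.keys x"]
  have "Poly_Mapping.keys (y + y') \<subseteq> ?S" by (rule keys_add)
  then show ?thesis
    by (simp add: f lookup_add algebra_simps sum.distrib)
qed

lemma form_scale_left: "form \<delta> n (scale c x) y = c * form \<delta> n x y"
  using keys_scale[of c x]
  by (simp add: form_superset[where T="Poly_Mapping.keys y" and S="Poly_Mapping.keys x"]
      sum_distrib_left mult_ac)

lemma form_scale_right: "form \<delta> n x (scale c y) = c * form \<delta> n x y"
  using keys_scale[of c y]
  by (simp add: form_superset[where T="Poly_Mapping.keys y" and S="Poly_Mapping.keys x"]
      sum_distrib_left mult_ac)

lemmas form_bilinear = form_add_left form_add_right form_scale_left form_scale_right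

lemma form_diff_right: "form \<delta> n x (y - y') = form \<delta> n x y - form \<delta> n x y'"
proof -
  have "form \<delta> n x (y - y') + form \<delta> n x y' = form \<delta> n x y"
    by (simp flip: form_add_right)
  then show ?thesis by (simp add: algebra_simps)
qed

lemma form_diff_left: "form \<delta> n (y - y') x = form \<delta> n y x - form \<delta> n y' x"
proof -
  have "form \<delta> n (y - y') x + form \<delta> n y' x = form \<delta> n y x"
    by (simp flip: form_add_left)
  then show ?thesis by (simp add: algebra_simps)
qed

lemma form_sum_left: "form \<delta> n (\<Sum>i\<in>I. f i) y = (\<Sum>i\<in>I. form \<delta> n (f i) y)"
  by (induction I rule: infinite_finite_induct) (simp_all add: form_add_left)

lemma form_lin_ext_left:
  "form \<delta> n (lin_ext f x) y = (\<Sum>u\<in>Poly_Mapping.keys x. Poly_Mapping.lookup x u * form \<delta> n (f u) y)"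
  by (simp add: lin_ext_def form_sum_left form_scale_left)

text \<open>
  Cups and caps are adjoint: a cup on the right becomes a cap on the left. As link states are words of cups,
  this determines the form, and its symmetry follows from the relations between cups and caps (\<open>form_sym\<close>).
\<close>

lemma form_cup:
  assumes x: "x \<in> standard (Suc (Suc n)) p" and y: "y \<in> standard n r" and i: "i \<le> n"
  shows "form \<delta> (Suc (Suc n)) x (cupop i y) = form \<delta> n (capop \<delta> i x) y"
  using x
proof (induction x rule: standard_induct)
  case (basis u)
  from y show ?case
  proof (induction y rule: standard_induct)
    case (basis v)
    then show ?case using state_form_cup[OF \<open>u \<in> _\<close> basis i]
      by (simp add: cap_state_def form_bilinear)
  qed (simp_all add: form_bilinear)
qed (simp_all add: form_bilinear)

lemma state_form_id: "state_form \<delta> n (\<lambda>a. a) (\<lambda>a. a) = 1"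
proof -
  have "loops n (\<lambda>a. a) (\<lambda>a. a) = {}"
    using glue_refl by (auto simp: loops_def)
  then show ?thesis using glue_refl by (auto simp: state_form_def)
qed

lemma radical_0: "radical \<delta> n 0 = {0}"
proof -
  have "c = 0" if "\<forall>y\<in>standard n 0. form \<delta> n (scale c (basis (\<lambda>a. a))) y = 0" for c
    using that[rule_format, of "basis (\<lambda>a. a)"]
    by (simp add: form_bilinear state_form_id link_states_0)
  then show ?thesis unfolding radical_def by (auto simp: standard_0_iff)
qed

text \<open>
  Every state with a cup is \<open>u\<^sub>i y\<close> for some \<open>i\<close> and \<open>y\<close>, so orthogonality to all states is a condition on the
  caps.
\<close>

lemma radical_Suc:
  "x \<in> radical \<delta> (Suc (Suc n)) (Suc p) \<longleftrightarrow>
    x \<in> standard (Suc (Suc n)) (Suc p) \<and> (\<forall>i\<le>n. capop \<delta> i x \<in> radical \<delta> n p)"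
proof (intro iffI conjI allI impI)
  assume x: "x \<in> radical \<delta> (Suc (Suc n)) (Suc p)"
  then show s: "x \<in> standard (Suc (Suc n)) (Suc p)" by (simp add: radical_def)
  fix i assume i: "i \<le> n"
  show "capop \<delta> i x \<in> radical \<delta> n p"
    unfolding radical_def using standard_cap[OF s i] form_cup[OF s _ i] standard_cup[OF _ i] x
    by (auto simp: radical_def simp flip: form_cup[OF s _ i])
next
  assume x: "x \<in> standard (Suc (Suc n)) (Suc p) \<and> (\<forall>i\<le>n. capop \<delta> i x \<in> radical \<delta> n p)"
  have "form \<delta> (Suc (Suc n)) x y = 0" if "y \<in> standard (Suc (Suc n)) (Suc p)" for y
    using that
  proof (induction y rule: standard_Suc_induct)
    case (cup n' i y)
    then have "capop \<delta> i x \<in> radical \<delta> n p" using x by simp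
    then show ?case using cup x form_cup[of x n "Suc p" y p i] by (simp add: radical_def)
  qed (simp_all add: form_bilinear)
  then show "x \<in> radical \<delta> (Suc (Suc n)) (Suc p)" using x by (simp add: radical_def)
qed

text \<open>
  A string added at the end of both states neither closes a loop nor changes any connection.
\<close>

lemma form_mono:
  "x \<in> standard n p \<Longrightarrow> y \<in> standard n p \<Longrightarrow> form \<delta> (Suc n) x y = form \<delta> n x y"
proof (induction p arbitrary: n x y)
  case 0
  then show ?case by (auto simp: standard_0_iff form_bilinear state_form_id)
next
  case (Suc p)
  from Suc.prems(2) show ?case
  proof (induction y rule: standard_Suc_induct)
    case (cup m i y)
    then have "x \<in> standard (Suc (Suc m)) (Suc p)" using Suc.prems by simp
    then show ?case
      using cup form_cup[of x m "Suc p" y p i] form_cup[of x "Suc m" "Suc p" y p i] standard_mono[of _ _ _ "Suc _"]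
        Suc.IH[of "capop \<delta> i x" m y] standard_cap[of x m p i \<delta>] by simp
  qed (simp_all add: form_bilinear)
qed

text \<open>
  For two words of cups, \<open>\<langle>u\<^sub>i a, u\<^sub>j b\<rangle>\<close> is evaluated by moving \<open>u\<^sub>j\<close> to the left argument; if \<open>i\<close> and \<open>j\<close> are far
  apart, the induction hypothesis is needed for one and for two cups less.
\<close>

lemma form_sym:
  "x \<in> standard n p \<Longrightarrow> y \<in> standard n p \<Longrightarrow> form \<delta> n x y = form \<delta> n y x"
proof (induction p arbitrary: n x y rule: less_induct)
  case (less p)
  show ?case
  proof (cases p)
    case 0
    then show ?thesis using less.prems by (auto simp: standard_0_iff form_bilinear)
  next
    case (Suc r)
    have key: "form \<delta> n (cupop i a) (cupop j b) = form \<delta> n (cupop j b) (cupop i a)"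
      if n: "n = Suc (Suc m)" and ab: "a \<in> standard m r" "b \<in> standard m r" "i \<le> m" "j \<le> m" "i \<le> j" for m a b i j
    proof -
      have A: "form \<delta> n (cupop i a) (cupop j b) = form \<delta> m (capop \<delta> j (cupop i a)) b"
        unfolding n by (rule form_cup[where p = "Suc r" and r = r]) (use standard_cup ab in auto)
      have B: "form \<delta> n (cupop j b) (cupop i a) = form \<delta> m (capop \<delta> i (cupop j b)) a"
        unfolding n by (rule form_cup[where p = "Suc r" and r = r]) (use standard_cup ab in auto)
      have inv: "invvec a" "invvec b" using ab standard_invvec by auto
      have S: "form \<delta> m a b = form \<delta> m b a" using less.IH[of r a m b] Suc ab by simp
      show ?thesis
      proof (cases j i rule: near_far_cases)
        case same
        then show ?thesis using A B S by (simp add: form_bilinear)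
      next
        case up
        then show ?thesis using A B S inv by (simp add: cap_cup_Suc cap_Suc_cup)
      next
        case (far_up l)
        show ?thesis
        proof (cases r)
          case 0
          then show ?thesis using A B far_up inv ab by (simp add: cap_cup_far cap_far_cup cap_standard_0)
        next
          case (Suc s)
          obtain m' where m': "m = Suc (Suc m')" "l \<le> m'" using far_up(1) ab(4) by (intro that[of "m - 2"]) auto
          have ca: "capop \<delta> l a \<in> standard m' s" and cb: "capop \<delta> i b \<in> standard m' s"
            using standard_cap[of _ m' s] ab m' Suc far_up by auto
          have im: "i \<le> m'" using far_up m' by simp
          have "form \<delta> n (cupop i a) (cupop j b) = form \<delta> m (cupop i (capop \<delta> l a)) b"
            using A far_up inv by (simp add: cap_far_cup)
          also have "\<dots> = form \<delta> m b (cupop i (capop \<delta> l a))"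
            using less.IH[of r _ m] \<open>p = Suc r\<close> ab ca standard_cup[OF ca im] m' Suc by simp
          also have "\<dots> = form \<delta> m' (capop \<delta> i b) (capop \<delta> l a)"
            unfolding m' by (rule form_cup[OF _ ca im]) (use ab m' in simp)
          also have "\<dots> = form \<delta> m' (capop \<delta> l a) (capop \<delta> i b)"
            using less.IH[of s _ m'] \<open>p = Suc r\<close> Suc ca cb by simp
          also have "\<dots> = form \<delta> m a (cupop l (capop \<delta> i b))"
            unfolding m' by (rule form_cup[OF _ cb m'(2), symmetric]) (use ab m' in simp)
          also have "\<dots> = form \<delta> m (cupop l (capop \<delta> i b)) a"
            using less.IH[of r _ m] \<open>p = Suc r\<close> ab standard_cup[OF cb m'(2)] m' Suc by simp
          also have "\<dots> = form \<delta> n (cupop j b) (cupop i a)"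
            using B far_up inv by (simp add: cap_cup_far)
          finally show ?thesis .
        qed
      qed (use \<open>i \<le> j\<close> in simp_all)
    qed
    have "x \<in> standard n (Suc r)" "y \<in> standard n (Suc r)" using less.prems Suc by auto
    then show ?thesis
    proof (induction x rule: standard_Suc_induct)
      case (cup m i a)
      from cup(4) show ?case
      proof (induction y rule: standard_Suc_induct)
        case (cup m' j b)
        then have "m' = m" using \<open>n = Suc (Suc m)\<close> by simp
        then show ?case
          using key[OF \<open>n = Suc (Suc m)\<close>, of a b i j] key[OF \<open>n = Suc (Suc m)\<close>, of b a j i]
            cup \<open>a \<in> _\<close> \<open>i \<le> m\<close> by (cases "i \<le> j") auto
      qed (simp_all add: form_bilinear)
    qed (simp_all add: form_bilinear)
  qed
qed

section \<open>Indexing by the number of strings\<close>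

text \<open>
  The points beyond the end of a finite state are fixed, so adding a string at the end does not change the
  encoding: \<open>V k p \<subseteq> V (Suc k) p\<close>, as sets of vectors.
\<close>

abbreviation V :: "nat \<Rightarrow> nat \<Rightarrow> vec set" where
  "V k p \<equiv> standard (k + 2 * p) p"

text \<open>
  The cap at the last point. The loop value is irrelevant for it by \<open>cap_last_indep\<close> and is fixed to 0, so that the
  map does not depend on \<open>\<delta>\<close> when \<open>\<delta>\<close> is varied.
\<close>

definition rho :: "nat \<Rightarrow> nat \<Rightarrow> vec \<Rightarrow> vec" where
  "rho k p = capop 0 (Suc (k + 2 * p))"

lemma rho_lin [simp]:
  "rho k p 0 = 0" "rho k p (x + y) = rho k p x + rho k p y" "rho k p (x - y) = rho k p x - rho k p y"
  "rho k p (scale c x) = scale c (rho k p x)"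
  by (simp_all add: rho_def)

lemma rho_sum: "rho k p (\<Sum>a\<in>I. g a) = (\<Sum>a\<in>I. rho k p (g a))"
  by (simp add: rho_def capop_sum)

lemma V_cup: "y \<in> V k p \<Longrightarrow> i \<le> k + 2 * p \<Longrightarrow> cupop i y \<in> V k (Suc p)"
  using standard_cup[of y "k + 2 * p" p i] by simp

lemma V_cap: "x \<in> V k (Suc p) \<Longrightarrow> i \<le> k + 2 * p \<Longrightarrow> capop \<delta> i x \<in> V k p"
  using standard_cap[of x "k + 2 * p" p i] by simp

lemma V_mono: "x \<in> V k p \<Longrightarrow> x \<in> V (Suc k) p"
  by (erule standard_mono) linarith

lemma rho_eq: "x \<in> V k (Suc p) \<Longrightarrow> capop \<delta> (Suc (k + 2 * p)) x = rho k p x"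
  unfolding rho_def by (rule cap_last_indep[of _ _ "Suc p"]) simp

lemma V_rho: "x \<in> V k (Suc p) \<Longrightarrow> rho k p x \<in> V (Suc k) p"
  unfolding rho_def using standard_cap_last[of x "Suc (k + 2 * p)" p] by simp

lemma kernel_rho:
  assumes "x \<in> V k (Suc p)" "rho k p x = 0"
  obtains "x = 0" | k' where "k = Suc k'" "x \<in> V k' (Suc p)"
proof -
  have x: "x \<in> standard (Suc (k + 2 * p)) (Suc p)"
    using kernel_cap_last[of x "Suc (k + 2 * p)" "Suc p" 0] assms by (simp add: rho_def)
  show thesis
  proof (cases k)
    case 0
    then show ?thesis using that(1) standard_small[OF x] by simp
  next
    case (Suc k')
    then show ?thesis using that(2) x by simp
  qed
qed

lemma rho_inclusion: "x \<in> V k (Suc p) \<Longrightarrow> rho (Suc k) p x = 0"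
  unfolding rho_def by (rule cap_outside[of _ "k + 2 * Suc p" "Suc p"]) simp_all

lemma cap_rho:
  assumes "x \<in> V k (Suc (Suc p))" "i \<le> Suc (k + 2 * p)"
  shows "capop \<delta> i (rho k (Suc p) x) = rho k p (capop \<delta> i x)"
proof -
  have x': "capop \<delta> i x \<in> V k (Suc p)" using V_cap[of x k "Suc p" i] assms by simp
  have "capop \<delta> i (rho k (Suc p) x) = capop \<delta> i (capop \<delta> (Suc (Suc (Suc (k + 2 * p)))) x)"
    using rho_eq[OF assms(1), of \<delta>] by simp
  also have "\<dots> = capop \<delta> (Suc (k + 2 * p)) (capop \<delta> i x)"
    by (rule cap_cap[OF assms(1,2)])
  finally show ?thesis using rho_eq[OF x'] by simp
qed

lemma rho_cup:
  assumes "y \<in> V k (Suc p)" "i \<le> Suc (k + 2 * p)"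
  shows "rho k (Suc p) (cupop i y) = cupop i (rho k p y)"
  using cap_far_cup[OF standard_invvec[OF assms(1)] assms(2), of 0] by (simp add: rho_def)

lemma rho_cup_last: "y \<in> V k p \<Longrightarrow> rho k p (cupop (k + 2 * p) y) = y"
  unfolding rho_def by (rule cap_Suc_cup) (rule standard_invvec)

lemma V_form_cup:
  assumes "x \<in> V k (Suc p)" "y \<in> V k p" "i \<le> k + 2 * p"
  shows "form \<delta> (k + 2 * Suc p) x (cupop i y) = form \<delta> (k + 2 * p) (capop \<delta> i x) y"
  using form_cup[of x "k + 2 * p" "Suc p" y p i] assms by simp

lemma V_Suc_induct [consumes 1, case_names zero add scale cup]:
  assumes "x \<in> V k (Suc p)" "P 0"
    "\<And>x y. x \<in> V k (Suc p) \<Longrightarrow> y \<in> V k (Suc p) \<Longrightarrow> P x \<Longrightarrow> P y \<Longrightarrow> P (x + y)"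
    "\<And>c x. x \<in> V k (Suc p) \<Longrightarrow> P x \<Longrightarrow> P (scale c x)"
    "\<And>i y. i \<le> k + 2 * p \<Longrightarrow> y \<in> V k p \<Longrightarrow> P (cupop i y)"
  shows "P x"
  using assms(1) by (induction x rule: standard_Suc_induct) (use assms(2-) in auto)

section \<open>A sequence of Chebyshev polynomials\<close>

text \<open>
  For \<open>t = q + 1/q\<close> and \<open>q\<^sup>2 \<noteq> 1\<close>, the value at \<open>t\<close> is the signed quantum integer
  \<open>(-1)\<^bsup>j - 1\<^esup> (q\<^bsup>j\<^esup> - q\<^bsup>-j\<^esup>) / (q - q\<^bsup>-1\<^esup>)\<close>. With the sign, the recursion is the condition that the caps of
  the combination \<open>wave\<close> below vanish.
\<close>

fun cheb :: "nat \<Rightarrow> complex poly" where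
  "cheb 0 = 0"
| "cheb (Suc 0) = 1"
| "cheb (Suc (Suc j)) = - ([:0, 1:] * cheb (Suc j)) - cheb j"

abbreviation A :: "complex \<Rightarrow> nat \<Rightarrow> complex" where
  "A t j \<equiv> poly (cheb j) t"

lemma A_consecutive: "A t j = 0 \<Longrightarrow> A t (Suc j) \<noteq> 0"
  by (induction j) auto

text \<open>
  The recursion reads the same in both directions, so the sequence is odd about each of its zeros.
\<close>

lemma A_reflect: "A t m = 0 \<Longrightarrow> j \<le> m \<Longrightarrow> A t (m + j) = - A t (m - j)"
proof (induction j rule: cheb.induct)
  case 2
  then obtain m' where "m = Suc m'" by (cases m) auto
  with 2 show ?case by simp
next
  case (3 j)
  then obtain l where l: "m = Suc (Suc l) + j" using 3 by (intro that[of "m - Suc (Suc j)"]) simp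
  have "A t (m + Suc (Suc j)) = - t * A t (m + Suc j) - A t (m + j)" by simp
  also have "A t (m + Suc j) = - A t (Suc l)" using 3 l by simp
  also have "A t (m + j) = - A t (Suc (Suc l))" using 3 l by simp
  also have "- t * - A t (Suc l) - - A t (Suc (Suc l)) = - A t l" by simp
  finally show ?case using l by simp
qed simp

text \<open>
  At this point no \<open>A j\<close> with \<open>j > 0\<close> vanishes; hence none of these polynomials is zero.
\<close>

lemma A_minus_two: "A (-2) j = of_nat j"
  by (induction j rule: cheb.induct) (simp_all add: algebra_simps)

declare cheb.simps(3) [simp del]

text \<open>
  The classical formula for the derivative of the Chebyshev polynomials of the second kind. At a zero of \<open>A j\<close> it gives
  \<open>(t\<^sup>2 - 4) A'(j) = 2 j A(j - 1)\<close>, which is not zero because neighbouring terms do not both vanish.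
\<close>

lemma A_deriv:
  "(t\<^sup>2 - 4) * poly (pderiv (cheb (Suc j))) t + of_nat (Suc j) * (A t (Suc (Suc j)) - A t j) + t * A t (Suc j) = 0"
proof (induction j rule: cheb.induct)
  case 2
  show ?case by (simp add: cheb.simps(3) pderiv_pCons pderiv_mult pderiv_diff pderiv_minus power2_eq_square algebra_simps)
next
  case (3 j)
  define a b where "a = A t (Suc j)" and "b = A t (Suc (Suc j))"
  define a' b' where "a' = poly (pderiv (cheb (Suc j))) t" and "b' = poly (pderiv (cheb (Suc (Suc j)))) t"
  have c: "A t (Suc (Suc (Suc j))) = - t * b - a" and d: "A t (Suc (Suc (Suc (Suc j)))) = - t * (- t * b - a) - b"
    and z: "A t j = - t * a - b"
    by (simp_all add: a_def b_def cheb.simps(3) algebra_simps)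
  have c': "poly (pderiv (cheb (Suc (Suc (Suc j))))) t = - b - t * b' - a'"
    unfolding a'_def b'_def b_def cheb.simps(3)[of "Suc j"]
    by (simp add: pderiv_mult pderiv_diff pderiv_minus pderiv_pCons del: cheb.simps)
  have 1: "(t\<^sup>2 - 4) * a' = - (of_nat (Suc j) * (b - (- t * a - b)) + t * a)"
    using 3(2) unfolding a_def[symmetric] b_def[symmetric] a'_def[symmetric] z by (simp add: algebra_simps)
  have 2: "(t\<^sup>2 - 4) * b' = - (of_nat (Suc (Suc j)) * (- t * b - a - a) + t * b)"
    using 3(1) unfolding a_def[symmetric] b_def[symmetric] b'_def[symmetric] c by (simp add: algebra_simps)
  have "(t\<^sup>2 - 4) * (- b - t * b' - a') + of_nat (Suc (Suc (Suc j))) * (- t * (- t * b - a) - b - b) + t * (- t * b - a) =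
      - (t\<^sup>2 - 4) * b - t * ((t\<^sup>2 - 4) * b') - (t\<^sup>2 - 4) * a'
      + of_nat (Suc (Suc (Suc j))) * (- t * (- t * b - a) - b - b) + t * (- t * b - a)"
    by algebra
  also have "\<dots> = 0"
    unfolding 1 2 of_nat_Suc by algebra
  finally show ?case
    unfolding c d c' b_def[symmetric] .
qed (simp add: cheb.simps(3))

text \<open>
  All zeros are simple: in characteristic zero, the factor \<open>j\<close> in the formula above does not vanish.
\<close>

lemma A_simple:
  assumes "A t j = 0" "0 < j"
  obtains h where "cheb j = [:- t, 1:] * h" "poly h t \<noteq> 0"
proof -
  obtain l where j: "j = Suc l" using assms(2) by (cases j) auto
  obtain h where h: "cheb j = [:- t, 1:] * h" using assms(1) by (auto simp: poly_eq_0_iff_dvd)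
  have "poly h t \<noteq> 0"
  proof
    assume "poly h t = 0"
    then have "poly (pderiv (cheb j)) t = 0"
      unfolding h by (simp only: pderiv_mult poly_add poly_mult) (simp add: pderiv_pCons)
    then have "of_nat (Suc l) * (A t (Suc (Suc l)) - A t l) = 0"
      using A_deriv[where t = t and j = l] assms(1) j by simp
    then have "A t (Suc (Suc l)) = A t l" by (metis eq_iff_diff_eq_0 mult_eq_0_iff of_nat_eq_0_iff nat.distinct(1))
    moreover have "A t (Suc (Suc l)) = - A t l" using assms(1) j by (simp add: cheb.simps(3))
    ultimately have "A t (Suc (Suc l)) = 0" by (simp add: eq_neg_iff_add_eq_0)
    then show False using A_consecutive[of j t] assms(1) j by simp
  qed
  with h that show thesis by blast
qed

section \<open>Radicals and singular vectors\<close>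

abbreviation Rd :: "complex \<Rightarrow> nat \<Rightarrow> nat \<Rightarrow> vec set" where
  "Rd \<delta> k p \<equiv> radical \<delta> (k + 2 * p) p"

lemma Rd_Suc: "x \<in> Rd \<delta> k (Suc p) \<longleftrightarrow> x \<in> V k (Suc p) \<and> (\<forall>i\<le>k + 2 * p. capop \<delta> i x \<in> Rd \<delta> k p)"
  using radical_Suc[of x \<delta> "k + 2 * p" p] by simp

lemma Rd_V: "x \<in> Rd \<delta> k p \<Longrightarrow> x \<in> V k p"
  by (simp add: radical_def)

lemma Rd_iff: "x \<in> Rd \<delta> k p \<longleftrightarrow> x \<in> V k p \<and> (\<forall>y\<in>V k p. form \<delta> (k + 2 * p) x y = 0)"
  by (simp add: radical_def)

lemma radical_zero [simp]: "0 \<in> radical \<delta> n p"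
  by (simp add: radical_def)

lemma radical_add: "x \<in> radical \<delta> n p \<Longrightarrow> y \<in> radical \<delta> n p \<Longrightarrow> x + y \<in> radical \<delta> n p"
  by (auto simp: radical_def form_bilinear standard_add)

lemma radical_diff: "x \<in> radical \<delta> n p \<Longrightarrow> y \<in> radical \<delta> n p \<Longrightarrow> x - y \<in> radical \<delta> n p"
  by (auto simp: radical_def form_diff_left standard_diff)

lemma radical_scale: "x \<in> radical \<delta> n p \<Longrightarrow> scale c x \<in> radical \<delta> n p"
  by (auto simp: radical_def form_bilinear standard_scale)

lemma radical_cup:
  "x \<in> radical \<delta> n p \<Longrightarrow> i \<le> n \<Longrightarrow> cupop i x \<in> radical \<delta> (Suc (Suc n)) (Suc p)"
proof (induction p arbitrary: n i x)
  case 0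
  then show ?case by (simp add: radical_0)
next
  case (Suc p)
  have x: "x \<in> standard n (Suc p)" "invvec x" using Suc.prems standard_invvec by (auto simp: radical_def)
  have "capop \<delta> j (cupop i x) \<in> radical \<delta> n (Suc p)" if "j \<le> n" for j
  proof (cases "x = 0")
    case False
    then have "Poly_Mapping.keys x \<noteq> {}" by simp
    then obtain v where "v \<in> link_states n (Suc p)" using x(1) unfolding standard_def by blast
    then obtain m where m: "n = Suc (Suc m)" by (rule link_states_Suc)
    have *: "capop \<delta> l x \<in> radical \<delta> m p" if "l \<le> m" for l
      using Suc.prems(1) that unfolding m radical_Suc by blast
    show ?thesis
    proof (cases i j rule: near_far_cases)
      case (far_up l)
      then show ?thesis using x Suc.IH[OF *[of j], of l] Suc.prems(2) m by (simp add: cap_cup_far)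
    next
      case (far_down l)
      then show ?thesis using x Suc.IH[OF *[of l], of i] that m by (simp add: cap_far_cup)
    qed (use x Suc.prems(1) in \<open>simp_all add: cap_cup_Suc cap_Suc_cup radical_scale\<close>)
  qed simp
  then show ?case unfolding radical_Suc using standard_cup[OF x(1)] Suc.prems(2) by blast
qed

lemma Rd_cup: "x \<in> Rd \<delta> k p \<Longrightarrow> i \<le> k + 2 * p \<Longrightarrow> cupop i x \<in> Rd \<delta> k (Suc p)"
  using radical_cup[of x \<delta> "k + 2 * p" p i] by simp

lemma V_form_mono: "x \<in> V k p \<Longrightarrow> y \<in> V k p \<Longrightarrow> form \<delta> (Suc k + 2 * p) x y = form \<delta> (k + 2 * p) x y"
  using form_mono by simp

lemma Rd_restrict: "x \<in> Rd \<delta> (Suc k) p \<Longrightarrow> x \<in> V k p \<Longrightarrow> x \<in> Rd \<delta> k p"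
  unfolding Rd_iff using V_form_mono V_mono by metis

text \<open>
  The bound on \<open>i\<close> leaves out \<open>rho\<close>, the cap that involves the point after the last one.
\<close>

definition singular :: "complex \<Rightarrow> nat \<Rightarrow> nat \<Rightarrow> vec \<Rightarrow> bool" where
  "singular \<delta> k p x \<longleftrightarrow> x \<in> V k p \<and> (\<forall>i. Suc i < k + 2 * p \<longrightarrow> capop \<delta> i x = 0)"

lemma singular_Rd: "singular \<delta> k (Suc p) x \<Longrightarrow> x \<in> Rd \<delta> k (Suc p)"
  unfolding Rd_Suc singular_def by auto

lemma singular_rho:
  assumes "singular \<delta> k (Suc p) x" shows "singular \<delta> (Suc k) p (rho k p x)"
  unfolding singular_def
proof (intro conjI allI impI)
  have x: "x \<in> V k (Suc p)" using assms by (simp add: singular_def)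
  then show "rho k p x \<in> V (Suc k) p" by (rule V_rho)
  fix i assume i: "Suc i < Suc k + 2 * p"
  show "capop \<delta> i (rho k p x) = 0"
  proof (cases p)
    case 0
    then show ?thesis using V_rho[OF x] cap_standard_0 by auto
  next
    case (Suc q)
    have "capop \<delta> i (rho k (Suc q) x) = rho k q (capop \<delta> i x)"
      by (rule cap_rho) (use x i Suc in auto)
    moreover have "capop \<delta> i x = 0" using assms i Suc by (simp add: singular_def)
    ultimately show ?thesis using Suc by simp
  qed
qed

text \<open>
  If \<open>rho k p x = 0\<close>, the last point is a string throughout \<open>x\<close>. Then the next cap to the left
  acts on \<open>x\<close> as \<open>rho (k - 1) p\<close>, and it also vanishes; so one string after the other can be removed.
\<close>

lemma singular_rho_0: "singular \<delta> k (Suc p) x \<Longrightarrow> rho k p x = 0 \<Longrightarrow> x = 0"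
proof (induction k)
  case 0
  then have "x \<in> V 0 (Suc p)" by (simp add: singular_def)
  then show ?case using 0(2) by (rule kernel_rho) auto
next
  case (Suc k)
  have "x \<in> V (Suc k) (Suc p)" using Suc.prems by (simp add: singular_def)
  then show ?case using Suc.prems(2)
  proof (rule kernel_rho)
    fix k' assume k': "Suc k = Suc k'" "x \<in> V k' (Suc p)"
    then have x: "x \<in> V k (Suc p)" by simp
    have "singular \<delta> k (Suc p) x" using Suc.prems(1) x by (auto simp: singular_def)
    moreover have "rho k p x = 0"
      using Suc.prems(1) rho_eq[OF x, of \<delta>] by (simp add: singular_def)
    ultimately show "x = 0" by (rule Suc.IH)
  qed
qed

text \<open>
  The coefficient of the state whose \<open>k\<close> strings are followed by \<open>p\<close> nested cups.
\<close>

primrec lead :: "nat \<Rightarrow> nat \<Rightarrow> vec \<Rightarrow> complex" where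
  "lead k 0 x = Poly_Mapping.lookup x (\<lambda>a. a)"
| "lead k (Suc p) x = lead (Suc k) p (rho k p x)"

lemma lead_lin [simp]:
  "lead k p 0 = 0" "lead k p (x + y) = lead k p x + lead k p y" "lead k p (scale c x) = c * lead k p x"
  by (induction p arbitrary: k x y) (simp_all add: lookup_add)

lemma lead_diff [simp]: "lead k p (x - y) = lead k p x - lead k p y"
  by (induction p arbitrary: k x y) (simp_all add: lookup_minus)

lemma lead_sum: "lead k p (\<Sum>a\<in>I. g a) = (\<Sum>a\<in>I. lead k p (g a))"
  by (induction I rule: infinite_finite_induct) simp_all

lemma singular_lead: "singular \<delta> k p x \<Longrightarrow> lead k p x = 0 \<Longrightarrow> x = 0"
proof (induction p arbitrary: k x)
  case 0
  then have "x \<in> standard k 0" by (simp add: singular_def)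
  then show ?case using 0(2) by (auto simp: standard_0_iff)
next
  case (Suc p)
  then show ?case using singular_rho singular_rho_0 by (metis lead.simps(2))
qed

lemma singular_proportional:
  assumes "singular \<delta> k p x" "singular \<delta> k p y" "x \<noteq> 0"
  obtains c where "y = scale c x"
proof -
  define c where "c = lead k p y / lead k p x"
  have "lead k p x \<noteq> 0" using assms singular_lead by blast
  then have "lead k p (y - scale c x) = 0" by (simp add: c_def)
  moreover have "singular \<delta> k p (y - scale c x)"
    using assms by (simp add: singular_def standard_diff standard_scale)
  ultimately have "y - scale c x = 0" using singular_lead by blast
  then show thesis using that[of c] by simp
qed

lemma Rd_singular:
  "x \<in> Rd \<delta> k p \<Longrightarrow> x \<noteq> 0 \<Longrightarrow> \<exists>p'\<le>p. 0 < p' \<and> (\<exists>x'. singular \<delta> k p' x' \<and> x' \<noteq> 0)"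
proof (induction p arbitrary: x)
  case 0
  then show ?case by (simp add: radical_0)
next
  case (Suc p)
  show ?case
  proof (cases "\<exists>i\<le>k + 2 * p. capop \<delta> i x \<noteq> 0")
    case True
    then obtain i where "i \<le> k + 2 * p" "capop \<delta> i x \<noteq> 0" by blast
    moreover have "capop \<delta> i x \<in> Rd \<delta> k p" using Suc.prems(1) calculation(1) unfolding Rd_Suc by blast
    ultimately show ?thesis using Suc.IH by (meson le_Suc_eq)
  next
    case False
    then have "singular \<delta> k (Suc p) x" using Rd_V[OF Suc.prems(1)] by (auto simp: singular_def)
    then show ?thesis using Suc.prems(2) by blast
  qed
qed

section \<open>Lifting from more strings\<close>

text \<open>
  If all caps of \<open>z\<close> vanish, the caps of \<open>\<Sum>\<^sub>i a\<^sub>i u\<^sub>i z\<close> are the multiples \<open>\<delta> a\<^sub>j + a\<^sub>j\<^sub>-\<^sub>1 + a\<^sub>j\<^sub>+\<^sub>1\<close> of \<open>z\<close>. The coefficients here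
  make all of them zero except the last one, where the right neighbour is missing.
\<close>

definition wave :: "complex \<Rightarrow> nat \<Rightarrow> vec \<Rightarrow> vec" where
  "wave \<delta> N z = (\<Sum>i\<le>N. scale (A \<delta> (Suc i)) (cupop i z))"

lemma cap_wave:
  assumes z: "singular \<delta> k p z" and N: "N = k + 2 * p" and j: "j \<le> N"
  shows "capop \<delta> j (wave \<delta> N z) = (if j = N then scale (- A \<delta> (Suc (Suc N))) z else 0)"
proof -
  have inv: "invvec z" using z standard_invvec by (auto simp: singular_def)
  have c: "capop \<delta> j (cupop i z) = scale ((if i = j then \<delta> else 0) + (if i = Suc j then 1 else 0) + (if Suc i = j then 1 else 0)) z"
    if i: "i \<le> N" for i
  proof (cases i j rule: near_far_cases)
    case (far_up l)
    then have "capop \<delta> j z = 0" using z i N by (simp add: singular_def)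
    then show ?thesis using far_up inv by (simp add: cap_cup_far)
  next
    case (far_down l)
    then have "capop \<delta> l z = 0" using z j N by (simp add: singular_def)
    then show ?thesis using far_down inv by (simp add: cap_far_cup)
  qed (use inv in \<open>simp_all add: cap_cup_Suc cap_Suc_cup\<close>)
  have "capop \<delta> j (wave \<delta> N z) = (\<Sum>i\<le>N. scale (A \<delta> (Suc i) * ((if i = j then \<delta> else 0) + (if i = Suc j then 1 else 0) + (if Suc i = j then 1 else 0))) z)"
    unfolding wave_def capop_sum by (rule sum.cong) (simp_all add: c)
  also have "\<dots> = scale (\<Sum>i\<le>N. A \<delta> (Suc i) * ((if i = j then \<delta> else 0) + (if i = Suc j then 1 else 0) + (if Suc i = j then 1 else 0))) z"
    by (simp add: lc.scale_sum_left)
  also have "(\<Sum>i\<le>N. A \<delta> (Suc i) * ((if i = j then \<delta> else 0) + (if i = Suc j then 1 else 0) + (if Suc i = j then 1 else 0)))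
     = (\<Sum>i\<le>N. if i = j then A \<delta> (Suc j) * \<delta> else 0) + (\<Sum>i\<le>N. if i = Suc j then A \<delta> (Suc (Suc j)) else 0)
       + (\<Sum>i\<le>N. if Suc i = j then A \<delta> j else 0)"
    unfolding sum.distrib[symmetric] by (rule sum.cong) auto
  also have "(\<Sum>i\<le>N. if Suc i = j then A \<delta> j else 0) = A \<delta> j"
  proof (cases j)
    case (Suc l)
    then show ?thesis using j by simp
  qed simp
  also have "(\<Sum>i\<le>N. if i = j then A \<delta> (Suc j) * \<delta> else 0) + (\<Sum>i\<le>N. if i = Suc j then A \<delta> (Suc (Suc j)) else 0) + A \<delta> j
      = (if j = N then - A \<delta> (Suc (Suc N)) else 0)"
    using j by (auto simp: algebra_simps cheb.simps(3))
  finally show ?thesis by simp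
qed

definition ispoly :: "(complex \<Rightarrow> complex) \<Rightarrow> bool" where
  "ispoly f \<longleftrightarrow> (\<exists>p. \<forall>t. f t = poly p t)"

lemma ispoly_poly [simp, intro]: "ispoly (poly p)" "ispoly (\<lambda>t. poly p t)"
  by (auto simp: ispoly_def)

lemma ispoly_const [simp, intro]: "ispoly (\<lambda>t. c)"
  unfolding ispoly_def by (rule exI[of _ "[:c:]"]) simp

lemma ispoly_ident [simp, intro]: "ispoly (\<lambda>t. t)"
  unfolding ispoly_def by (rule exI[of _ "[:0, 1:]"]) simp

lemma ispoly_add [intro]: "ispoly f \<Longrightarrow> ispoly g \<Longrightarrow> ispoly (\<lambda>t. f t + g t)"
  unfolding ispoly_def by (metis poly_add)

lemma ispoly_mult [intro]: "ispoly f \<Longrightarrow> ispoly g \<Longrightarrow> ispoly (\<lambda>t. f t * g t)"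
  unfolding ispoly_def by (metis poly_mult)

lemma ispoly_power [intro]: "ispoly f \<Longrightarrow> ispoly (\<lambda>t. f t ^ n)"
  unfolding ispoly_def by (metis poly_power)

lemma ispoly_sum [intro]: "(\<And>i. i \<in> I \<Longrightarrow> ispoly (f i)) \<Longrightarrow> ispoly (\<lambda>t. \<Sum>i\<in>I. f i t)"
  by (induction I rule: infinite_finite_induct) auto

lemma ispoly_eq:
  assumes "ispoly f" "ispoly g" "\<And>t. t \<noteq> a \<Longrightarrow> f t = g t"
  shows "f t = g t"
proof -
  obtain p q where pq: "\<And>t. f t = poly p t" "\<And>t. g t = poly q t" using assms(1,2) by (auto simp: ispoly_def)
  have "p - q = 0"
  proof (rule ccontr)
    assume "p - q \<noteq> 0"
    then have "finite {t. poly (p - q) t = 0}" by (rule poly_roots_finite)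
    moreover have "- {a} \<subseteq> {t. poly (p - q) t = 0}" using assms(3) pq by auto
    ultimately have "finite (- {a})" by (rule finite_subset[rotated])
    then show False by (simp add: infinite_UNIV_char_0 finite_compl)
  qed
  then show ?thesis using pq by simp
qed

definition polyvec :: "(complex \<Rightarrow> vec) \<Rightarrow> bool" where
  "polyvec F \<longleftrightarrow> (\<forall>v. ispoly (\<lambda>t. Poly_Mapping.lookup (F t) v))"

lemma finite_link_states: "finite (link_states n p)"
proof (induction p arbitrary: n)
  case (Suc p)
  have "link_states n (Suc p) \<subseteq> (\<lambda>(i, u). cup i u) ` ({..n} \<times> link_states (n - 2) p)"
  proof
    fix v assume "v \<in> link_states n (Suc p)"
    then obtain m i u where "n = Suc (Suc m)" "i \<le> m" "u \<in> link_states m p" "v = cup i u"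
      by (rule link_states_Suc)
    then show "v \<in> (\<lambda>(i, u). cup i u) ` ({..n} \<times> link_states (n - 2) p)"
      by (intro image_eqI[of _ _ "(i, u)"]) auto
  qed
  then show ?case using Suc by (meson finite_SigmaI finite_atMost finite_imageI finite_subset)
qed (simp add: link_states_0)

lemma lin_ext_standard:
  "x \<in> standard n p \<Longrightarrow> lin_ext f x = (\<Sum>u\<in>link_states n p. scale (Poly_Mapping.lookup x u) (f u))"
  by (rule lin_ext_superset) (auto simp: finite_link_states standard_def)

lemma polyvec_lin_ext:
  assumes "polyvec F" "\<And>t. F t \<in> standard n p" "\<And>u. u \<in> link_states n p \<Longrightarrow> polyvec (G u)"
  shows "polyvec (\<lambda>t. lin_ext (\<lambda>u. G u t) (F t))"
  unfolding polyvec_def lin_ext_standard[OF assms(2)] lookup_sum lookup_scale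
  using assms(1,3) by (intro allI ispoly_sum ispoly_mult) (simp_all add: polyvec_def)

lemma polyvec_const [simp]: "polyvec (\<lambda>t. x)"
  by (simp add: polyvec_def)

lemma polyvec_scale: "ispoly f \<Longrightarrow> polyvec F \<Longrightarrow> polyvec (\<lambda>t. scale (f t) (F t))"
  by (auto simp: polyvec_def)

lemma polyvec_sum: "(\<And>i. i \<in> I \<Longrightarrow> polyvec (F i)) \<Longrightarrow> polyvec (\<lambda>t. \<Sum>i\<in>I. F i t)"
  unfolding polyvec_def lookup_sum by (intro allI ispoly_sum) simp

lemma polyvec_cup: "polyvec F \<Longrightarrow> (\<And>t. F t \<in> standard n p) \<Longrightarrow> polyvec (\<lambda>t. cupop i (F t))"
  unfolding cupop_def by (rule polyvec_lin_ext) auto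

text \<open>
  \<open>Y\<close> lifts \<open>X\<close> along \<open>rho\<close>, up to a factor, and represents a multiple of \<open>v \<mapsto> \<langle>X, rho v\<rangle>\<close>. Normalising \<open>rho Y\<close> to
  \<open>X\<close> would need \<open>A (k + 1) \<noteq> 0\<close>; without it lifts exist for all loop values and depend polynomially on them.
\<close>

definition lifts :: "nat \<Rightarrow> nat \<Rightarrow> (complex \<Rightarrow> vec) \<Rightarrow> (complex \<Rightarrow> vec) \<Rightarrow> bool" where
  "lifts k p X Y \<longleftrightarrow> polyvec Y \<and> (\<forall>t. Y t \<in> V k (Suc p) \<and> rho k p (Y t) = scale (A t (Suc k)) (X t) \<and>
    (\<forall>y\<in>V k (Suc p). form t (k + 2 * Suc p) (Y t) y = - A t (Suc (Suc k)) * form t (Suc k + 2 * p) (X t) (rho k p y)))"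

text \<open>
  Lifts of \<open>x\<close> give lifts of \<open>u\<^sub>i x\<close>, because \<open>rho\<close> commutes with \<open>u\<^sub>i\<close> and with its adjoint \<open>c\<^sub>i\<close>.
\<close>

lemma lift_cup:
  assumes F: "lifts k p (\<lambda>t. x) F" and x: "x \<in> V (Suc k) p" and i: "i \<le> Suc k + 2 * p"
  shows "lifts k (Suc p) (\<lambda>t. cupop i x) (\<lambda>t. cupop i (F t))"
proof -
  have Ft: "F t \<in> V k (Suc p)" "rho k p (F t) = scale (A t (Suc k)) x"
    "\<And>y. y \<in> V k (Suc p) \<Longrightarrow> form t (k + 2 * Suc p) (F t) y = - A t (Suc (Suc k)) * form t (Suc k + 2 * p) x (rho k p y)" for t
    using F by (auto simp: lifts_def)
  have V: "cupop i (F t) \<in> V k (Suc (Suc p))" for t using V_cup[OF Ft(1)] i by simp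
  have Vx: "cupop i x \<in> V (Suc k) (Suc p)" using V_cup[OF x] i by simp
  have "rho k (Suc p) (cupop i (F t)) = scale (A t (Suc k)) (cupop i x)" for t
    using rho_cup[OF Ft(1), of i t] i Ft(2) by simp
  moreover have "form t (k + 2 * Suc (Suc p)) (cupop i (F t)) y =
      - A t (Suc (Suc k)) * form t (Suc k + 2 * Suc p) (cupop i x) (rho k (Suc p) y)"
    if y: "y \<in> V k (Suc (Suc p))" for t y
  proof -
    have i': "i \<le> k + 2 * Suc p" "i \<le> Suc (k + 2 * p)" using i by simp_all
    have cy: "capop t i y \<in> V k (Suc p)" using V_cap[OF y i'(1)] .
    have "form t (k + 2 * Suc (Suc p)) (cupop i (F t)) y = form t (k + 2 * Suc (Suc p)) y (cupop i (F t))"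
      by (rule form_sym[OF V y])
    also have "\<dots> = form t (k + 2 * Suc p) (capop t i y) (F t)"
      by (rule V_form_cup[OF y Ft(1) i'(1)])
    also have "\<dots> = form t (k + 2 * Suc p) (F t) (capop t i y)"
      by (rule form_sym[OF cy Ft(1)])
    also have "\<dots> = - A t (Suc (Suc k)) * form t (Suc k + 2 * p) x (capop t i (rho k (Suc p) y))"
      using Ft(3)[OF cy] cap_rho[OF y i'(2)] by simp
    also have "form t (Suc k + 2 * p) x (capop t i (rho k (Suc p) y)) = form t (Suc k + 2 * p) (capop t i (rho k (Suc p) y)) x"
      by (rule form_sym[OF x V_cap[OF V_rho[OF y] i]])
    also have "\<dots> = form t (Suc k + 2 * Suc p) (rho k (Suc p) y) (cupop i x)"
      by (rule V_form_cup[OF V_rho[OF y] x i, symmetric])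
    also have "\<dots> = form t (Suc k + 2 * Suc p) (cupop i x) (rho k (Suc p) y)"
      by (rule form_sym[OF V_rho[OF y] Vx])
    finally show ?thesis .
  qed
  moreover have "polyvec (\<lambda>t. cupop i (F t))"
    using F Ft(1) by (intro polyvec_cup) (auto simp: lifts_def)
  ultimately show ?thesis using V by (simp add: lifts_def)
qed

text \<open>
  For a state without cups the lift is the combination of all states with a single cup whose caps vanish,
  except those at the last two places.
\<close>

lemma lift_id: "lifts k 0 (\<lambda>t. basis (\<lambda>a. a)) (\<lambda>t. wave t k (basis (\<lambda>a. a)))"
proof -
  let ?o = "basis (\<lambda>a. a)"
  have o: "?o \<in> V j 0" for j by (simp add: link_states_0)
  have so: "singular t k 0 ?o" for t using o[of k] by (simp add: singular_def)
  have V: "wave t k ?o \<in> V k (Suc 0)" for t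
    unfolding wave_def using V_cup[OF o[of k]] by (intro standard_sum standard_scale) simp
  have rc: "rho k 0 (cupop i ?o) = (if i = k then ?o else 0)" if i: "i \<le> k" for i
  proof (cases "i = k")
    case True
    then show ?thesis using rho_cup_last[OF o[of k]] by simp
  next
    case False
    then obtain l where "k = Suc l" "i \<le> l" using i by (cases k) auto
    then show ?thesis
      using cap_far_cup[OF invvec_basis[OF invol_id], of i l 0] False unfolding rho_def by simp
  qed
  have rw: "rho k 0 (wave t k ?o) = scale (A t (Suc k)) ?o" for t
  proof -
    have "rho k 0 (wave t k ?o) = (\<Sum>i\<le>k. if i = k then scale (A t (Suc k)) ?o else 0)"
      unfolding wave_def rho_sum rho_lin by (rule sum.cong) (use rc in auto)
    then show ?thesis by simp
  qed
  have "form t (k + 2 * Suc 0) (wave t k ?o) y = - A t (Suc (Suc k)) * form t (Suc k + 2 * 0) ?o (rho k 0 y)"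
    if "y \<in> V k (Suc 0)" for t y
    using that
  proof (induction y rule: V_Suc_induct)
    case (cup i y)
    then obtain c where c: "y = scale c ?o" by (auto simp: standard_0_iff)
    have "form t (k + 2 * Suc 0) (wave t k ?o) (cupop i y) = form t k (capop t i (wave t k ?o)) y"
      using V_form_cup[OF V cup(2,1)] by simp
    also have "\<dots> = (if i = k then - A t (Suc (Suc k)) * c else 0)"
      using cap_wave[OF so, of k i] cup(1) c
      by (simp add: form_bilinear state_form_id del: lc.scale_minus_left)
    also have "\<dots> = - A t (Suc (Suc k)) * form t (Suc k) ?o (rho k 0 (cupop i y))"
      using rc[of i] cup(1) c by (simp add: form_bilinear state_form_id)
    finally show ?case by simp
  qed (simp_all add: form_bilinear algebra_simps)
  moreover have "polyvec (\<lambda>t. wave t k ?o)"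
    unfolding wave_def by (intro polyvec_sum polyvec_scale) auto
  ultimately show ?thesis using V rw by (simp add: lifts_def)
qed

lemma lift_state: "u \<in> link_states (Suc k + 2 * p) p \<Longrightarrow> \<exists>F. lifts k p (\<lambda>t. basis u) F"
proof (induction p arbitrary: u)
  case 0
  then show ?case using lift_id by (auto simp: link_states_0)
next
  case (Suc p)
  then obtain n i v where n: "Suc k + 2 * Suc p = Suc (Suc n)" "i \<le> n" "v \<in> link_states n p" "u = cup i v"
    by (elim link_states_Suc)
  then have "n = Suc k + 2 * p" by simp
  then show ?case using Suc.IH[of v] lift_cup[of k p "basis v" _ i] n by fastforce
qed

lemma lift_family:
  assumes X: "polyvec X" "\<And>t. X t \<in> V (Suc k) p"
  obtains Y where "lifts k p X Y"
proof -
  have "\<forall>u\<in>link_states (Suc k + 2 * p) p. \<exists>F. lifts k p (\<lambda>t. basis u) F" using lift_state by blast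
  then obtain F where F: "\<And>u. u \<in> link_states (Suc k + 2 * p) p \<Longrightarrow> lifts k p (\<lambda>t. basis u) (F u)"
    by metis
  define Y where "Y t = lin_ext (\<lambda>u. F u t) (X t)" for t
  have sub: "Poly_Mapping.keys (X t) \<subseteq> link_states (Suc k + 2 * p) p" for t
    using X(2)[of t] by (simp add: standard_def)
  have "polyvec Y"
    unfolding Y_def by (rule polyvec_lin_ext[OF X]) (use F in \<open>auto simp: lifts_def\<close>)
  moreover have "Y t \<in> V k (Suc p)" for t
    unfolding Y_def lin_ext_def using F sub by (intro standard_sum standard_scale) (auto simp: lifts_def)
  moreover have "rho k p (Y t) = scale (A t (Suc k)) (X t)" for t
  proof -
    have "rho k p (Y t) = (\<Sum>u\<in>Poly_Mapping.keys (X t). scale (Poly_Mapping.lookup (X t) u) (rho k p (F u t)))"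
      by (simp add: Y_def lin_ext_def rho_sum)
    also have "\<dots> = (\<Sum>u\<in>Poly_Mapping.keys (X t). scale (A t (Suc k)) (scale (Poly_Mapping.lookup (X t) u) (basis u)))"
    proof (rule sum.cong)
      fix u assume "u \<in> Poly_Mapping.keys (X t)"
      then have "rho k p (F u t) = scale (A t (Suc k)) (basis u)" using F sub by (auto simp: lifts_def)
      then show "scale (Poly_Mapping.lookup (X t) u) (rho k p (F u t)) = scale (A t (Suc k)) (scale (Poly_Mapping.lookup (X t) u) (basis u))"
        by (simp add: mult.commute)
    qed simp
    also have "\<dots> = scale (A t (Suc k)) (X t)"
      by (simp only: lc.scale_sum_right[symmetric] vec_expand[symmetric])
    finally show ?thesis .
  qed
  moreover have "form t (k + 2 * Suc p) (Y t) y = - A t (Suc (Suc k)) * form t (Suc k + 2 * p) (X t) (rho k p y)"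
    if y: "y \<in> V k (Suc p)" for t y
  proof -
    have "form t (k + 2 * Suc p) (Y t) y = (\<Sum>u\<in>Poly_Mapping.keys (X t). Poly_Mapping.lookup (X t) u * (- A t (Suc (Suc k)) * form t (Suc k + 2 * p) (basis u) (rho k p y)))"
      unfolding Y_def form_lin_ext_left
    proof (rule sum.cong)
      fix u assume "u \<in> Poly_Mapping.keys (X t)"
      then have "lifts k p (\<lambda>t. basis u) (F u)" using F sub by blast
      then have "form t (k + 2 * Suc p) (F u t) y = - A t (Suc (Suc k)) * form t (Suc k + 2 * p) (basis u) (rho k p y)"
        using y unfolding lifts_def by blast
      then show "Poly_Mapping.lookup (X t) u * form t (k + 2 * Suc p) (F u t) y = Poly_Mapping.lookup (X t) u * (- A t (Suc (Suc k)) * form t (Suc k + 2 * p) (basis u) (rho k p y))"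
        by simp
    qed simp
    also have "\<dots> = - A t (Suc (Suc k)) * form t (Suc k + 2 * p) (lin_ext (\<lambda>u. basis u) (X t)) (rho k p y)"
      unfolding form_lin_ext_left sum_distrib_left by (simp add: mult_ac)
    finally show ?thesis by simp
  qed
  ultimately have "lifts k p X Y" unfolding lifts_def by blast
  then show thesis by (rule that)
qed

section \<open>Critical numbers of strings\<close>

text \<open>
  Lifting the state without cups \<open>r\<close> times gives a vector that represents a multiple of the functional \<open>lead\<close>.
  Its own leading coefficient is the product of \<open>A (k + 1), \<dots>, A (k + r)\<close>, and the pairing with \<open>v\<close> has
  the factor \<open>\<plusminus> A (k + 2) \<cdots> A (k + r + 1)\<close>; this explains the two coefficients that remain.
\<close>

lemma iterated_lift:
  "\<exists>X. polyvec X \<and> (\<forall>t. X t \<in> V k r) \<and> lead k r (X (-2)) \<noteq> 0 \<and>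
    (\<forall>t. \<forall>y\<in>V k r. A t (Suc k) * form t (k + 2 * r) (X t) y =
       (-1) ^ r * A t (Suc (k + r)) * lead k r (X t) * lead k r y)"
proof (induction r arbitrary: k)
  case 0
  have "basis (\<lambda>a. a) \<in> V k 0" by (simp add: link_states_0)
  moreover have "form t (k + 2 * 0) (basis (\<lambda>a. a)) y = lead k 0 y" if "y \<in> V k 0" for t y
    using that by (auto simp: standard_0_iff form_bilinear state_form_id)
  ultimately show ?case
    by (intro exI[of _ "\<lambda>t. basis (\<lambda>a. a)"]) simp
next
  case (Suc r)
  obtain X where X: "polyvec X" "\<And>t. X t \<in> V (Suc k) r" "lead (Suc k) r (X (-2)) \<noteq> 0"
    and form_X: "\<And>t y. y \<in> V (Suc k) r \<Longrightarrow> A t (Suc (Suc k)) * form t (Suc k + 2 * r) (X t) y =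
       (-1) ^ r * A t (Suc (Suc k + r)) * lead (Suc k) r (X t) * lead (Suc k) r y"
    using Suc.IH[of "Suc k"] by blast
  obtain Y where Y: "lifts k r X Y" using lift_family[OF X(1,2)] .
  have lead_Y: "lead k (Suc r) (Y t) = A t (Suc k) * lead (Suc k) r (X t)" for t
    using Y by (simp add: lifts_def)
  have "A t (Suc k) * form t (k + 2 * Suc r) (Y t) y =
      (-1) ^ Suc r * A t (Suc (k + Suc r)) * lead k (Suc r) (Y t) * lead k (Suc r) y"
    if y: "y \<in> V k (Suc r)" for t y
  proof -
    have "form t (k + 2 * Suc r) (Y t) y = - (A t (Suc (Suc k)) * form t (Suc k + 2 * r) (X t) (rho k r y))"
      using Y y unfolding lifts_def by simp
    also have "\<dots> = - ((-1) ^ r * A t (Suc (Suc k + r)) * lead (Suc k) r (X t) * lead (Suc k) r (rho k r y))"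
      using form_X[OF V_rho[OF y]] by simp
    finally show ?thesis unfolding lead_Y by simp
  qed
  moreover have "lead k (Suc r) (Y (-2)) \<noteq> 0"
    unfolding lead_Y A_minus_two using X(3) by (simp del: of_nat_Suc)
  moreover have "polyvec Y" "\<forall>t. Y t \<in> V k (Suc r)"
    using Y by (simp_all add: lifts_def)
  ultimately show ?case by blast
qed

text \<open>
  Division by the highest power of \<open>X - a\<close> that divides all members of the family.
\<close>

lemma divide_common_zero:
  fixes f :: "'a \<Rightarrow> complex poly"
  assumes "finite S" "\<exists>v\<in>S. f v \<noteq> 0"
  obtains N g where "\<And>v. v \<in> S \<Longrightarrow> f v = [:- a, 1:] ^ N * g v" "\<exists>v\<in>S. poly (g v) a \<noteq> 0"
proof -
  define T where "T = {v \<in> S. f v \<noteq> 0}"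
  have T: "finite T" "T \<noteq> {}" using assms by (auto simp: T_def)
  obtain v0 where v0: "v0 \<in> T" "\<And>v. v \<in> T \<Longrightarrow> order a (f v0) \<le> order a (f v)"
    using arg_min_if_finite[OF T, of "\<lambda>v. order a (f v)"] by (metis not_le)
  define N where "N = order a (f v0)"
  have "\<exists>h. f v = [:- a, 1:] ^ N * h" if "v \<in> S" for v
  proof (cases "f v = 0")
    case False
    then have "N \<le> order a (f v)" using v0(2) that by (simp add: T_def N_def)
    then have "[:- a, 1:] ^ N dvd f v" using order_1 power_le_dvd by blast
    then show ?thesis by (simp add: dvd_def)
  qed (auto intro: exI[of _ 0])
  then obtain g where g: "\<And>v. v \<in> S \<Longrightarrow> f v = [:- a, 1:] ^ N * g v" by metis
  have "v0 \<in> S" "f v0 \<noteq> 0" using v0(1) by (auto simp: T_def)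
  have "poly (g v0) a \<noteq> 0"
  proof
    assume "poly (g v0) a = 0"
    then have "[:- a, 1:] dvd g v0" by (simp add: poly_eq_0_iff_dvd)
    then have "[:- a, 1:] ^ Suc N dvd f v0"
      unfolding g[OF \<open>v0 \<in> S\<close>] power_Suc2 by (rule mult_dvd_mono[OF dvd_refl])
    then show False using order_2[OF \<open>f v0 \<noteq> 0\<close>, of a] by (simp add: N_def)
  qed
  then show thesis using that g \<open>v0 \<in> S\<close> by blast
qed

lemma polyvec_divide:
  assumes "polyvec X" "\<And>t. X t \<in> standard n p" "X s \<noteq> 0"
  obtains N X' where "polyvec X'" "\<And>t. X' t \<in> standard n p" "\<And>t. X t = scale ((t - a) ^ N) (X' t)" "X' a \<noteq> 0"
proof -
  let ?S = "link_states n p"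
  obtain f where f: "\<And>v t. Poly_Mapping.lookup (X t) v = poly (f v) t"
    using assms(1) unfolding polyvec_def ispoly_def by metis
  have "\<exists>v\<in>?S. f v \<noteq> 0"
  proof -
    have "Poly_Mapping.keys (X s) \<noteq> {}" using assms(3) by simp
    then obtain v where v: "v \<in> Poly_Mapping.keys (X s)" by blast
    then have "v \<in> ?S" "f v \<noteq> 0" using assms(2)[of s] f[of s v] by (auto simp: standard_def in_keys_iff)
    then show ?thesis by blast
  qed
  then obtain N g where g: "\<And>v. v \<in> ?S \<Longrightarrow> f v = [:- a, 1:] ^ N * g v" "\<exists>v\<in>?S. poly (g v) a \<noteq> 0"
    using divide_common_zero[OF finite_link_states] by metis
  define X' where "X' t = (\<Sum>v\<in>?S. scale (poly (g v) t) (basis v))" for t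
  have lk: "Poly_Mapping.lookup (X' t) u = (if u \<in> ?S then poly (g u) t else 0)" for t u
  proof -
    have "Poly_Mapping.lookup (X' t) u = (\<Sum>v\<in>?S. if v = u then poly (g v) t else 0)"
      unfolding X'_def lookup_sum by (rule sum.cong) (auto simp: lookup_single when_def)
    then show ?thesis by (simp add: finite_link_states)
  qed
  have "ispoly (\<lambda>t. Poly_Mapping.lookup (X' t) v)" for v unfolding lk by (cases "v \<in> ?S") simp_all
  then have "polyvec X'" by (simp add: polyvec_def)
  moreover have "X' t \<in> standard n p" for t
    by (auto simp: standard_def in_keys_iff lk split: if_splits)
  moreover have "X t = scale ((t - a) ^ N) (X' t)" for t
  proof (rule poly_mapping_eqI)
    fix u
    have "Poly_Mapping.lookup (X t) u = 0" if "u \<notin> ?S"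
      using assms(2)[of t] that by (auto simp: standard_def in_keys_iff)
    then show "Poly_Mapping.lookup (X t) u = Poly_Mapping.lookup (scale ((t - a) ^ N) (X' t)) u"
      using g(1)[of u] by (auto simp: lk f poly_power algebra_simps)
  qed
  moreover have "X' a \<noteq> 0"
  proof
    assume "X' a = 0"
    then have "Poly_Mapping.lookup (X' a) v = 0" for v by simp
    then show False using g(2) lk by metis
  qed
  ultimately show thesis by (rule that)
qed

lemma ispoly_state_form: "ispoly (\<lambda>t. state_form t n u v)"
proof -
  define c where "c \<longleftrightarrow> (\<forall>i<n. u i = i \<longrightarrow> (\<exists>j<n. v j = j \<and> (i, j) \<in> glue u v))"
  have "state_form t n u v = (if c then t ^ card (loops n u v) else 0)" for t
    unfolding state_form_def c_def ..
  then show ?thesis by (cases c) (auto intro!: ispoly_power)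
qed

lemma ispoly_form:
  assumes "polyvec X" "\<And>t. X t \<in> standard n p"
  shows "ispoly (\<lambda>t. form t m (X t) y)"
proof -
  have "form t m (X t) y = (\<Sum>u\<in>link_states n p. \<Sum>v\<in>Poly_Mapping.keys y.
      Poly_Mapping.lookup (X t) u * Poly_Mapping.lookup y v * state_form t m u v)" for t
    by (rule form_superset) (use assms(2) finite_link_states in \<open>auto simp: standard_def\<close>)
  then show ?thesis
    using assms(1) by (auto simp only: polyvec_def intro!: ispoly_sum ispoly_mult ispoly_state_form ispoly_const)
qed

lemma ispoly_lead:
  assumes "polyvec X" "\<And>t. X t \<in> standard n p"
  shows "ispoly (\<lambda>t. lead k r (X t))"
proof -
  have "lead k r (X t) = lead k r (lin_ext basis (X t))" for t by simp
  also have "lead k r (lin_ext basis (X t)) = (\<Sum>u\<in>link_states n p. Poly_Mapping.lookup (X t) u * lead k r (basis u))" for t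
    unfolding lin_ext_standard[OF assms(2)] by (simp add: lead_sum)
  finally show ?thesis
    using assms(1) by (auto simp only: polyvec_def intro!: ispoly_sum ispoly_mult ispoly_const)
qed

text \<open>
  If \<open>A (k + 1)\<close> and \<open>A (k + 1 + r)\<close> vanish for the same \<open>\<delta>\<close>, the identity of \<open>iterated_lift\<close> says
  nothing at \<open>\<delta>\<close> itself. But the zeros are simple, so \<open>t - \<delta>\<close> cancels and nonzero factors remain. After a
  common power of \<open>t - \<delta>\<close> has been removed from the family as well, its value \<open>x\<close> at \<open>\<delta>\<close> is a nonzero vector with
  \<open>\<langle>x, v\<rangle> = c (lead x) (lead v)\<close> and \<open>c \<noteq> 0\<close>. A singular vector is orthogonal to \<open>x\<close>, so its leading coefficient
  is zero and it vanishes, provided that \<open>lead x \<noteq> 0\<close>. Otherwise \<open>x\<close> would be in the radical, hence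
  singular, as the radical one degree lower is zero, and with leading coefficient zero.
\<close>

lemma no_critical_singular:
  assumes k: "A \<delta> (Suc k) = 0" and kr: "A \<delta> (Suc (k + Suc r)) = 0" and R: "Rd \<delta> k r = {0}"
    and y: "singular \<delta> k (Suc r) y"
  shows "y = 0"
proof -
  obtain \<alpha> where \<alpha>: "cheb (Suc k) = [:- \<delta>, 1:] * \<alpha>" "poly \<alpha> \<delta> \<noteq> 0" using A_simple[OF k] by blast
  obtain \<beta> where \<beta>: "cheb (Suc (k + Suc r)) = [:- \<delta>, 1:] * \<beta>" "poly \<beta> \<delta> \<noteq> 0" using A_simple[OF kr] by blast
  let ?V = "V k (Suc r)" and ?n = "k + 2 * Suc r" and ?l = "lead k (Suc r)"
  obtain X where X: "polyvec X" "\<And>t. X t \<in> ?V" "?l (X (-2)) \<noteq> 0"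
    and form_X: "\<And>t y. y \<in> ?V \<Longrightarrow> A t (Suc k) * form t ?n (X t) y = (-1) ^ Suc r * A t (Suc (k + Suc r)) * ?l (X t) * ?l y"
    using iterated_lift[of k "Suc r"] by blast
  have "X (-2) \<noteq> 0" using X(3) by auto
  then obtain N X' where X': "polyvec X'" "\<And>t. X' t \<in> ?V" "\<And>t. X t = scale ((t - \<delta>) ^ N) (X' t)" "X' \<delta> \<noteq> 0"
    using polyvec_divide[OF X(1,2), where a = \<delta>] by metis
  have form_X': "poly \<alpha> \<delta> * form \<delta> ?n (X' \<delta>) v = (-1) ^ Suc r * poly \<beta> \<delta> * ?l (X' \<delta>) * ?l v" if v: "v \<in> ?V" for v
  proof (rule ispoly_eq[where a = \<delta> and t = \<delta> and f = "\<lambda>t. poly \<alpha> t * form t ?n (X' t) v"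
        and g = "\<lambda>t. (-1) ^ Suc r * poly \<beta> t * ?l (X' t) * ?l v"])
    fix t assume t: "t \<noteq> \<delta>"
    have "(t - \<delta>) ^ Suc N * (poly \<alpha> t * form t ?n (X' t) v) = (t - \<delta>) ^ Suc N * ((-1) ^ Suc r * poly \<beta> t * ?l (X' t) * ?l v)"
      using form_X[OF v, of t] unfolding \<alpha>(1) \<beta>(1) X'(3) by (simp add: form_bilinear algebra_simps)
    moreover have "(t - \<delta>) ^ Suc N \<noteq> 0" using t by simp
    ultimately show "poly \<alpha> t * form t ?n (X' t) v = (-1) ^ Suc r * poly \<beta> t * ?l (X' t) * ?l v"
      by (rule mult_left_cancel[THEN iffD1, rotated])
  qed (intro ispoly_mult ispoly_form[OF X'(1,2)] ispoly_lead[OF X'(1,2)] ispoly_const ispoly_poly(2))+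
  have lead: "?l (X' \<delta>) \<noteq> 0"
  proof
    assume l: "?l (X' \<delta>) = 0"
    then have "X' \<delta> \<in> Rd \<delta> k (Suc r)"
      unfolding Rd_iff using form_X' \<alpha>(2) X'(2) by simp
    then have "\<forall>i\<le>k + 2 * r. capop \<delta> i (X' \<delta>) = 0" unfolding Rd_Suc R by simp
    then have "singular \<delta> k (Suc r) (X' \<delta>)" using X'(2) by (simp add: singular_def)
    then show False using singular_lead l X'(4) by blast
  qed
  have yV: "y \<in> ?V" using y by (simp add: singular_def)
  have "form \<delta> ?n y (X' \<delta>) = 0" using singular_Rd[OF y] X'(2) unfolding Rd_iff by blast
  then have "form \<delta> ?n (X' \<delta>) y = 0" using form_sym[OF yV X'(2)] by simp
  then have "?l y = 0" using form_X'[OF yV] \<beta>(2) lead by simp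
  then show ?thesis using singular_lead[OF y] by blast
qed

lemma lift_vector:
  assumes "u \<in> V (Suc k) p"
  obtains y where "y \<in> V k (Suc p)" "rho k p y = scale (A \<delta> (Suc k)) u"
    "\<And>v. v \<in> V k (Suc p) \<Longrightarrow> form \<delta> (k + 2 * Suc p) y v = - A \<delta> (Suc (Suc k)) * form \<delta> (Suc k + 2 * p) u (rho k p v)"
proof -
  obtain Y where "lifts k p (\<lambda>t. u) Y" using lift_family[of "\<lambda>t. u" k p] assms by auto
  then show thesis using that[of "Y \<delta>"] unfolding lifts_def by blast
qed

text \<open>
  The functionals \<open>v \<mapsto> \<langle>u, rho v\<rangle>\<close> are represented by vectors, which are orthogonal to the radical.
\<close>

lemma rho_Rd:
  assumes x: "x \<in> Rd \<delta> k (Suc p)" and A: "A \<delta> (Suc (Suc k)) \<noteq> 0"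
  shows "rho k p x \<in> Rd \<delta> (Suc k) p"
proof -
  have xV: "x \<in> V k (Suc p)" using x by (rule Rd_V)
  have "form \<delta> (Suc k + 2 * p) (rho k p x) u = 0" if u: "u \<in> V (Suc k) p" for u
  proof -
    obtain y where y: "y \<in> V k (Suc p)"
      "form \<delta> (k + 2 * Suc p) y x = - A \<delta> (Suc (Suc k)) * form \<delta> (Suc k + 2 * p) u (rho k p x)"
      using lift_vector[OF u] xV by metis
    have "form \<delta> (k + 2 * Suc p) x y = 0" using x y(1) unfolding Rd_iff by blast
    then have "form \<delta> (Suc k + 2 * p) u (rho k p x) = 0"
      using form_sym[OF xV y(1)] y(2) A by simp
    then show ?thesis using form_sym[OF u V_rho[OF xV]] by simp
  qed
  then show ?thesis unfolding Rd_iff using V_rho[OF xV] by blast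
qed

text \<open>
  Applying \<open>rho\<close> repeatedly gives singular vectors with one more string and one cup less each time. With one cup
  left, \<open>A (k + 1 + p) = 0\<close> follows from \<open>rho_Rd\<close>; the induction hypothesis covers the terms in
  between, and \<open>no_critical_singular\<close> covers \<open>A (k + 1)\<close>.
\<close>

lemma singular_A:
  "singular \<delta> k p x \<Longrightarrow> x \<noteq> 0 \<Longrightarrow> 0 < p \<Longrightarrow>
    A \<delta> (Suc (k + p)) = 0 \<and> (\<forall>j<p. A \<delta> (Suc (k + j)) \<noteq> 0)"
proof (induction p arbitrary: k x rule: less_induct)
  case (less p)
  then obtain r where p: "p = Suc r" by (cases p) auto
  let ?x = "rho k r x"
  have s: "singular \<delta> (Suc k) r ?x" and n: "?x \<noteq> 0"
    using less.prems(1,2) singular_rho singular_rho_0 unfolding p by blast+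
  have later: "A \<delta> (Suc (k + p)) = 0 \<and> (\<forall>j. 0 < j \<and> j < p \<longrightarrow> A \<delta> (Suc (k + j)) \<noteq> 0)"
  proof (cases r)
    case 0
    have "A \<delta> (Suc (Suc k)) = 0"
    proof (rule ccontr)
      assume "A \<delta> (Suc (Suc k)) \<noteq> 0"
      then have "?x \<in> Rd \<delta> (Suc k) 0"
        using rho_Rd[OF singular_Rd] less.prems(1) p 0 by blast
      then show False using n radical_0 by auto
    qed
    then show ?thesis using p 0 by simp
  next
    case (Suc r')
    then have IH: "A \<delta> (Suc (Suc k + r)) = 0" "\<forall>j<r. A \<delta> (Suc (Suc k + j)) \<noteq> 0"
      using less.IH[OF _ s n] p by auto
    have "A \<delta> (Suc (k + j)) \<noteq> 0" if "0 < j" "j < p" for j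
      using IH(2)[rule_format, of "j - 1"] that p by simp
    then show ?thesis using IH(1) p by simp
  qed
  moreover have "A \<delta> (Suc k) \<noteq> 0"
  proof
    assume A: "A \<delta> (Suc k) = 0"
    have "Rd \<delta> k r = {0}"
    proof (rule ccontr)
      assume "Rd \<delta> k r \<noteq> {0}"
      then obtain z where "z \<in> Rd \<delta> k r" "z \<noteq> 0" using radical_zero by blast
      then obtain p' z' where "p' \<le> r" "0 < p'" "singular \<delta> k p' z'" "z' \<noteq> 0" using Rd_singular by blast
      then have "\<forall>j<p'. A \<delta> (Suc (k + j)) \<noteq> 0" using less.IH[of p' k z'] p by auto
      then show False using A \<open>0 < p'\<close> by auto
    qed
    then have "x = 0" using no_critical_singular[of k \<delta> r x] A later less.prems(1) p by auto
    then show False using less.prems(2) by simp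
  qed
  ultimately show ?case by (metis add_0_right gr0I)
qed

section \<open>Irreducibility of the radical\<close>

text \<open>
  Repeated caps lead from a nonzero element of the radical to a nonzero singular vector, whose degree
  is determined by \<open>singular_A\<close>.
\<close>

lemma Rd_trivial:
  assumes "\<And>j. 0 < j \<Longrightarrow> j \<le> p \<Longrightarrow> A \<delta> (Suc (k + j)) \<noteq> 0 \<or> A \<delta> (Suc k) = 0"
  shows "Rd \<delta> k p = {0}"
proof (rule ccontr)
  assume "Rd \<delta> k p \<noteq> {0}"
  then obtain z where "z \<in> Rd \<delta> k p" "z \<noteq> 0" using radical_zero by blast
  then obtain p' z' where p': "p' \<le> p" "0 < p'" "singular \<delta> k p' z'" "z' \<noteq> 0" using Rd_singular by blast
  then have "A \<delta> (Suc (k + p')) = 0" "\<forall>j<p'. A \<delta> (Suc (k + j)) \<noteq> 0" using singular_A by blast+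
  then show False using assms[of p'] p' by auto
qed

text \<open>
  The factor \<open>A (k + 2)\<close> in the pairing of a lift makes every lift an element of the radical when it is zero.
\<close>

lemma lift_Rd:
  assumes u: "u \<in> V (Suc k) p" and A: "A \<delta> (Suc k) \<noteq> 0"
    and "u \<in> Rd \<delta> (Suc k) p \<or> A \<delta> (Suc (Suc k)) = 0"
  obtains y where "y \<in> Rd \<delta> k (Suc p)" "rho k p y = u"
proof -
  obtain y where y: "y \<in> V k (Suc p)" "rho k p y = scale (A \<delta> (Suc k)) u"
    "\<And>v. v \<in> V k (Suc p) \<Longrightarrow> form \<delta> (k + 2 * Suc p) y v = - A \<delta> (Suc (Suc k)) * form \<delta> (Suc k + 2 * p) u (rho k p v)"
    using lift_vector[OF u] by metis
  have "form \<delta> (k + 2 * Suc p) y v = 0" if v: "v \<in> V k (Suc p)" for v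
    using y(3)[OF v] assms(3) V_rho[OF v] unfolding Rd_iff by auto
  then have "y \<in> Rd \<delta> k (Suc p)" unfolding Rd_iff using y(1) by blast
  then show thesis using that[of "scale (1 / A \<delta> (Suc k)) y"] y(2) A by (simp add: radical_scale)
qed

text \<open>
  If \<open>A (k + 2) \<noteq> 0\<close>, lifts along \<open>rho\<close> form a complement of \<open>V k p\<close> in \<open>V (Suc k) p\<close>. It is orthogonal to
  \<open>V k p\<close>, on which \<open>rho\<close> vanishes; so adding a string does not lead out of the radical.
\<close>

lemma Rd_mono:
  assumes x: "x \<in> Rd \<delta> k p" and A: "A \<delta> (Suc (Suc k)) \<noteq> 0"
  shows "x \<in> Rd \<delta> (Suc k) p"
proof (cases p)
  case 0
  then show ?thesis using x by (simp add: radical_0)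
next
  case (Suc r)
  have xV: "x \<in> V k (Suc r)" using Rd_V[OF x] Suc by simp
  have xV': "x \<in> V (Suc k) (Suc r)" using V_mono[OF xV] .
  have "form \<delta> (Suc k + 2 * Suc r) x v = 0" if v: "v \<in> V (Suc k) (Suc r)" for v
  proof -
    obtain y where y: "y \<in> V (Suc k) (Suc r)" "rho (Suc k) r y = scale (A \<delta> (Suc (Suc k))) (rho (Suc k) r v)"
      "\<And>v'. v' \<in> V (Suc k) (Suc r) \<Longrightarrow> form \<delta> (Suc k + 2 * Suc r) y v' =
        - A \<delta> (Suc (Suc (Suc k))) * form \<delta> (Suc (Suc k) + 2 * r) (rho (Suc k) r v) (rho (Suc k) r v')"
      using lift_vector[OF V_rho[OF v]] by metis
    have xy: "form \<delta> (Suc k + 2 * Suc r) x y = 0"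
      using y(3)[OF xV'] form_sym[OF xV' y(1)] rho_inclusion[OF xV] by simp
    let ?v = "v - scale (1 / A \<delta> (Suc (Suc k))) y"
    have v': "?v \<in> V (Suc k) (Suc r)" using v y(1) by (simp add: standard_diff standard_scale)
    have "rho (Suc k) r ?v = 0" using y(2) A by simp
    then have "form \<delta> (Suc k + 2 * Suc r) x ?v = 0"
    proof (rule kernel_rho[OF v'])
      fix k' assume "Suc k = Suc k'" "?v \<in> V k' (Suc r)"
      then have "?v \<in> V k (Suc r)" by simp
      then show ?thesis using V_form_mono[OF xV, of ?v] x Suc unfolding Rd_iff by simp
    qed simp
    then show ?thesis using xy by (simp add: form_diff_right form_scale_right)
  qed
  then show ?thesis unfolding Rd_iff using xV' Suc by blast
qed

inductive_set cupspan :: "nat \<Rightarrow> vec set \<Rightarrow> vec set" for N S where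
  zero: "0 \<in> cupspan N S"
| add: "x \<in> cupspan N S \<Longrightarrow> y \<in> cupspan N S \<Longrightarrow> x + y \<in> cupspan N S"
| cup: "y \<in> S \<Longrightarrow> i \<le> N \<Longrightarrow> cupop i y \<in> cupspan N S"

lemma cupspan_scale:
  assumes "x \<in> cupspan N S" "\<And>y. y \<in> S \<Longrightarrow> scale c y \<in> S"
  shows "scale c x \<in> cupspan N S"
  using assms(1)
proof induction
  case (cup y i)
  then show ?case using cupspan.cup[OF assms(2), of y i N] by simp
qed (auto simp: lc.scale_right_distrib intro: cupspan.intros)

lemma cupspan_sum: "(\<And>i. i \<in> I \<Longrightarrow> f i \<in> cupspan N S) \<Longrightarrow> sum f I \<in> cupspan N S"
  by (induction I rule: infinite_finite_induct) (auto intro: cupspan.intros)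

lemma cupspan_mono:
  assumes "x \<in> cupspan N S" "N \<le> M" "S \<subseteq> T" shows "x \<in> cupspan M T"
  using assms(1) by induction (use assms in \<open>auto intro: cupspan.intros\<close>)

lemma V_cupspan: "x \<in> V k (Suc p) \<Longrightarrow> x \<in> cupspan (k + 2 * p) (V k p)"
  by (induction x rule: V_Suc_induct) (auto intro: cupspan.intros cupspan_scale standard_scale)

lemma cupspan_lift:
  assumes "u \<in> cupspan (Suc k + 2 * p) S" "\<And>s. s \<in> S \<Longrightarrow> \<exists>h\<in>Rd \<delta> k (Suc p). rho k p h = s"
  shows "\<exists>y\<in>cupspan (k + 2 * Suc p) (Rd \<delta> k (Suc p)). rho k (Suc p) y = u"
  using assms(1)
proof induction
  case (add x y)
  then show ?case by (metis cupspan.add rho_lin(2))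
next
  case (cup s i)
  then obtain h where h: "h \<in> Rd \<delta> k (Suc p)" "rho k p h = s" using assms(2) by blast
  then have "rho k (Suc p) (cupop i h) = cupop i s"
    using rho_cup[OF Rd_V[OF h(1)], of i] cup by simp
  moreover have "cupop i h \<in> cupspan (k + 2 * Suc p) (Rd \<delta> k (Suc p))"
    using h cup by (intro cupspan.cup) auto
  ultimately show ?case by blast
qed (use cupspan.zero rho_lin(1) in blast)

lemma cupspan_Rd: "x \<in> cupspan (k + 2 * p) (Rd \<delta> k p) \<Longrightarrow> x \<in> Rd \<delta> k (Suc p)"
  by (induction rule: cupspan.induct) (auto intro: radical_add Rd_cup simp del: mult_Suc_right)

text \<open>
  Here \<open>r\<close> is the degree of the singular vector for \<open>k\<close> strings. By induction \<open>rho x\<close> is a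
  combination of cups, and it can be lifted to a combination \<open>y\<close> of cups of elements of the radical. The rest \<open>z = x - y\<close>
  has a string at the end, so it belongs to the radical for \<open>k - 1\<close> strings, where the degree of the singular vector is
  \<open>r + 1\<close> (unless \<open>A k = 0\<close>, when this radical is zero). Either induction applies again, or \<open>z\<close> is itself a singular vector for \<open>k - 1\<close> strings.
  In the latter case a multiple of a \<open>wave\<close> over the singular vector \<open>c\<close> for \<open>k\<close> strings has the same caps as \<open>z\<close>, and it is
  equal to \<open>z\<close> since singular vectors exist only in degree \<open>r\<close>.
\<close>

lemma Rd_generated:
  "A \<delta> (Suc (k + r)) = 0 \<Longrightarrow> (\<And>j. j < r \<Longrightarrow> A \<delta> (Suc (k + j)) \<noteq> 0) \<Longrightarrow> 0 < r \<Longrightarrow> r \<le> p \<Longrightarrow>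
    x \<in> Rd \<delta> k (Suc p) \<Longrightarrow> x \<in> cupspan (k + 2 * p) (Rd \<delta> k p)"
proof (induction "k + 2 * p" arbitrary: k p r x rule: less_induct)
  case less
  note zero = less.prems(1) and nonzero = less.prems(2) and r = less.prems(3,4) and x = less.prems(5)
  obtain q where p: "p = Suc q" using r by (cases p) auto
  have Ak: "A \<delta> (Suc k) \<noteq> 0" using nonzero[of 0] r by simp
  have xV: "x \<in> V k (Suc p)" using x by (rule Rd_V)
  have "\<exists>y\<in>cupspan (k + 2 * p) (Rd \<delta> k p). rho k p y = rho k p x"
  proof (cases "r = 1")
    case True
    then have "A \<delta> (Suc (Suc k)) = 0" using zero by simp
    then have "\<exists>h\<in>Rd \<delta> k (Suc q). rho k q h = s" if "s \<in> V (Suc k) q" for s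
      using lift_Rd[OF that Ak] by metis
    moreover have "rho k p x \<in> cupspan (Suc k + 2 * q) (V (Suc k) q)"
      using V_cupspan[of "rho k p x" "Suc k" q] V_rho[OF xV] p by simp
    ultimately show ?thesis unfolding p by (rule cupspan_lift[rotated])
  next
    case False
    then have A2: "A \<delta> (Suc (Suc k)) \<noteq> 0" using nonzero[of 1] r by simp
    have "\<exists>h\<in>Rd \<delta> k (Suc q). rho k q h = s" if "s \<in> Rd \<delta> (Suc k) q" for s
      using lift_Rd[OF Rd_V[OF that] Ak] that by metis
    moreover have "rho k p x \<in> cupspan (Suc k + 2 * q) (Rd \<delta> (Suc k) q)"
    proof (rule less.hyps[of _ _ "r - 1"])
      show "A \<delta> (Suc (Suc k + (r - 1))) = 0" using zero r by simp
      show "A \<delta> (Suc (Suc k + j)) \<noteq> 0" if "j < r - 1" for j using nonzero[of "Suc j"] that by simp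
      show "rho k p x \<in> Rd \<delta> (Suc k) (Suc q)" using rho_Rd[OF x A2] p by simp
    qed (use False r p in auto)
    ultimately show ?thesis unfolding p by (rule cupspan_lift[rotated])
  qed
  then obtain y where y: "y \<in> cupspan (k + 2 * p) (Rd \<delta> k p)" "rho k p y = rho k p x" by blast
  define z where "z = x - y"
  have zR: "z \<in> Rd \<delta> k (Suc p)" unfolding z_def using x cupspan_Rd[OF y(1)] by (rule radical_diff)
  have "z \<in> cupspan (k + 2 * p) (Rd \<delta> k p)"
  proof (rule kernel_rho[OF Rd_V[OF zR]])
    show "rho k p z = 0" using y(2) by (simp add: z_def)
  next
    assume "z = 0" then show ?thesis by (simp add: cupspan.zero)
  next
    fix l assume k: "k = Suc l" and zV: "z \<in> V l (Suc p)"
    then have zl: "z \<in> Rd \<delta> l (Suc p)" using Rd_restrict zR by blast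
    have incl: "Rd \<delta> l p \<subseteq> Rd \<delta> k p" using Rd_mono[of _ \<delta> l p] Ak k by blast
    show ?thesis
    proof (cases "A \<delta> (Suc l) = 0")
      case True
      then have "Rd \<delta> l (Suc p) = {0}" by (intro Rd_trivial) simp
      then show ?thesis using zl by (simp add: cupspan.zero)
    next
      case False
      have nz: "A \<delta> (Suc (l + j)) \<noteq> 0" if "j < Suc r" for j
        using nonzero[of "j - 1"] False that k by (cases j) auto
      show ?thesis
      proof (cases "Suc r \<le> p")
        case True
        have "z \<in> cupspan (l + 2 * p) (Rd \<delta> l p)"
          by (rule less.hyps[of l p "Suc r"]) (use zero nz True zl k in auto)
        then show ?thesis by (rule cupspan_mono) (use incl k in auto)
      next
        case False
        then have rp: "r = p" using r by simp
        have trivial: "Rd \<delta> l p = {0}" by (rule Rd_trivial) (use nz rp in auto)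
        let ?N = "k + 2 * p"
        have capz: "capop \<delta> i z = 0" if "i < ?N" for i
        proof -
          have "capop \<delta> i z \<in> Rd \<delta> l p" using zl that k unfolding Rd_Suc by simp
          then show ?thesis using trivial by simp
        qed
        define c where "c = capop \<delta> ?N z"
        have cR: "c \<in> Rd \<delta> k p" using zR unfolding Rd_Suc c_def by simp
        have "Rd \<delta> k q = {0}" by (rule Rd_trivial) (use nonzero rp p in auto)
        then have cs: "singular \<delta> k p c"
          using cR unfolding p Rd_Suc singular_def by auto
        \<comment> \<open>The sequence is odd about its zero \<open>k + p + 1\<close>, and \<open>2 + ?N\<close> is the mirror image of \<open>k\<close>.\<close>
        have An: "A \<delta> (Suc (Suc ?N)) \<noteq> 0"
        proof -
          have "A \<delta> (Suc (k + p) + Suc p) = - A \<delta> (Suc (k + p) - Suc p)"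
            by (rule A_reflect) (use zero rp in auto)
          moreover have e: "Suc (k + p) + Suc p = Suc (Suc ?N)" "Suc (k + p) - Suc p = Suc l" using k by auto
          ultimately have "A \<delta> (Suc (Suc ?N)) = - A \<delta> (Suc l)" by (simp only: e)
          then show ?thesis using nz[of 0] by simp
        qed
        define w where "w = scale (- 1 / A \<delta> (Suc (Suc ?N))) (wave \<delta> ?N c)"
        have wsp: "w \<in> cupspan ?N (Rd \<delta> k p)"
          unfolding w_def wave_def
          by (intro cupspan_scale cupspan_sum cupspan.cup radical_scale) (auto intro: cR)
        have "singular \<delta> k (Suc p) (z - w)"
          unfolding singular_def
        proof (intro conjI allI impI)
          show "z - w \<in> V k (Suc p)" using Rd_V[OF zR] Rd_V[OF cupspan_Rd[OF wsp]] by (rule standard_diff)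
          fix i assume "Suc i < k + 2 * Suc p"
          then have i: "i \<le> ?N" by simp
          show "capop \<delta> i (z - w) = 0"
            using cap_wave[OF cs refl i] capz[of i] An i c_def by (cases "i = ?N") (auto simp: w_def)
        qed
        then have "z - w = 0" using singular_A[of \<delta> k "Suc p" "z - w"] zero rp by auto
        then show ?thesis using wsp by simp
      qed
    qed
  qed
  then have "y + z \<in> cupspan (k + 2 * p) (Rd \<delta> k p)" by (rule cupspan.add[OF y(1)])
  then show ?case by (simp add: z_def)
qed

text \<open>
  The submodule generated by \<open>x\<close> under the generators that act on the first \<open>n\<close> points.
\<close>

inductive_set tlspan :: "complex \<Rightarrow> nat \<Rightarrow> vec \<Rightarrow> vec set" for \<delta> n x where
  base: "x \<in> tlspan \<delta> n x"
| add: "y \<in> tlspan \<delta> n x \<Longrightarrow> z \<in> tlspan \<delta> n x \<Longrightarrow> y + z \<in> tlspan \<delta> n x"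
| scale: "y \<in> tlspan \<delta> n x \<Longrightarrow> scale c y \<in> tlspan \<delta> n x"
| gen: "y \<in> tlspan \<delta> n x \<Longrightarrow> Suc i < n \<Longrightarrow> cupop i (capop \<delta> i y) \<in> tlspan \<delta> n x"

lemma standard_cup_cap:
  assumes "x \<in> standard n p" "Suc i < n" shows "cupop i (capop \<delta> i x) \<in> standard n p"
proof (cases p)
  case 0
  then show ?thesis using assms cap_standard_0[of x n] by simp
next
  case (Suc q)
  obtain m where n: "n = Suc (Suc m)" "i \<le> m" using assms(2) by (intro that[of "n - 2"]) auto
  have "capop \<delta> i x \<in> standard m q" by (rule standard_cap) (use assms n Suc in auto)
  then show ?thesis unfolding n(1) Suc by (rule standard_cup) (rule n(2))
qed

text \<open>
  The cup can be moved: \<open>e\<^sub>l u\<^sub>l\<^sub>+\<^sub>1 g = u\<^sub>l g\<close> and \<open>e\<^sub>l\<^sub>+\<^sub>1 u\<^sub>l g = u\<^sub>l\<^sub>+\<^sub>1 g\<close>.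
\<close>

lemma tlspan_cup_all:
  assumes "invvec g" "cupop j g \<in> tlspan \<delta> (Suc (Suc N)) x" "j \<le> N" "i \<le> N"
  shows "cupop i g \<in> tlspan \<delta> (Suc (Suc N)) x"
proof (cases "j \<le> i")
  case True
  from this assms(4) show ?thesis
  proof (induction i rule: dec_induct)
    case (step l)
    then have "cupop (Suc l) (capop \<delta> (Suc l) (cupop l g)) \<in> tlspan \<delta> (Suc (Suc N)) x"
      by (intro tlspan.gen) auto
    then show ?case using cap_Suc_cup[OF assms(1)] by simp
  qed (use assms(2) in simp)
next
  case False
  then have "i \<le> j" by simp
  then show ?thesis
  proof (induction i rule: inc_induct)
    case (step l)
    then have "cupop l (capop \<delta> l (cupop (Suc l) g)) \<in> tlspan \<delta> (Suc (Suc N)) x"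
      using assms(3) by (intro tlspan.gen) auto
    then show ?case using cap_cup_Suc[OF assms(1)] by simp
  qed (use assms(2) in simp)
qed

text \<open>
  The action on \<open>g\<close> can be performed behind an inserted cup. With the cup at the first two points,
  \<open>u\<^sub>0 e\<^sub>l g = e\<^sub>l\<^sub>+\<^sub>2 u\<^sub>0 g\<close> for every \<open>l\<close>; at a place next to \<open>l\<close> several generators would be needed.
\<close>

lemma tlspan_cup:
  assumes g0: "g0 \<in> V k p" and j: "j \<le> k + 2 * p" "cupop j g0 \<in> tlspan \<delta> (Suc (Suc (k + 2 * p))) x"
    and g: "g \<in> tlspan \<delta> (k + 2 * p) g0" and i: "i \<le> k + 2 * p"
  shows "cupop i g \<in> tlspan \<delta> (Suc (Suc (k + 2 * p))) x"
proof -
  have "g \<in> V k p \<and> (\<forall>i\<le>k + 2 * p. cupop i g \<in> tlspan \<delta> (Suc (Suc (k + 2 * p))) x)"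
    using g
  proof induction
    case base
    then show ?case using g0 tlspan_cup_all[OF standard_invvec[OF g0] j(2,1)] by blast
  next
    case (add y z)
    then show ?case by (auto intro: standard_add tlspan.add)
  next
    case (scale y c)
    then show ?case by (auto intro: standard_scale tlspan.scale)
  next
    case (gen y l)
    then have y: "y \<in> V k p" "invvec y" "cupop 0 y \<in> tlspan \<delta> (Suc (Suc (k + 2 * p))) x"
      using standard_invvec by auto
    let ?y = "cupop l (capop \<delta> l y)"
    have V: "?y \<in> V k p" by (rule standard_cup_cap[OF y(1)]) (use gen in simp)
    have "cupop 0 ?y = cupop (Suc (Suc l)) (capop \<delta> (Suc (Suc l)) (cupop 0 y))"
      using cap_far_cup[OF y(2), of 0 l \<delta>] cupop_cupop[of 0 l "capop \<delta> l y"] by simp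
    also have "\<dots> \<in> tlspan \<delta> (Suc (Suc (k + 2 * p))) x"
      by (rule tlspan.gen[OF y(3)]) (use gen in simp)
    finally have "cupop 0 ?y \<in> tlspan \<delta> (Suc (Suc (k + 2 * p))) x" .
    then show ?case using V tlspan_cup_all[OF standard_invvec[OF V], of 0] by blast
  qed
  then show ?thesis using i by blast
qed

lemma tlspan_zero: "0 \<in> tlspan \<delta> n x"
  using tlspan.scale[OF tlspan.base, where c = 0] by simp

lemma Rd_irreducible:
  "x \<in> Rd \<delta> k p \<Longrightarrow> x \<noteq> 0 \<Longrightarrow> y \<in> Rd \<delta> k p \<Longrightarrow> y \<in> tlspan \<delta> (k + 2 * p) x"
proof (induction p arbitrary: x y)
  case 0
  then show ?case by (simp add: radical_0)
next
  case (Suc p)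
  show ?case
  proof (cases "\<exists>j\<le>k + 2 * p. capop \<delta> j x \<noteq> 0")
    case False
    then have s: "singular \<delta> k (Suc p) x"
      using Rd_V[OF Suc.prems(1)] by (auto simp: singular_def)
    have "\<forall>j<Suc p. A \<delta> (Suc (k + j)) \<noteq> 0" using singular_A[OF s Suc.prems(2)] by simp
    then have "Rd \<delta> k p = {0}" by (intro Rd_trivial) auto
    then have "singular \<delta> k (Suc p) y"
      using Suc.prems(3) unfolding Rd_Suc singular_def by auto
    then obtain c where "y = scale c x" using singular_proportional[OF s _ Suc.prems(2)] by blast
    then show ?thesis by (auto intro: tlspan.intros)
  next
    case True
    then obtain j where j: "j \<le> k + 2 * p" "capop \<delta> j x \<noteq> 0" by blast
    let ?g = "capop \<delta> j x"
    have g: "?g \<in> Rd \<delta> k p" using Suc.prems(1) j(1) unfolding Rd_Suc by blast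
    obtain r z where "r \<le> p" "0 < r" "singular \<delta> k r z" "z \<noteq> 0" using Rd_singular[OF g j(2)] by blast
    then have "y \<in> cupspan (k + 2 * p) (Rd \<delta> k p)"
      using singular_A[of \<delta> k r z] Suc.prems(3) by (intro Rd_generated[where r = r]) auto
    then have "y \<in> tlspan \<delta> (Suc (Suc (k + 2 * p))) x"
    proof induction
      case (cup g' i)
      have "cupop j ?g \<in> tlspan \<delta> (Suc (Suc (k + 2 * p))) x"
        by (rule tlspan.gen[OF tlspan.base]) (use j in simp)
      then show ?case
        using tlspan_cup[OF Rd_V[OF g] j(1) _ Suc.IH[OF g j(2) cup(1)] cup(2)] by blast
    qed (auto intro: tlspan.add tlspan_zero)
    then show ?thesis by simp
  qed
qed

section \<open>The action of the free algebra\<close>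

lemma e_op_lin [simp]:
  "e_op \<delta> i 0 = 0" "e_op \<delta> i (x + y) = e_op \<delta> i x + e_op \<delta> i y"
  "e_op \<delta> i (scale c x) = scale c (e_op \<delta> i x)"
  by (simp_all add: e_op_def lin_ext_add lin_ext_scale)

lemma e_op_eq: "invvec x \<Longrightarrow> e_op \<delta> i x = cupop i (capop \<delta> i x)"
proof -
  assume "invvec x"
  then have "e_op \<delta> i x = lin_ext (\<lambda>v. lin_ext (\<lambda>v. basis (cup i v)) (cap_state \<delta> i v)) x"
    unfolding e_op_def invvec_def by (intro lin_ext_cong e_state_eq) auto
  then show ?thesis by (simp add: cupop_def capop_def lin_ext_lin_ext)
qed

lemma word_op_lin [simp]:
  "foldr (e_op \<delta>) l 0 = 0"
  "foldr (e_op \<delta>) l (x + y) = foldr (e_op \<delta>) l x + foldr (e_op \<delta>) l y"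
  "foldr (e_op \<delta>) l (scale c x) = scale c (foldr (e_op \<delta>) l x)"
  by (induction l) simp_all

lemma act_lin_ext: "act \<delta> a x = lin_ext (\<lambda>u. foldr (e_op \<delta>) (letters u) x) a"
  by (simp add: act_def lin_ext_def)

lemma act_left [simp]:
  "act \<delta> 0 x = 0" "act \<delta> (a + b) x = act \<delta> a x + act \<delta> b x" "act \<delta> (a - b) x = act \<delta> a x - act \<delta> b x"
  "act \<delta> (scale c a) x = scale c (act \<delta> a x)"
  "act \<delta> (Poly_Mapping.single u c) x = scale c (foldr (e_op \<delta>) (letters u) x)"
  by (simp_all add: act_lin_ext lin_ext_add lin_ext_diff lin_ext_scale)

lemma act_right [simp]:
  "act \<delta> a 0 = 0" "act \<delta> a (x + y) = act \<delta> a x + act \<delta> a y" "act \<delta> a (scale c x) = scale c (act \<delta> a x)"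
  by (simp_all add: act_def lc.scale_right_distrib sum.distrib lc.scale_sum_right mult.commute)

lemma act_gen [simp]: "act \<delta> (gen i) x = e_op \<delta> i x"
  by (simp add: gen_def)

lemma single_induct:
  fixes a :: "'b \<Rightarrow>\<^sub>0 complex"
  assumes "P 0" "\<And>a b. P a \<Longrightarrow> P b \<Longrightarrow> P (a + b)" "\<And>u c. P (Poly_Mapping.single u c)"
  shows "P a"
proof -
  have "P (\<Sum>v\<in>F. scale (Poly_Mapping.lookup a v) (Poly_Mapping.single v 1))" if "finite F" for F
    using that by (induction F rule: finite_induct) (auto intro: assms simp: scale_basis)
  then show ?thesis using vec_expand[of a] by (metis finite_keys)
qed

lemma act_mult [simp]: "act \<delta> (a * b) x = act \<delta> a (act \<delta> b x)"
proof (induction a rule: single_induct)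
  case (3 u c)
  show ?case
    by (induction b rule: single_induct)
      (simp_all add: distrib_left mult_single plus_word_def foldr_append lc.scale_right_distrib mult.commute)
qed (simp_all add: distrib_right)

lemma act_subspace:
  assumes "lc.subspace S" "\<And>i x. x \<in> S \<Longrightarrow> e_op \<delta> i x \<in> S" "x \<in> S"
  shows "act \<delta> a x \<in> S"
proof -
  have "foldr (e_op \<delta>) l x \<in> S" for l by (induction l) (use assms in auto)
  then show ?thesis unfolding act_def
    by (intro lc.subspace_sum[OF assms(1)] lc.subspace_scale[OF assms(1)])
qed

section \<open>Link states with a common tail\<close>

definition closed_at :: "(nat \<Rightarrow> nat) \<Rightarrow> nat \<Rightarrow> bool" where
  "closed_at w m \<longleftrightarrow> (\<forall>i<m. w i < m)"

definition tail :: "(nat \<Rightarrow> nat) \<Rightarrow> nat \<Rightarrow> (nat \<Rightarrow> nat) \<Rightarrow> nat \<Rightarrow> nat" where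
  "tail w m v = (\<lambda>i. if i < m then v i else w i)"

definition trunc :: "nat \<Rightarrow> (nat \<Rightarrow> nat) \<Rightarrow> nat \<Rightarrow> nat" where
  "trunc m v = (\<lambda>i. if i < m then v i else i)"

definition extend :: "(nat \<Rightarrow> nat) \<Rightarrow> nat \<Rightarrow> vec \<Rightarrow> vec" where
  "extend w m = lin_ext (\<lambda>v. basis (tail w m v))"

definition ncups :: "(nat \<Rightarrow> nat) \<Rightarrow> nat \<Rightarrow> nat" where
  "ncups w m = card {i. i < m \<and> i < w i}"

lemma extend_lin [simp]:
  "extend w m 0 = 0" "extend w m (x + y) = extend w m x + extend w m y"
  "extend w m (scale c x) = scale c (extend w m x)" "extend w m (Poly_Mapping.single v c) = scale c (basis (tail w m v))"
  by (simp_all add: extend_def lin_ext_add lin_ext_scale)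

lemma cut_eq: "cut v n = (LEAST m. n \<le> m \<and> closed_at v m)"
  by (simp add: cut_def closed_at_def)

context
  fixes w :: "nat \<Rightarrow> nat"
  assumes w: "inf_link_state w"
begin

lemma w_invol: "w (w i) = i"
  using w by (simp add: link_state_def)

lemma w_noncross: "a < c \<Longrightarrow> c < w a \<Longrightarrow> w a < w c \<Longrightarrow> False"
  using w by (auto simp: link_state_def)

lemma w_nostring: "a < c \<Longrightarrow> c < w a \<Longrightarrow> w c \<noteq> c"
  using w by (auto simp: link_state_def)

text \<open>
  The cups over the point \<open>n\<close> are nested, so there is an outermost one; no cup leads over its
  right end.
\<close>

lemma ex_closed_at: "\<exists>m\<ge>n. closed_at w m"
proof (cases "closed_at w n")
  case False
  then obtain b0 where b0: "b0 < n" "n \<le> w b0" by (auto simp: closed_at_def not_less)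
  define M where "M = Max (w ` {..<n})"
  have fin: "finite (w ` {..<n})" "w ` {..<n} \<noteq> {}" using b0 by auto
  then have "M \<in> w ` {..<n}" unfolding M_def by (rule Max_in)
  then obtain a where a: "a < n" "M = w a" by auto
  have le: "w i \<le> M" if "i < n" for i unfolding M_def using fin that by simp
  have nM: "n \<le> M" using b0 le by (meson le_trans)
  have "w i \<le> M" if "i \<le> M" for i
  proof (rule ccontr)
    assume *: "\<not> w i \<le> M"
    then have "n \<le> i" using le by (meson not_le)
    moreover have "i \<noteq> M" using * a w_invol[of a] nM by auto
    ultimately show False using w_noncross[of a i] a * that by auto
  qed
  then have "closed_at w (Suc M)" by (simp add: closed_at_def less_Suc_eq_le)
  then show ?thesis using nM le_SucI by blast
qed blast

lemma cut_closed: "closed_at w (cut w n)" "n \<le> cut w n"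
proof -
  obtain m where "n \<le> m \<and> closed_at w m" using ex_closed_at by blast
  then have "n \<le> cut w n \<and> closed_at w (cut w n)"
    unfolding cut_eq by (rule LeastI)
  then show "closed_at w (cut w n)" "n \<le> cut w n" by auto
qed

lemma closed_outside: "closed_at w m \<Longrightarrow> m \<le> i \<Longrightarrow> m \<le> w i"
  using w_invol[of i] unfolding closed_at_def by (metis not_le)

lemma cut_tail:
  assumes "closed_at w m" "v \<in> link_states m p" "m \<le> n"
  shows "cut (tail w m v) n = cut w n"
proof -
  have "closed_at (tail w m v) l \<longleftrightarrow> closed_at w l" if "n \<le> l" for l
  proof -
    have "tail w m v i < l \<longleftrightarrow> w i < l" if "i < l" for i
    proof (cases "i < m")
      case True
      then have "v i < l" "w i < l" using link_states_le[OF assms(2)] assms(1,3) \<open>n \<le> l\<close> 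
        unfolding closed_at_def by (meson order_less_le_trans)+
      then show ?thesis using True by (simp add: tail_def)
    qed (simp add: tail_def)
    then show ?thesis by (simp add: closed_at_def)
  qed
  then have "(n \<le> l \<and> closed_at (tail w m v) l) = (n \<le> l \<and> closed_at w l)" for l by blast
  then show ?thesis unfolding cut_eq by simp
qed

lemma tail_link_states:
  assumes m: "closed_at w m" and M: "closed_at w M" and "m \<le> M" and v: "v \<in> link_states m (ncups w m)"
  shows "trunc M (tail w m v) \<in> link_states M (ncups w M)"
proof -
  let ?u = "trunc M (tail w m v)"
  have u: "?u i = (if i < m then v i else if i < M then w i else i)" for i
    using \<open>m \<le> M\<close> by (simp add: trunc_def tail_def)
  have vm: "v i < m" if "i < m" for i using link_states_le[OF v that] .
  have wM: "w i < M" "m \<le> w i" if "i < M" "m \<le> i" for i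
    using M that closed_outside[OF m] by (auto simp: closed_at_def)
  show ?thesis
  proof (rule link_statesI)
    show "?u i = i" if "M \<le> i" for i using that \<open>m \<le> M\<close> by (simp add: u)
    show "?u i < M" if "i < M" for i
      using that vm[of i] wM[of i] \<open>m \<le> M\<close> by (cases "i < m") (auto simp: u)
    show "?u (?u i) = i" for i
      using vm[of i] wM[of i] link_states_invol[OF v] w_invol[of i] by (auto simp: u invol_def)
    show False if "a < c" "c < ?u a" "?u a < ?u c" for a c
    proof (cases "a < m")
      case True
      then have "c < m" using that(2) vm[of a] by (simp add: u)
      then show ?thesis using that True link_states_noncross[OF v, of a c] by (simp add: u)
    next
      case False
      then have "a < M" using that(1,2) by (auto simp: u split: if_splits)
      then have "c < M" "\<not> c < m" using that(1,2) False wM[of a] by (auto simp: u)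
      then show ?thesis using that False \<open>a < M\<close> w_noncross[of a c] by (simp add: u)
    qed
    show "?u c \<noteq> c" if "a < c" "c < ?u a" for a c
    proof (cases "a < m")
      case True
      then have "c < m" using that(2) vm[of a] by (simp add: u)
      then show ?thesis using that True link_states_nostring[OF v, of a c] by (simp add: u)
    next
      case False
      then have "a < M" using that(1,2) by (auto simp: u split: if_splits)
      then have "c < M" "\<not> c < m" using that(1,2) False wM[of a] by (auto simp: u)
      then show ?thesis using that False \<open>a < M\<close> w_nostring[of a c] by (simp add: u)
    qed
    let ?T = "{i. m \<le> i \<and> i < M \<and> i < w i}"
    have "{i. i < ?u i} = {i. i < v i} \<union> ?T"
      using link_states_fixed[OF v] by (auto simp: u not_less split: if_splits)
    moreover have "{i. i < v i} \<inter> ?T = {}"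
      using link_states_fixed[OF v] by auto
    moreover have "finite ?T" "finite {i. i < m \<and> i < w i}" by simp_all
    moreover have "{i. i < M \<and> i < w i} = {i. i < m \<and> i < w i} \<union> ?T"
      using \<open>m \<le> M\<close> by auto
    moreover have "{i. i < m \<and> i < w i} \<inter> ?T = {}" by auto
    ultimately show "card {i. i < ?u i} = ncups w M"
      using openers_finite[OF v] link_states_card[OF v] by (simp add: ncups_def card_Un_disjoint)
  qed
qed

text \<open>
  The combinations of states that agree with \<open>w\<close> from \<open>m\<close> on and have as many cups before \<open>m\<close> as \<open>w\<close>. They
  are stable under the generators that act before \<open>m\<close>, and \<open>extend w m\<close> identifies them with a standard
  module.
\<close>

definition tailed :: "nat \<Rightarrow> vec set" where
  "tailed m = extend w m ` standard m (ncups w m)"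

lemma tail_trunc: "m \<le> M \<Longrightarrow> tail w M (trunc M (tail w m v)) = tail w m v"
  by (auto simp: tail_def trunc_def)

lemma trunc_tail: "v \<in> link_states M p \<Longrightarrow> trunc M (tail w M v) = v"
  using link_states_fixed[of v M p] by (auto simp: tail_def trunc_def)

lemma lin_ext_trunc_extend:
  "lin_ext (\<lambda>v. basis (trunc M v)) (extend w m y) = lin_ext (\<lambda>v. basis (trunc M (tail w m v))) y"
  by (simp add: extend_def lin_ext_lin_ext)

lemma standard_trunc:
  assumes "closed_at w m" "closed_at w M" "m \<le> M" "y \<in> standard m (ncups w m)"
  shows "lin_ext (\<lambda>v. basis (trunc M (tail w m v))) y \<in> standard M (ncups w M)"
  unfolding standard_def mem_Collect_eq
  by (rule keys_lin_ext) (use tail_link_states[OF assms(1-3)] assms(4) in \<open>auto simp: standard_def\<close>)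

lemma extend_trunc:
  assumes "m \<le> M"
  shows "extend w M (lin_ext (\<lambda>v. basis (trunc M (tail w m v))) y) = extend w m y"
  unfolding extend_def lin_ext_lin_ext using tail_trunc[OF assms] by simp

lemma trunc_extend:
  assumes "y \<in> standard M p"
  shows "lin_ext (\<lambda>v. basis (trunc M v)) (extend w M y) = y"
proof -
  have "lin_ext (\<lambda>v. basis (trunc M (tail w M v))) y = lin_ext basis y"
    using assms trunc_tail by (intro lin_ext_cong) (auto simp: standard_def)
  then show ?thesis by (simp add: lin_ext_trunc_extend)
qed

lemma tailed_mono:
  assumes "closed_at w m" "closed_at w M" "m \<le> M" shows "tailed m \<subseteq> tailed M"
proof
  fix x assume "x \<in> tailed m"
  then obtain y where "y \<in> standard m (ncups w m)" "x = extend w m y" by (auto simp: tailed_def)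
  then show "x \<in> tailed M"
    unfolding tailed_def using standard_trunc[OF assms] extend_trunc[OF assms(3)] by (metis imageI)
qed

text \<open>
  All states in such a combination have the same cuts beyond \<open>m\<close> as \<open>w\<close>, so restriction is truncation
  at a common length and is undone by attaching the tail of \<open>w\<close> again.
\<close>

lemma tailed_restr:
  assumes m: "closed_at w m" and x: "x \<in> tailed m" and k: "m \<le> k"
  shows "v \<in> Poly_Mapping.keys x \<Longrightarrow> cut v k = cut w k"
    and "restr k x = lin_ext (\<lambda>v. basis (trunc (cut w k) v)) x"
    and "restr k x \<in> standard (cut w k) (ncups w (cut w k))"
    and "extend w (cut w k) (restr k x) = x"
proof -
  obtain y where y: "y \<in> standard m (ncups w m)" "x = extend w m y" using x by (auto simp: tailed_def)
  have K: "Poly_Mapping.keys x \<subseteq> tail w m ` link_states m (ncups w m)"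
    unfolding y(2) extend_def by (rule keys_lin_ext) (use y(1) in \<open>auto simp: standard_def\<close>)
  show c: "cut v k = cut w k" if "v \<in> Poly_Mapping.keys x" for v
    using that K cut_tail[OF m _ k] by blast
  show r: "restr k x = lin_ext (\<lambda>v. basis (trunc (cut w k) v)) x"
    unfolding restr_def by (rule lin_ext_cong) (simp add: restr_state_def trunc_def c)
  have mk: "m \<le> cut w k" using k cut_closed(2) le_trans by blast
  have r': "restr k x = lin_ext (\<lambda>v. basis (trunc (cut w k) (tail w m v))) y"
    using r by (simp only: y(2) lin_ext_trunc_extend)
  show "restr k x \<in> standard (cut w k) (ncups w (cut w k))"
    unfolding r' by (rule standard_trunc[OF m cut_closed(1) mk y(1)])
  show "extend w (cut w k) (restr k x) = x"
    using extend_trunc[OF mk, of y] y(2) r' by simp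
qed

lemma tail_upd: "a < m \<Longrightarrow> tail w m (v(a := b)) = (tail w m v)(a := b)"
  by (auto simp: tail_def)

lemma e_op_extend:
  assumes y: "y \<in> standard m p" and i: "Suc i < m"
  shows "e_op \<delta> i (extend w m y) = extend w m (e_op \<delta> i y)"
  using y
proof (induction y rule: standard_induct)
  case (basis v)
  have b: "v i < m" "v (Suc i) < m" "i < m" using link_states_le[OF basis] i by auto
  have t: "tail w m v i = v i" "tail w m v (Suc i) = v (Suc i)" using i by (auto simp: tail_def)
  show ?case
    using b i by (simp add: e_op_def e_state_def Let_def t tail_upd)
qed simp_all

lemma e_op_standard:
  assumes "y \<in> standard m p" "Suc i < m" shows "e_op \<delta> i y \<in> standard m p"
  using standard_cup_cap[OF assms] e_op_eq[OF standard_invvec[OF assms(1)]] by simp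

lemma e_op_tailed:
  assumes "x \<in> tailed m" "Suc i < m" shows "e_op \<delta> i x \<in> tailed m"
proof -
  obtain y where y: "y \<in> standard m (ncups w m)" "x = extend w m y" using assms(1) by (auto simp: tailed_def)
  have "e_op \<delta> i x = extend w m (e_op \<delta> i y)" using e_op_extend[OF y(1) assms(2)] y(2) by simp
  then show ?thesis unfolding tailed_def using e_op_standard[OF y(1) assms(2)] by blast
qed

definition tails :: "vec set" where
  "tails = (\<Union>m\<in>{m. closed_at w m}. tailed m)"

lemma tails_raise:
  assumes "x \<in> tails" obtains m where "closed_at w m" "n \<le> m" "x \<in> tailed m"
proof -
  obtain m0 where m0: "closed_at w m0" "x \<in> tailed m0" using assms by (auto simp: tails_def)
  obtain m where "max m0 n \<le> m" "closed_at w m" using ex_closed_at by blast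
  then show thesis using that[of m] tailed_mono[OF m0(1), of m] m0(2) by auto
qed

lemma tailed_subspace: "lc.subspace (tailed m)"
proof (rule lc.subspaceI)
  show "0 \<in> tailed m" unfolding tailed_def by (rule image_eqI[of _ _ 0]) simp_all
  show "x + y \<in> tailed m" if xy: "x \<in> tailed m" "y \<in> tailed m" for x y
  proof -
    obtain a b where "a \<in> standard m (ncups w m)" "b \<in> standard m (ncups w m)" "x = extend w m a" "y = extend w m b"
      using xy by (auto simp: tailed_def)
    then show ?thesis unfolding tailed_def by (intro image_eqI[of _ _ "a + b"]) (simp_all add: standard_add)
  qed
  show "scale c x \<in> tailed m" if x: "x \<in> tailed m" for c x
  proof -
    obtain a where "a \<in> standard m (ncups w m)" "x = extend w m a"
      using x by (auto simp: tailed_def)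
    then show ?thesis unfolding tailed_def by (intro image_eqI[of _ _ "scale c a"]) (simp_all add: standard_scale)
  qed
qed

lemma tails_common:
  assumes "x \<in> tails" "y \<in> tails" obtains m where "closed_at w m" "x \<in> tailed m" "y \<in> tailed m"
proof -
  obtain m0 where m0: "closed_at w m0" "x \<in> tailed m0" using assms by (auto simp: tails_def)
  obtain m where m: "closed_at w m" "m0 \<le> m" "y \<in> tailed m" using tails_raise[OF assms(2)] .
  then show thesis using that[of m] tailed_mono[OF m0(1) m(1)] m0(2) by auto
qed

lemma tails_subspace: "lc.subspace tails"
proof (rule lc.subspaceI)
  have "closed_at w 0" by (simp add: closed_at_def)
  then show "0 \<in> tails" using lc.subspace_0[OF tailed_subspace] unfolding tails_def by blast
  show "x + y \<in> tails" if xy: "x \<in> tails" "y \<in> tails" for x y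
  proof -
    obtain m where "closed_at w m" "x \<in> tailed m" "y \<in> tailed m" using tails_common[OF xy] .
    then show ?thesis using lc.subspace_add[OF tailed_subspace] unfolding tails_def by blast
  qed
  show "scale c x \<in> tails" if "x \<in> tails" for c x
    using that lc.subspace_scale[OF tailed_subspace] unfolding tails_def by blast
qed

lemma tails_e_op: "x \<in> tails \<Longrightarrow> e_op \<delta> i x \<in> tails"
proof -
  assume "x \<in> tails"
  then obtain m where "closed_at w m" "Suc (Suc i) \<le> m" "x \<in> tailed m" by (rule tails_raise)
  then show ?thesis using e_op_tailed[of x m i] unfolding tails_def by auto
qed

lemma tails_act: "x \<in> tails \<Longrightarrow> act \<delta> a x \<in> tails"
  by (rule act_subspace[OF tails_subspace tails_e_op])

lemma tails_w: "basis w \<in> tails"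
proof -
  have "basis w = extend w 0 (basis (\<lambda>a. a))" by (simp add: tail_def)
  moreover have "basis (\<lambda>a. a) \<in> standard 0 (ncups w 0)" by (simp add: ncups_def link_states_0)
  moreover have "closed_at w 0" by (simp add: closed_at_def)
  ultimately show ?thesis unfolding tails_def tailed_def by blast
qed

text \<open>
  The relations are checked on the standard module that contains the first \<open>m\<close> points, for \<open>m\<close> large, where they
  are consequences of the relations between cups and caps.
\<close>

lemma tails_relations:
  assumes "x \<in> tails"
  shows "e_op \<delta> i (e_op \<delta> i x) = scale \<delta> (e_op \<delta> i x)"
    and "e_op \<delta> i (e_op \<delta> (Suc i) (e_op \<delta> i x)) = e_op \<delta> i x"
    and "e_op \<delta> (Suc i) (e_op \<delta> i (e_op \<delta> (Suc i) x)) = e_op \<delta> (Suc i) x"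
    and "Suc i < j \<Longrightarrow> e_op \<delta> i (e_op \<delta> j x) = e_op \<delta> j (e_op \<delta> i x)"
proof -
  obtain m where m: "Suc (Suc (i + j)) < m" "x \<in> tailed m"
    using tails_raise[OF assms, of "Suc (Suc (Suc (i + j)))"] by (metis Suc_le_eq)
  then obtain p y where y: "y \<in> standard m p" "x = extend w m y" by (auto simp: tailed_def)
  let ?e = "\<lambda>i. e_op \<delta> i"
  have ext: "?e l (extend w m z) = extend w m (?e l z)" "?e l z \<in> standard m p"
    if "z \<in> standard m p" "l \<le> Suc i \<or> l = j" for l z
    using e_op_extend[OF that(1), of l] e_op_standard[OF that(1), of l] that(2) m(1) by auto
  have uc: "?e l z = cupop l (capop \<delta> l z)" if "z \<in> standard m p" for l z
    using e_op_eq standard_invvec that by blast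
  have ci: "invvec (capop \<delta> l z)" if z: "z \<in> standard m p" for l z
  proof (cases p)
    case 0 then show ?thesis using z cap_standard_0 by (simp add: invvec_def)
  next
    case (Suc q)
    have "z \<in> standard (Suc (Suc (max m l))) (Suc q)" using standard_mono[OF z] Suc by simp
    then have "capop \<delta> l z \<in> standard (max m l) q" by (rule standard_cap) simp
    then show ?thesis by (rule standard_invvec)
  qed
  have sq: "?e i (?e i y) = scale \<delta> (?e i y)"
    using ext(2)[OF y(1), of i] by (simp add: uc y(1))
  have b1: "?e i (?e (Suc i) (?e i y)) = ?e i y"
    using ext(2)[OF y(1), of i] ext(2)[OF ext(2)[OF y(1), of i], of "Suc i"]
    by (simp add: uc y(1) cap_cup_Suc cap_Suc_cup ci)
  have b2: "?e (Suc i) (?e i (?e (Suc i) y)) = ?e (Suc i) y"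
    using ext(2)[OF y(1), of "Suc i"] ext(2)[OF ext(2)[OF y(1), of "Suc i"], of i]
    by (simp add: uc y(1) cap_cup_Suc cap_Suc_cup ci)
  show "e_op \<delta> i (e_op \<delta> i x) = scale \<delta> (e_op \<delta> i x)"
    using sq y ext(1)[OF y(1)] ext(1)[OF ext(2)[OF y(1), of i]] by simp
  show "e_op \<delta> i (e_op \<delta> (Suc i) (e_op \<delta> i x)) = e_op \<delta> i x"
    using b1 y ext ext(2)[OF ext(2)[OF y(1), of i], of "Suc i"] by simp
  show "e_op \<delta> (Suc i) (e_op \<delta> i (e_op \<delta> (Suc i) x)) = e_op \<delta> (Suc i) x"
    using b2 y ext ext(2)[OF ext(2)[OF y(1), of "Suc i"], of i] by simp
  show "e_op \<delta> i (e_op \<delta> j x) = e_op \<delta> j (e_op \<delta> i x)" if "Suc i < j"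
  proof -
    obtain l where l: "j = Suc (Suc l)" "i \<le> l" using \<open>Suc i < j\<close> by (intro that[of "j - 2"]) auto
    have "?e i (?e j y) = cupop i (cupop l (capop \<delta> l (capop \<delta> i y)))"
      using ext(2)[OF y(1), of j] l cap_cap[OF y(1) l(2)] by (simp add: uc y(1) cap_cup_far ci)
    moreover have "?e j (?e i y) = cupop j (cupop i (capop \<delta> l (capop \<delta> i y)))"
      using ext(2)[OF y(1), of i] l by (simp add: uc y(1) cap_far_cup ci)
    ultimately have "?e i (?e j y) = ?e j (?e i y)" using cupop_cupop[OF l(2)] l(1) by simp
    then show ?thesis using y ext by simp
  qed
qed

lemma tl_ideal_zero:
  assumes "a \<in> tl_ideal \<delta>" "x \<in> tails" shows "act \<delta> a x = 0"
  using assms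
proof (induction arbitrary: x rule: tl_ideal.induct)
  case (mult_right a r)
  then show ?case using tails_act by simp
next
  case (commute i j)
  then show ?case using tails_relations(4)[OF commute(2,1)] by simp
qed (simp_all add: tails_relations)

section \<open>The radical of the infinite representation\<close>

lemma X_tails: "X_rep \<delta> w \<subseteq> tails"
  unfolding X_rep_def using tails_act[OF tails_w] by auto

lemma X_subspace: "lc.subspace (X_rep \<delta> w)"
proof (rule lc.subspaceI)
  show "0 \<in> X_rep \<delta> w" unfolding X_rep_def using act_left(1) by (metis (mono_tags, lifting) mem_Collect_eq)
  show "x + y \<in> X_rep \<delta> w" if "x \<in> X_rep \<delta> w" "y \<in> X_rep \<delta> w" for x y
    using that unfolding X_rep_def using act_left(2) by (smt (verit) mem_Collect_eq)
  show "scale c x \<in> X_rep \<delta> w" if "x \<in> X_rep \<delta> w" for c x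
    using that unfolding X_rep_def using act_left(4) by (smt (verit) mem_Collect_eq)
qed

lemma X_e_op: "x \<in> X_rep \<delta> w \<Longrightarrow> e_op \<delta> i x \<in> X_rep \<delta> w"
  unfolding X_rep_def using act_mult act_gen by (smt (verit) mem_Collect_eq)

text \<open>
  The length and the number of cups in the definition of \<open>R_rep\<close> are necessarily those of the restriction of \<open>w\<close>
  (any values will do for the zero vector). In this form the condition is visibly linear.
\<close>

lemma R_iff:
  "x \<in> R_rep \<delta> w \<longleftrightarrow> x \<in> X_rep \<delta> w \<and> (\<exists>n. \<forall>k\<ge>n. restr k x \<in> radical \<delta> (cut w k) (ncups w (cut w k)))"
proof (intro iffI conjI)
  assume x: "x \<in> R_rep \<delta> w"
  then show xX: "x \<in> X_rep \<delta> w" by (simp add: R_rep_def)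
  obtain n where n: "\<And>k. n \<le> k \<Longrightarrow> \<exists>m p. (\<forall>v\<in>Poly_Mapping.keys x. cut v k = m) \<and> restr k x \<in> radical \<delta> m p"
    using x by (auto simp: R_rep_def)
  obtain m where m: "closed_at w m" "x \<in> tailed m" using xX X_tails by (auto simp: tails_def)
  have "restr k x \<in> radical \<delta> (cut w k) (ncups w (cut w k))" if k: "max n m \<le> k" for k
  proof (cases "x = 0")
    case True
    then show ?thesis by (simp add: restr_def)
  next
    case False
    note R = tailed_restr[OF m, of k]
    obtain l p where l: "\<forall>v\<in>Poly_Mapping.keys x. cut v k = l" "restr k x \<in> radical \<delta> l p"
      using n k by (meson max.boundedE)
    obtain v where "v \<in> Poly_Mapping.keys x" using False by (metis ex_in_conv keys_eq_empty)
    then have "l = cut w k" using l(1) R(1) k by auto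
    moreover have "p = ncups w (cut w k)"
    proof -
      have "restr k x \<noteq> 0" using R(4) k False by auto
      then obtain u where "u \<in> Poly_Mapping.keys (restr k x)" by (metis ex_in_conv keys_eq_empty)
      moreover have "restr k x \<in> standard l p" using l(2) by (simp add: radical_def)
      moreover have "restr k x \<in> standard (cut w k) (ncups w (cut w k))" using R(3) k by simp
      ultimately show ?thesis using link_states_card unfolding standard_def by blast
    qed
    ultimately show ?thesis using l(2) by simp
  qed
  then show "\<exists>n. \<forall>k\<ge>n. restr k x \<in> radical \<delta> (cut w k) (ncups w (cut w k))" by blast
next
  assume "x \<in> X_rep \<delta> w \<and> (\<exists>n. \<forall>k\<ge>n. restr k x \<in> radical \<delta> (cut w k) (ncups w (cut w k)))"
  then obtain n where xX: "x \<in> X_rep \<delta> w"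
    and n: "\<And>k. n \<le> k \<Longrightarrow> restr k x \<in> radical \<delta> (cut w k) (ncups w (cut w k))" by blast
  obtain m where m: "closed_at w m" "x \<in> tailed m" using xX X_tails by (auto simp: tails_def)
  have "\<exists>l p. (\<forall>v\<in>Poly_Mapping.keys x. cut v k = l) \<and> restr k x \<in> radical \<delta> l p" if "max n m \<le> k" for k
    using n[of k] tailed_restr(1)[OF m, of k] that by auto
  then show "x \<in> R_rep \<delta> w" unfolding R_rep_def using xX by blast
qed

lemma radical_e_op:
  assumes "y \<in> radical \<delta> m p" "Suc i < m" shows "e_op \<delta> i y \<in> radical \<delta> m p"
proof -
  have y: "y \<in> standard m p" using assms(1) by (simp add: radical_def)
  show ?thesis
  proof (cases p)
    case 0
    then show ?thesis using assms(1) by (simp add: radical_0)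
  next
    case (Suc q)
    obtain n where n: "m = Suc (Suc n)" "i \<le> n" using assms(2) by (intro that[of "m - 2"]) auto
    have "capop \<delta> i y \<in> radical \<delta> n q" using assms(1) n unfolding Suc n(1) radical_Suc by blast
    then show ?thesis using radical_cup[OF _ n(2)] e_op_eq[OF standard_invvec[OF y]] Suc n by simp
  qed
qed

lemma R_subspace: "lc.subspace (R_rep \<delta> w)"
proof (rule lc.subspaceI)
  show "0 \<in> R_rep \<delta> w" unfolding R_iff using lc.subspace_0[OF X_subspace] by (simp add: restr_def)
  show "x + y \<in> R_rep \<delta> w" if xy: "x \<in> R_rep \<delta> w" "y \<in> R_rep \<delta> w" for x y
  proof -
    obtain n n' where "\<forall>k\<ge>n. restr k x \<in> radical \<delta> (cut w k) (ncups w (cut w k))"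
      "\<forall>k\<ge>n'. restr k y \<in> radical \<delta> (cut w k) (ncups w (cut w k))" using xy unfolding R_iff by blast
    then have "\<forall>k\<ge>max n n'. restr k (x + y) \<in> radical \<delta> (cut w k) (ncups w (cut w k))"
      by (auto simp: restr_def lin_ext_add intro: radical_add)
    then show ?thesis using xy lc.subspace_add[OF X_subspace] unfolding R_iff by blast
  qed
  show "scale c x \<in> R_rep \<delta> w" if x: "x \<in> R_rep \<delta> w" for c x
  proof -
    obtain n where "\<forall>k\<ge>n. restr k x \<in> radical \<delta> (cut w k) (ncups w (cut w k))"
      using x unfolding R_iff by blast
    then have "\<forall>k\<ge>n. restr k (scale c x) \<in> radical \<delta> (cut w k) (ncups w (cut w k))"
      by (auto simp: restr_def lin_ext_scale intro: radical_scale)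
    then show ?thesis using x lc.subspace_scale[OF X_subspace] unfolding R_iff by blast
  qed
qed

lemma R_e_op:
  assumes x: "x \<in> R_rep \<delta> w" shows "e_op \<delta> i x \<in> R_rep \<delta> w"
proof -
  obtain n where n: "\<And>k. n \<le> k \<Longrightarrow> restr k x \<in> radical \<delta> (cut w k) (ncups w (cut w k))"
    using x unfolding R_iff by blast
  have xX: "x \<in> X_rep \<delta> w" using x unfolding R_iff by blast
  then obtain m where m: "closed_at w m" "Suc (Suc i) \<le> m" "x \<in> tailed m" using X_tails tails_raise by blast
  then have ex: "e_op \<delta> i x \<in> tailed m" using e_op_tailed by simp
  have "restr k (e_op \<delta> i x) \<in> radical \<delta> (cut w k) (ncups w (cut w k))" if k: "max n m \<le> k" for k
  proof -
    let ?M = "cut w k" and ?y = "restr k x"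
    note R = tailed_restr[OF m(1) m(3), of k] and R' = tailed_restr[OF m(1) ex, of k]
    have i: "Suc i < ?M" using cut_closed(2)[of k] k m(2) by simp
    have y: "?y \<in> standard ?M (ncups w ?M)" using R(3) k by simp
    have "e_op \<delta> i x = extend w ?M (e_op \<delta> i ?y)" using e_op_extend[OF y i] R(4) k by simp
    then have "restr k (e_op \<delta> i x) = e_op \<delta> i ?y"
      using R'(2) trunc_extend[OF e_op_standard[OF y i]] k by simp
    then show ?thesis using radical_e_op[OF n i] k by simp
  qed
  then show ?thesis unfolding R_iff using X_e_op[OF xX] by blast
qed

lemma R_TL_rep: "TL_rep \<delta> (R_rep \<delta> w)"
  unfolding TL_rep_def invariant_subspace_def
proof (intro conjI ballI allI)
  show "act \<delta> a x \<in> R_rep \<delta> w" if "x \<in> R_rep \<delta> w" for a x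
    by (rule act_subspace[OF R_subspace R_e_op that])
  show "act \<delta> a x = 0" if "a \<in> tl_ideal \<delta>" "x \<in> R_rep \<delta> w" for a x
    using tl_ideal_zero[OF that(1)] that(2) X_tails R_iff by blast
qed (rule R_subspace)

lemma radical_irreducible:
  assumes "x \<in> radical \<delta> m p" "x \<noteq> 0" "y \<in> radical \<delta> m p" shows "y \<in> tlspan \<delta> m x"
proof -
  have "x \<in> standard m p" using assms(1) by (simp add: radical_def)
  then have "2 * p \<le> m" using standard_small assms(2) by (meson not_le)
  then obtain k where "m = k + 2 * p" by (metis le_add_diff_inverse2)
  then show ?thesis using Rd_irreducible assms by blast
qed

text \<open>
  Restrict both vectors to a common segment, use the irreducibility of its radical and attach the
  tail again.
\<close>

lemma R_generated:
  assumes x: "x \<in> R_rep \<delta> w" "x \<noteq> 0" and y: "y \<in> R_rep \<delta> w" and U: "invariant_subspace \<delta> U" "x \<in> U"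
  shows "y \<in> U"
proof -
  obtain n n' where n: "\<And>k. n \<le> k \<Longrightarrow> restr k x \<in> radical \<delta> (cut w k) (ncups w (cut w k))"
    "\<And>k. n' \<le> k \<Longrightarrow> restr k y \<in> radical \<delta> (cut w k) (ncups w (cut w k))" using x y unfolding R_iff by blast
  have "x \<in> tails" "y \<in> tails" using x y X_tails unfolding R_iff by blast+
  then obtain m where m: "closed_at w m" "x \<in> tailed m" "y \<in> tailed m" by (rule tails_common)
  define k where "k = max m (max n n')"
  let ?M = "cut w k" and ?x = "restr k x" and ?y = "restr k y"
  have k: "m \<le> k" by (simp add: k_def)
  note X = tailed_restr[OF m(1,2) k] and Y = tailed_restr[OF m(1,3) k]
  have r: "?x \<in> radical \<delta> ?M (ncups w ?M)" "?y \<in> radical \<delta> ?M (ncups w ?M)"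
    using n[of k] by (simp_all add: k_def)
  have "?x \<noteq> 0" using X(4) x(2) by auto
  then have "?y \<in> tlspan \<delta> ?M ?x" using radical_irreducible r by blast
  then have "?y \<in> standard ?M (ncups w ?M) \<and> extend w ?M ?y \<in> U"
  proof induction
    case base
    then show ?case using X(3,4) U(2) by simp
  next
    case (add a b)
    then show ?case using U(1) by (auto simp: invariant_subspace_def intro: standard_add lc.subspace_add)
  next
    case (scale a c)
    then show ?case using U(1) by (auto simp: invariant_subspace_def intro: standard_scale lc.subspace_scale)
  next
    case (gen a i)
    then have a: "a \<in> standard ?M (ncups w ?M)" "extend w ?M a \<in> U" by auto
    have "act \<delta> (gen i) (extend w ?M a) \<in> U" using U(1) a(2) unfolding invariant_subspace_def by blast
    then show ?case
      using e_op_extend[OF a(1) gen(2), of \<delta>] e_op_standard[OF a(1) gen(2)] e_op_eq[OF standard_invvec[OF a(1)]] by simp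
  qed
  then show ?thesis using Y(4) by simp
qed

end

theorem proposition3p3:
  fixes q \<delta> :: complex and w :: "nat \<Rightarrow> nat"
  assumes "q \<noteq> 0" and "\<delta> = q + inverse q" and "inf_link_state w"
  shows "R_rep \<delta> w = {0} \<or> TL_irreducible \<delta> (R_rep \<delta> w)"
proof (cases "R_rep \<delta> w = {0}")
  case False
  note w = assms(3)
  have "U = {0} \<or> U = R_rep \<delta> w" if U: "TL_rep \<delta> U" "U \<subseteq> R_rep \<delta> w" for U
  proof (cases "U = {0}")
    case False
    have inv: "invariant_subspace \<delta> U" using U(1) by (simp add: TL_rep_def)
    then have "0 \<in> U" using lc.subspace_0 by (auto simp: invariant_subspace_def)
    then obtain x where "x \<in> U" "x \<noteq> 0" using False by blast
    then have "R_rep \<delta> w \<subseteq> U" using R_generated[OF w _ _ _ inv] U(2) by blast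
    then show ?thesis using U(2) by blast
  qed simp
  then show ?thesis using False R_TL_rep[OF w] by (simp add: TL_irreducible_def)
qed simp

end
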